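(* Let $M=({}_xM,{}_y\alpha_x)$ be a representation of a species $\mathfrak S$. If, for each $x\in\mathsf C$, ${}_xM$ is artinian as a left module over $\mathrm{End}_{\mathrm{Rep}(\mathfrak S)}(M)$, then $M$ is a direct sum of strongly indecomposable representations of $\mathfrak S$.
   Context: $\mathsf C$ is a fixed set of arbitrary cardinality; rings are associative and unital. A species $\mathfrak S=(R_x,{}_yA_x)$ consists of a ring $R_x$ for each $x\in\mathsf C$ and an $R_y$-$R_x$-bimodule ${}_yA_x$ for each $(y,x)\in\mathsf C^2$. An $\mathfrak S$-representation $({}_xM,{}_y\alpha_x)$ consists of a left $R_x$-module ${}_xM$ for each $x\in\mathsf C$ and a left $R_y$-linear map ${}_y\alpha_x\colon {}_yA_x\otimes_{R_x}{}_xM\to{}_yM$ for each $(y,x)\in\mathsf C^2$. A morphism $({}_xf)\colon({}_xM,{}_y\alpha_x)\to({}_xN,{}_y\beta_x)$ consists of $R_x$-linear maps ${}_xf\colon{}_xM\to{}_xN$ such that ${}_y\beta_x\circ(1_{{}_yA_x}\otimes{}_xf)={}_yf\circ{}_y\alpha_x$ for all $(y,x)$. $\mathrm{Rep}(\mathfrak S)$ is the category of $\mathfrak S$-representations. The ring $\mathrm{End}_{\mathrm{Rep}(\mathfrak S)}(M)$ acts on ${}_xM$ by $f\cdot m={}_xf(m)$. An object is strongly indecomposable if its endomorphism ring is local. *)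

theory Defs
  imports "HOL-Algebra.Free_Abelian_Groups" "HOL-Algebra.Module" "HOL-Algebra.Ideal"
begin

section \<open>Modules and bimodules over noncommutative rings\<close>

text \<open>The library locale \<open>module\<close> requires a commutative ring of scalars.\<close>

locale left_module = R?: ring R + M?: abelian_group M for R and M (structure) +
  assumes smult_closed:
      "\<lbrakk>r \<in> carrier R; m \<in> carrier M\<rbrakk> \<Longrightarrow> r \<odot>\<^bsub>M\<^esub> m \<in> carrier M"
    and smult_l_distr:
      "\<lbrakk>r \<in> carrier R; s \<in> carrier R; m \<in> carrier M\<rbrakk> \<Longrightarrow>
        (r \<oplus>\<^bsub>R\<^esub> s) \<odot>\<^bsub>M\<^esub> m = r \<odot>\<^bsub>M\<^esub> m \<oplus>\<^bsub>M\<^esub> s \<odot>\<^bsub>M\<^esub> m"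
    and smult_r_distr:
      "\<lbrakk>r \<in> carrier R; m \<in> carrier M; n \<in> carrier M\<rbrakk> \<Longrightarrow>
        r \<odot>\<^bsub>M\<^esub> (m \<oplus>\<^bsub>M\<^esub> n) = r \<odot>\<^bsub>M\<^esub> m \<oplus>\<^bsub>M\<^esub> r \<odot>\<^bsub>M\<^esub> n"
    and smult_assoc:
      "\<lbrakk>r \<in> carrier R; s \<in> carrier R; m \<in> carrier M\<rbrakk> \<Longrightarrow>
        (r \<otimes>\<^bsub>R\<^esub> s) \<odot>\<^bsub>M\<^esub> m = r \<odot>\<^bsub>M\<^esub> (s \<odot>\<^bsub>M\<^esub> m)"
    and smult_one:
      "m \<in> carrier M \<Longrightarrow> \<one>\<^bsub>R\<^esub> \<odot>\<^bsub>M\<^esub> m = m"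

record ('l, 'r, 'a) bimodule = "('l, 'a) module" +
  rsmult :: "['a, 'r] \<Rightarrow> 'a"  (infixl \<open>\<odot>\<^sub>r\<index>\<close> 70)

locale bimodule = left_module L A + R?: ring R for L and R and A (structure) +
  assumes rsmult_closed:
      "\<lbrakk>a \<in> carrier A; r \<in> carrier R\<rbrakk> \<Longrightarrow> a \<odot>\<^sub>r\<^bsub>A\<^esub> r \<in> carrier A"
    and rsmult_l_distr:
      "\<lbrakk>a \<in> carrier A; b \<in> carrier A; r \<in> carrier R\<rbrakk> \<Longrightarrow>
        (a \<oplus>\<^bsub>A\<^esub> b) \<odot>\<^sub>r\<^bsub>A\<^esub> r = a \<odot>\<^sub>r\<^bsub>A\<^esub> r \<oplus>\<^bsub>A\<^esub> b \<odot>\<^sub>r\<^bsub>A\<^esub> r"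
    and rsmult_r_distr:
      "\<lbrakk>a \<in> carrier A; r \<in> carrier R; s \<in> carrier R\<rbrakk> \<Longrightarrow>
        a \<odot>\<^sub>r\<^bsub>A\<^esub> (r \<oplus>\<^bsub>R\<^esub> s) = a \<odot>\<^sub>r\<^bsub>A\<^esub> r \<oplus>\<^bsub>A\<^esub> a \<odot>\<^sub>r\<^bsub>A\<^esub> s"
    and rsmult_assoc:
      "\<lbrakk>a \<in> carrier A; r \<in> carrier R; s \<in> carrier R\<rbrakk> \<Longrightarrow>
        a \<odot>\<^sub>r\<^bsub>A\<^esub> (r \<otimes>\<^bsub>R\<^esub> s) = (a \<odot>\<^sub>r\<^bsub>A\<^esub> r) \<odot>\<^sub>r\<^bsub>A\<^esub> s"
    and rsmult_one:
      "a \<in> carrier A \<Longrightarrow> a \<odot>\<^sub>r\<^bsub>A\<^esub> \<one>\<^bsub>R\<^esub> = a"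
    and smult_rsmult:
      "\<lbrakk>l \<in> carrier L; a \<in> carrier A; r \<in> carrier R\<rbrakk> \<Longrightarrow>
        (l \<odot>\<^bsub>A\<^esub> a) \<odot>\<^sub>r\<^bsub>A\<^esub> r = l \<odot>\<^bsub>A\<^esub> (a \<odot>\<^sub>r\<^bsub>A\<^esub> r)"

text \<open>A module record built from an abelian group in multiplicative notation and a
  scalar action; the ring multiplication and unit of a module record carry no meaning.\<close>

definition module_of ::
    "('m, 'z) monoid_scheme \<Rightarrow> ('s \<Rightarrow> 'm \<Rightarrow> 'm) \<Rightarrow> ('s, 'm) module" where
  "module_of G act =
    \<lparr>carrier = carrier G, mult = undefined, one = undefined,
     zero = \<one>\<^bsub>G\<^esub>, add = (\<lambda>m n. m \<otimes>\<^bsub>G\<^esub> n), smult = act\<rparr>"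

definition left_linear_maps ::
    "('r, 'y) ring_scheme \<Rightarrow> ('r, 'm, 'z) module_scheme \<Rightarrow> ('r, 'n, 'w) module_scheme
      \<Rightarrow> ('m \<Rightarrow> 'n) set" where
  "left_linear_maps R M N =
    {f \<in> hom (add_monoid M) (add_monoid N).
      \<forall>r\<in>carrier R. \<forall>m\<in>carrier M. f (r \<odot>\<^bsub>M\<^esub> m) = r \<odot>\<^bsub>N\<^esub> f m}"

definition artinian_module ::
    "('r, 'y) ring_scheme \<Rightarrow> ('r, 'm, 'z) module_scheme \<Rightarrow> bool" where
  "artinian_module R M \<longleftrightarrow>
    (\<forall>N :: nat \<Rightarrow> 'm set. (\<forall>n. submodule (N n) R M) \<and> (\<forall>n. N (Suc n) \<subseteq> N n)
      \<longrightarrow> (\<exists>n. \<forall>k\<ge>n. N k = N n))"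

text \<open>A (not necessarily commutative) ring is local if its non-units form an ideal.
  This excludes the zero ring, where the empty set of non-units is not an ideal.\<close>

definition local_ring :: "('r, 'z) ring_scheme \<Rightarrow> bool" where
  "local_ring R \<longleftrightarrow> ideal (carrier R - Units R) R"


section \<open>Tensor products\<close>

text \<open>For a right \<open>R\<close>-module \<open>A\<close> and a left \<open>R\<close>-module \<open>M\<close>, the group \<open>A \<otimes>\<^sub>R M\<close> is the
  free abelian group on \<open>A \<times> M\<close> modulo the subgroup \<open>tensor_null R A M\<close>; its elements
  are cosets, the pure tensor of \<open>a\<close> and \<open>m\<close> being the coset of \<open>frag_of (a, m)\<close>.\<close>

abbreviation tensor_free ::
    "('l, 'r, 'a, 'z) bimodule_scheme \<Rightarrow> ('r, 'm, 'w) module_scheme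
      \<Rightarrow> ('a \<times> 'm \<Rightarrow>\<^sub>0 int) monoid" where
  "tensor_free A M \<equiv> free_Abelian_group (carrier A \<times> carrier M)"

definition tensor_null ::
    "('r, 'y) ring_scheme \<Rightarrow> ('l, 'r, 'a, 'z) bimodule_scheme
      \<Rightarrow> ('r, 'm, 'w) module_scheme \<Rightarrow> ('a \<times> 'm \<Rightarrow>\<^sub>0 int) set" where
  "tensor_null R A M = generate (tensor_free A M)
    ({frag_of (a \<oplus>\<^bsub>A\<^esub> b, m) - frag_of (a, m) - frag_of (b, m) | a b m.
        a \<in> carrier A \<and> b \<in> carrier A \<and> m \<in> carrier M} \<union>
     {frag_of (a, m \<oplus>\<^bsub>M\<^esub> n) - frag_of (a, m) - frag_of (a, n) | a m n.
        a \<in> carrier A \<and> m \<in> carrier M \<and> n \<in> carrier M} \<union>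
     {frag_of (a \<odot>\<^sub>r\<^bsub>A\<^esub> r, m) - frag_of (a, r \<odot>\<^bsub>M\<^esub> m) | a r m.
        a \<in> carrier A \<and> r \<in> carrier R \<and> m \<in> carrier M})"

text \<open>The map \<open>g \<otimes> h\<close> into \<open>B \<otimes>\<^sub>R N\<close>, for \<open>g\<close> and \<open>h\<close> linear over \<open>R\<close>: all representatives \<open>u\<close> of
  the argument coset give the same coset, so the union is that coset.\<close>

definition tensor_map ::
    "('r, 'y) ring_scheme \<Rightarrow> ('l, 'r, 'b, 'z) bimodule_scheme
      \<Rightarrow> ('r, 'n, 'w) module_scheme \<Rightarrow> ('a \<Rightarrow> 'b) \<Rightarrow> ('m \<Rightarrow> 'n)
      \<Rightarrow> ('a \<times> 'm \<Rightarrow>\<^sub>0 int) set \<Rightarrow> ('b \<times> 'n \<Rightarrow>\<^sub>0 int) set" where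
  "tensor_map R B N g h T =
    (\<Union>u\<in>T. tensor_null R B N #>\<^bsub>tensor_free B N\<^esub>
        frag_extend (\<lambda>(a, m). frag_of (g a, h m)) u)"

text \<open>\<open>A \<otimes>\<^sub>R M\<close> as a left module, with the action coming from the left action on the
  bimodule \<open>A\<close>.\<close>

definition tensor ::
    "('r, 'y) ring_scheme \<Rightarrow> ('l, 'r, 'a, 'z) bimodule_scheme
      \<Rightarrow> ('r, 'm, 'w) module_scheme \<Rightarrow> ('l, ('a \<times> 'm \<Rightarrow>\<^sub>0 int) set) module" where
  "tensor R A M = module_of (tensor_free A M Mod tensor_null R A M)
    (\<lambda>l. tensor_map R A M (\<lambda>a. l \<odot>\<^bsub>A\<^esub> a) (\<lambda>m. m))"


section \<open>Species and their representations\<close>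

text \<open>\<open>Bim S y x\<close> is the bimodule written \<open>\<^sub>yA\<^sub>x\<close>. All rings of a species share one
  carrier type, and so do all bimodules; this is no restriction, since carriers are
  arbitrary subsets of the type.\<close>

record ('c, 'r, 'a) species =
  Idx :: "'c set"
  Rng :: "'c \<Rightarrow> 'r ring"
  Bim :: "'c \<Rightarrow> 'c \<Rightarrow> ('r, 'r, 'a) bimodule"

definition is_species :: "('c, 'r, 'a) species \<Rightarrow> bool" where
  "is_species S \<longleftrightarrow>
    (\<forall>x\<in>Idx S. ring (Rng S x)) \<and>
    (\<forall>y\<in>Idx S. \<forall>x\<in>Idx S. bimodule (Rng S y) (Rng S x) (Bim S y x))"

record ('c, 'r, 'a, 'm) representation =
  Mod_at :: "'c \<Rightarrow> ('r, 'm) module"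
  Map_at :: "'c \<Rightarrow> 'c \<Rightarrow> ('a \<times> 'm \<Rightarrow>\<^sub>0 int) set \<Rightarrow> 'm"

definition tensor_at ::
    "('c, 'r, 'a) species \<Rightarrow> ('c, 'r, 'a, 'm) representation \<Rightarrow> 'c \<Rightarrow> 'c
      \<Rightarrow> ('r, ('a \<times> 'm \<Rightarrow>\<^sub>0 int) set) module" where
  "tensor_at S M y x = tensor (Rng S x) (Bim S y x) (Mod_at M x)"

definition is_representation ::
    "('c, 'r, 'a) species \<Rightarrow> ('c, 'r, 'a, 'm) representation \<Rightarrow> bool" where
  "is_representation S M \<longleftrightarrow>
    (\<forall>x\<in>Idx S. left_module (Rng S x) (Mod_at M x)) \<and>
    (\<forall>y\<in>Idx S. \<forall>x\<in>Idx S.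
      Map_at M y x \<in> left_linear_maps (Rng S y) (tensor_at S M y x) (Mod_at M y))"

text \<open>The map \<open>1 \<otimes> f\<close> from \<open>\<^sub>yA\<^sub>x \<otimes> \<^sub>xM\<close> to \<open>\<^sub>yA\<^sub>x \<otimes> \<^sub>xN\<close>.\<close>

definition one_tensor ::
    "('c, 'r, 'a) species \<Rightarrow> ('c, 'r, 'a, 'n) representation \<Rightarrow> 'c \<Rightarrow> 'c \<Rightarrow> ('m \<Rightarrow> 'n)
      \<Rightarrow> ('a \<times> 'm \<Rightarrow>\<^sub>0 int) set \<Rightarrow> ('a \<times> 'n \<Rightarrow>\<^sub>0 int) set" where
  "one_tensor S N y x f = tensor_map (Rng S x) (Bim S y x) (Mod_at N x) (\<lambda>a. a) f"

text \<open>Morphisms are made extensional (\<open>undefined\<close> off the index set and off the carriers),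
  so that equality of HOL functions is equality of morphisms.\<close>

definition rep_hom ::
    "('c, 'r, 'a) species \<Rightarrow> ('c, 'r, 'a, 'm) representation
      \<Rightarrow> ('c, 'r, 'a, 'n) representation \<Rightarrow> ('c \<Rightarrow> 'm \<Rightarrow> 'n) set" where
  "rep_hom S M N =
    {f \<in> (\<Pi>\<^sub>E x\<in>Idx S. left_linear_maps (Rng S x) (Mod_at M x) (Mod_at N x)
                        \<inter> extensional (carrier (Mod_at M x))).
      \<forall>y\<in>Idx S. \<forall>x\<in>Idx S. \<forall>t\<in>carrier (tensor_at S M y x).
        Map_at N y x (one_tensor S N y x (f x) t) = f y (Map_at M y x t)}"

definition rep_id ::
    "('c, 'r, 'a) species \<Rightarrow> ('c, 'r, 'a, 'm) representation \<Rightarrow> 'c \<Rightarrow> 'm \<Rightarrow> 'm" where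
  "rep_id S M = (\<lambda>x\<in>Idx S. \<lambda>m\<in>carrier (Mod_at M x). m)"

definition rep_comp ::
    "('c, 'r, 'a) species \<Rightarrow> ('c, 'r, 'a, 'm) representation
      \<Rightarrow> ('c \<Rightarrow> 'n \<Rightarrow> 'p) \<Rightarrow> ('c \<Rightarrow> 'm \<Rightarrow> 'n) \<Rightarrow> 'c \<Rightarrow> 'm \<Rightarrow> 'p" where
  "rep_comp S M g f = (\<lambda>x\<in>Idx S. compose (carrier (Mod_at M x)) (g x) (f x))"

definition rep_iso ::
    "('c, 'r, 'a) species \<Rightarrow> ('c, 'r, 'a, 'm) representation
      \<Rightarrow> ('c, 'r, 'a, 'n) representation \<Rightarrow> bool" where
  "rep_iso S M N \<longleftrightarrow>
    (\<exists>f\<in>rep_hom S M N. \<exists>g\<in>rep_hom S N M.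
      rep_comp S M g f = rep_id S M \<and> rep_comp S N f g = rep_id S N)"

definition rep_End ::
    "('c, 'r, 'a) species \<Rightarrow> ('c, 'r, 'a, 'm) representation \<Rightarrow> ('c \<Rightarrow> 'm \<Rightarrow> 'm) ring" where
  "rep_End S M =
    \<lparr>carrier = rep_hom S M M,
     mult = rep_comp S M,
     one = rep_id S M,
     zero = (\<lambda>x\<in>Idx S. \<lambda>m\<in>carrier (Mod_at M x). \<zero>\<^bsub>Mod_at M x\<^esub>),
     add = (\<lambda>f g. \<lambda>x\<in>Idx S. \<lambda>m\<in>carrier (Mod_at M x). f x m \<oplus>\<^bsub>Mod_at M x\<^esub> g x m)\<rparr>"

text \<open>\<open>\<^sub>xM\<close> as a left module over the endomorphism ring of \<open>M\<close>.\<close>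

definition End_module ::
    "('c, 'r, 'a, 'm) representation \<Rightarrow> 'c \<Rightarrow> ('c \<Rightarrow> 'm \<Rightarrow> 'm, 'm) module" where
  "End_module M x = module_of (add_monoid (Mod_at M x)) (\<lambda>f m. f x m)"

definition strongly_indecomposable ::
    "('c, 'r, 'a) species \<Rightarrow> ('c, 'r, 'a, 'm) representation \<Rightarrow> bool" where
  "strongly_indecomposable S M \<longleftrightarrow> local_ring (rep_End S M)"

text \<open>The direct sum is formed vertexwise from finitely supported families. Its structure
  maps act componentwise: the \<open>i\<close>-th component of the image of a tensor \<open>t\<close> is obtained by
  applying \<open>1 \<otimes> \<pi>\<^sub>i\<close> (the \<open>i\<close>-th projection) and then the structure map of \<open>N i\<close>.\<close>

definition rep_direct_sum ::
    "('c, 'r, 'a) species \<Rightarrow> 'i set \<Rightarrow> ('i \<Rightarrow> ('c, 'r, 'a, 'm) representation)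
      \<Rightarrow> ('c, 'r, 'a, 'i \<Rightarrow> 'm) representation" where
  "rep_direct_sum S I N =
    \<lparr>Mod_at = (\<lambda>x. module_of (sum_group I (\<lambda>i. add_monoid (Mod_at (N i) x)))
                     (\<lambda>r v. \<lambda>i\<in>I. r \<odot>\<^bsub>Mod_at (N i) x\<^esub> v i)),
     Map_at = (\<lambda>y x t. \<lambda>i\<in>I. Map_at (N i) y x (one_tensor S (N i) y x (\<lambda>v. v i) t))\<rparr>"

end

theory Submission
  imports Defs "HOL-Algebra.QuotRing"
begin

text \<open>
  For the topology of pointwise convergence, in which annihilators of finite sets are the
  basic neighbourhoods of \<open>0\<close>, the endomorphism ring \<open>E\<close> of \<open>M\<close> is complete, and it is
  strictly linearly compact as a left module over itself because the \<open>\<^sub>xM\<close> are artinian: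
  closed affine subsets with the finite intersection property have a common point.
  Linear compactness has three uses. Minimal closed left ideals together with an
  Ellis--Numakura argument yield, below each nonzero idempotent \<open>g\<close>, an idempotent \<open>e = eg\<close>
  with \<open>eEe\<close> local. An independent family of such idempotents \<open>s\<close> admits global coordinate
  endomorphisms. And the sum \<open>N\<close> of the images \<open>sM\<close>, being locally split in \<open>M\<close>, is a direct
  summand, since \<open>N\<close> is again artinian over its own operators. For a maximal independent
  family the complement of \<open>N\<close> contains no further local idempotent, so \<open>N = M\<close> and \<open>M\<close> is
  the direct sum of the images \<open>sM\<close>, whose endomorphism rings are the corners \<open>sEs\<close>.
\<close>

section \<open>Rings of operators on artinian modules\<close>

text \<open>The obstacle is that neither \<open>E\<close> nor \<open>M\<close> need satisfy a global
  chain condition: with infinitely many vertices, chains stabilise only one vertex at a time, and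
  Fitting-type arguments with powers of one endomorphism have no uniform end. The chain condition is
  therefore spent in one place, \<open>affine_in_min\<close>, on cosets inside a single
  \<open>V x\<close>; everything else receives it through that lemma or through linear compactness.
  One-sidedness shapes the rest. A minimal left ideal controls multiplication by g from the right
  only, so e = eg is obtained but ge = e is not. A new idempotent e satisfies es = 0 for the earlier
  s, while se may be nonzero; the family is not orthogonal. Independence is hence phrased by
  auxiliary operators p with ps = s and pt = 0, and the final coordinates are products of s with
  such an operator instead of s itself. Species and tensor products are absent from this argument.
  They return to show that \<open>E\<close> is complete and to identify sEs with the endomorphism
  ring of the image of s.\<close>

lemma (in abelian_group) add_diff_cancel:
  "\<lbrakk>x \<in> carrier G; y \<in> carrier G\<rbrakk> \<Longrightarrow> x \<oplus> (y \<ominus> x) = y"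
  by (simp add: minus_eq a_lcomm[of x y] r_neg)

lemma (in abelian_group) add_diff_cancel2:
  "\<lbrakk>x \<in> carrier G; y \<in> carrier G\<rbrakk> \<Longrightarrow> (x \<oplus> y) \<ominus> x = y"
  by (simp add: minus_eq a_assoc a_comm[of y] r_neg2)

lemma (in abelian_group) diff_eq_zero_iff:
  assumes "x \<in> carrier G" "y \<in> carrier G"
  shows "x \<ominus> y = \<zero> \<longleftrightarrow> x = y"
proof
  assume "x \<ominus> y = \<zero>"
  then show "x = y" using add_diff_cancel[of y x] assms by simp
qed (use assms in \<open>simp add: minus_eq r_neg\<close>)

section \<open>Scalar arithmetic and submodules over noncommutative rings\<close>

context left_module
begin

lemma smult_r_null [simp]: "r \<in> carrier R \<Longrightarrow> r \<odot>\<^bsub>M\<^esub> \<zero>\<^bsub>M\<^esub> = \<zero>\<^bsub>M\<^esub>"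
  using smult_r_distr[of r "\<zero>\<^bsub>M\<^esub>" "\<zero>\<^bsub>M\<^esub>"] smult_closed[of r "\<zero>\<^bsub>M\<^esub>"]
  by (simp add: M.add.l_cancel_one')

lemma smult_l_null [simp]: "m \<in> carrier M \<Longrightarrow> \<zero>\<^bsub>R\<^esub> \<odot>\<^bsub>M\<^esub> m = \<zero>\<^bsub>M\<^esub>"
  using smult_l_distr[of "\<zero>\<^bsub>R\<^esub>" "\<zero>\<^bsub>R\<^esub>" m] smult_closed[of "\<zero>\<^bsub>R\<^esub>" m]
  by (simp add: M.add.l_cancel_one')

lemma smult_l_uminus:
  "\<lbrakk>r \<in> carrier R; m \<in> carrier M\<rbrakk> \<Longrightarrow> (\<ominus>\<^bsub>R\<^esub> r) \<odot>\<^bsub>M\<^esub> m = \<ominus>\<^bsub>M\<^esub> (r \<odot>\<^bsub>M\<^esub> m)"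
  by (rule M.minus_equality[symmetric])
    (simp_all add: smult_closed smult_l_distr[symmetric] R.l_neg)

lemma smult_r_uminus:
  "\<lbrakk>r \<in> carrier R; m \<in> carrier M\<rbrakk> \<Longrightarrow> r \<odot>\<^bsub>M\<^esub> (\<ominus>\<^bsub>M\<^esub> m) = \<ominus>\<^bsub>M\<^esub> (r \<odot>\<^bsub>M\<^esub> m)"
  by (rule M.minus_equality[symmetric])
    (simp_all add: smult_closed smult_r_distr[symmetric] M.l_neg)

lemma smult_l_diff:
  "\<lbrakk>r \<in> carrier R; s \<in> carrier R; m \<in> carrier M\<rbrakk> \<Longrightarrow>
    (r \<ominus>\<^bsub>R\<^esub> s) \<odot>\<^bsub>M\<^esub> m = r \<odot>\<^bsub>M\<^esub> m \<ominus>\<^bsub>M\<^esub> s \<odot>\<^bsub>M\<^esub> m"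
  by (simp add: R.minus_eq M.minus_eq smult_l_distr smult_l_uminus)

lemma smult_r_diff:
  "\<lbrakk>r \<in> carrier R; m \<in> carrier M; n \<in> carrier M\<rbrakk> \<Longrightarrow>
    r \<odot>\<^bsub>M\<^esub> (m \<ominus>\<^bsub>M\<^esub> n) = r \<odot>\<^bsub>M\<^esub> m \<ominus>\<^bsub>M\<^esub> r \<odot>\<^bsub>M\<^esub> n"
  by (simp add: M.minus_eq smult_r_distr smult_r_uminus)

end

lemma (in left_module) submoduleI:
  assumes "H \<subseteq> carrier M" "\<zero>\<^bsub>M\<^esub> \<in> H"
    and "\<And>a b. \<lbrakk>a \<in> H; b \<in> H\<rbrakk> \<Longrightarrow> a \<ominus>\<^bsub>M\<^esub> b \<in> H"
    and "\<And>a x. \<lbrakk>a \<in> carrier R; x \<in> H\<rbrakk> \<Longrightarrow> a \<odot>\<^bsub>M\<^esub> x \<in> H"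
  shows "submodule H R M"
proof -
  have inv: "\<ominus>\<^bsub>M\<^esub> a \<in> H" if "a \<in> H" for a
    using assms(3)[OF assms(2) that] that assms(1) by (auto simp: M.minus_eq)
  have add: "a \<oplus>\<^bsub>M\<^esub> b \<in> H" if "a \<in> H" "b \<in> H" for a b
    using assms(3)[OF that(1) inv[OF that(2)]] that assms(1) by (auto simp: M.minus_eq)
  show ?thesis
    by (intro submodule.intro submodule_axioms.intro M.add.subgroupI)
      (use assms inv add in \<open>auto simp: a_inv_def\<close>)
qed

text \<open>The abstract form of an endomorphism ring acting on all vertex modules at once.
  \<open>complete\<close> says that \<open>E\<close> is closed among all families of self-maps of
  the \<open>G x\<close>: a prescription \<phi> that can be matched on every finite set of points by
  an operator is itself an operator. Together with \<open>faithful\<close> this lets operators be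
  built value by value.\<close>

locale operator_ring = ring E for E (structure) +
  fixes X :: "'x set" and G :: "'x \<Rightarrow> ('e, 'm) module"
  assumes left_module: "x \<in> X \<Longrightarrow> left_module E (G x)"
    and faithful: "\<lbrakk>f \<in> carrier E; g \<in> carrier E;
        \<And>x v. \<lbrakk>x \<in> X; v \<in> carrier (G x)\<rbrakk> \<Longrightarrow> f \<odot>\<^bsub>G x\<^esub> v = g \<odot>\<^bsub>G x\<^esub> v\<rbrakk> \<Longrightarrow> f = g"
    and complete: "\<lbrakk>\<And>x v. \<lbrakk>x \<in> X; v \<in> carrier (G x)\<rbrakk> \<Longrightarrow> \<phi> x v \<in> carrier (G x);
        \<And>P. \<lbrakk>finite P; P \<subseteq> (SIGMA x:X. carrier (G x))\<rbrakk> \<Longrightarrow>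
          \<exists>f\<in>carrier E. \<forall>(x, v)\<in>P. f \<odot>\<^bsub>G x\<^esub> v = \<phi> x v\<rbrakk>
      \<Longrightarrow> \<exists>f\<in>carrier E. \<forall>x\<in>X. \<forall>v\<in>carrier (G x). f \<odot>\<^bsub>G x\<^esub> v = \<phi> x v"
    and artinian: "x \<in> X \<Longrightarrow> artinian_module E (G x)"
begin

abbreviation V where "V x \<equiv> carrier (G x)"
abbreviation act where "act x f v \<equiv> f \<odot>\<^bsub>G x\<^esub> v"

lemma mod_abelian: "x \<in> X \<Longrightarrow> abelian_group (G x)"
  using left_module left_module.axioms(2) by blast

lemmas act_closed [simp, intro] = left_module.smult_closed[OF left_module]
lemmas act_zero [simp] = left_module.smult_r_null[OF left_module]
lemmas zero_act [simp] = left_module.smult_l_null[OF left_module]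
lemmas one_act [simp] = left_module.smult_one[OF left_module]
lemmas add_act = left_module.smult_l_distr[OF left_module]
lemmas diff_act = left_module.smult_l_diff[OF left_module]
lemmas act_diff = left_module.smult_r_diff[OF left_module]
lemmas mult_act = left_module.smult_assoc[OF left_module]

section \<open>Affine and closed sets of operators\<close>

definition subgroups where
  "subgroups N \<longleftrightarrow> (\<forall>x\<in>X. N x \<subseteq> V x \<and> \<zero>\<^bsub>G x\<^esub> \<in> N x \<and> (\<forall>u\<in>N x. \<forall>v\<in>N x. u \<ominus>\<^bsub>G x\<^esub> v \<in> N x))"

text \<open>For a family N of subgroups this is a right ideal of \<open>E\<close> on which the ring
  \<open>stab N\<close> acts from the left. Linear compactness is proved for it in this generality:
  N = \<open>V\<close> gives \<open>E\<close> itself, and smaller N give the splitting of the sum of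
  images.\<close>

definition into where
  "into N = {f \<in> carrier E. \<forall>x\<in>X. \<forall>v\<in>V x. act x f v \<in> N x}"

definition stab where
  "stab N = {f \<in> carrier E. \<forall>x\<in>X. \<forall>v\<in>N x. act x f v \<in> N x}"

text \<open>A retraction onto N is asked for on finite sets only. This is what a directed union of
  direct summands satisfies at once, while a single retraction has to be produced by
  compactness.\<close>

definition locally_split where
  "locally_split N \<longleftrightarrow> subgroups N \<and>
    (\<forall>P. finite P \<and> P \<subseteq> Sigma X N \<longrightarrow> (\<exists>a\<in>into N. \<forall>(x, v)\<in>P. act x a v = v))"

text \<open>For a family N of subgroups these are the cosets of left
  \<open>stab N\<close>-submodules of \<open>into N\<close>, together with the empty set. The
  ternary closure condition names no base point and no direction submodule, so it passes to
  intersections without a case split on emptiness.\<close>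

definition affine where
  "affine N C \<longleftrightarrow> C \<subseteq> into N \<and>
    (\<forall>f\<in>C. \<forall>g\<in>C. \<forall>h\<in>C. \<forall>r\<in>stab N. f \<oplus> r \<otimes> (g \<ominus> h) \<in> C)"

text \<open>Closed in the topology of pointwise convergence on discrete modules.\<close>

definition closed where
  "closed C \<longleftrightarrow> C \<subseteq> carrier E \<and> (\<forall>f\<in>carrier E.
    (\<forall>P. finite P \<and> P \<subseteq> Sigma X V \<longrightarrow> (\<exists>g\<in>C. \<forall>(x, v)\<in>P. act x f v = act x g v)) \<longrightarrow> f \<in> C)"

text \<open>The same notion for values instead of operators. Emptiness is excluded here because the
  chain argument chooses base points.\<close>

definition affine_in where
  "affine_in N x Z \<longleftrightarrow> Z \<subseteq> N x \<and> Z \<noteq> {} \<and>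
    (\<forall>u\<in>Z. \<forall>v\<in>Z. \<forall>w\<in>Z. \<forall>r\<in>stab N. u \<oplus>\<^bsub>G x\<^esub> act x r (v \<ominus>\<^bsub>G x\<^esub> w) \<in> Z)"

lemma into_carrier: "into N \<subseteq> carrier E" and stab_carrier: "stab N \<subseteq> carrier E"
  by (auto simp: into_def stab_def)

lemma subgroupsD:
  assumes "subgroups N" "x \<in> X"
  shows "N x \<subseteq> V x" "\<zero>\<^bsub>G x\<^esub> \<in> N x"
    "\<lbrakk>u \<in> N x; v \<in> N x\<rbrakk> \<Longrightarrow> u \<ominus>\<^bsub>G x\<^esub> v \<in> N x"
    "\<lbrakk>u \<in> N x; v \<in> N x\<rbrakk> \<Longrightarrow> u \<oplus>\<^bsub>G x\<^esub> v \<in> N x"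
proof -
  interpret M: abelian_group "G x" using mod_abelian assms by blast
  show *: "N x \<subseteq> V x" "\<zero>\<^bsub>G x\<^esub> \<in> N x"
    and **: "\<And>u v. \<lbrakk>u \<in> N x; v \<in> N x\<rbrakk> \<Longrightarrow> u \<ominus>\<^bsub>G x\<^esub> v \<in> N x"
    using assms by (auto simp: subgroups_def)
  show "u \<oplus>\<^bsub>G x\<^esub> v \<in> N x" if "u \<in> N x" "v \<in> N x"
  proof -
    have "u \<ominus>\<^bsub>G x\<^esub> (\<zero>\<^bsub>G x\<^esub> \<ominus>\<^bsub>G x\<^esub> v) \<in> N x" using * ** that by blast
    then show ?thesis using * that by (auto simp: M.minus_eq subset_iff)
  qed
qed

lemma into_subset_stab: "subgroups N \<Longrightarrow> into N \<subseteq> stab N"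
  using subgroupsD(1) by (fastforce simp: into_def stab_def)

lemma one_in_stab [simp]: "subgroups N \<Longrightarrow> \<one> \<in> stab N"
  using subgroupsD(1)[THEN subsetD] by (auto simp: stab_def)

lemma into_mult: "\<lbrakk>a \<in> into N; f \<in> carrier E\<rbrakk> \<Longrightarrow> a \<otimes> f \<in> into N"
  by (auto simp: into_def mult_act)

lemma into_affine:
  assumes N: "subgroups N" and f: "f \<in> into N" and g: "g \<in> into N" and h: "h \<in> into N"
    and r: "r \<in> stab N"
  shows "f \<oplus> r \<otimes> (g \<ominus> h) \<in> into N"
proof -
  have c: "f \<in> carrier E" "g \<in> carrier E" "h \<in> carrier E" "r \<in> carrier E"
    using f g h r by (auto simp: into_def stab_def)
  have "act x (f \<oplus> r \<otimes> (g \<ominus> h)) v \<in> N x" if "x \<in> X" "v \<in> V x" for x v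
  proof -
    have "act x f v \<in> N x" "act x g v \<ominus>\<^bsub>G x\<^esub> act x h v \<in> N x"
      using f g h that by (auto simp: into_def intro: subgroupsD(3)[OF N])
    moreover from this have "act x r (act x g v \<ominus>\<^bsub>G x\<^esub> act x h v) \<in> N x"
      using r that by (auto simp: stab_def)
    ultimately show ?thesis
      using c that by (simp add: add_act mult_act diff_act subgroupsD(4)[OF N])
  qed
  then show ?thesis using c by (simp add: into_def)
qed

text \<open>The correction term r(g - h) vanishes at v as soon as g and h agree there. These fibres
  of evaluation are the sets by which values are prescribed in every compactness argument
  below.\<close>

lemma affine_single:
  assumes N: "subgroups N" and "x \<in> X" "v \<in> V x"
  shows "affine N {f \<in> into N. act x f v = w}"
  unfolding affine_def
proof (intro conjI ballI)
  fix f g h r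
  assume f: "f \<in> {f \<in> into N. act x f v = w}" and g: "g \<in> {f \<in> into N. act x f v = w}"
    and h: "h \<in> {f \<in> into N. act x f v = w}" and r: "r \<in> stab N"
  interpret M: abelian_group "G x" using mod_abelian assms by blast
  have c: "f \<in> carrier E" "g \<in> carrier E" "h \<in> carrier E" "r \<in> carrier E"
    using f g h r by (auto simp: into_def stab_def)
  have "f \<oplus> r \<otimes> (g \<ominus> h) \<in> into N"
    using into_affine[OF N] f g h r by blast
  moreover have "act x (f \<oplus> r \<otimes> (g \<ominus> h)) v = w"
    using f g h c assms by (auto simp: add_act mult_act diff_act M.minus_eq M.r_neg)
  ultimately show "f \<oplus> r \<otimes> (g \<ominus> h) \<in> {f \<in> into N. act x f v = w}" by blast
qed auto

lemma affine_Int: "\<lbrakk>affine N C; affine N D\<rbrakk> \<Longrightarrow> affine N (C \<inter> D)"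
  by (auto simp: affine_def)

lemma affine_Inter: "\<lbrakk>\<And>C. C \<in> \<C> \<Longrightarrow> affine N C; \<C> \<noteq> {}\<rbrakk> \<Longrightarrow> affine N (\<Inter>\<C>)"
  by (fastforce simp: affine_def)

lemma closedD:
  assumes "closed C" "f \<in> carrier E"
    and "\<And>P. \<lbrakk>finite P; P \<subseteq> Sigma X V\<rbrakk> \<Longrightarrow> \<exists>g\<in>C. \<forall>(x, v)\<in>P. act x f v = act x g v"
  shows "f \<in> C"
  using assms by (simp add: closed_def)

lemma closed_Inter:
  assumes "\<And>C. C \<in> \<C> \<Longrightarrow> closed C" "\<C> \<noteq> {}"
  shows "closed (\<Inter>\<C>)"
  unfolding closed_def
proof (intro conjI ballI impI InterI)
  show "\<Inter>\<C> \<subseteq> carrier E" using assms by (auto simp: closed_def)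
next
  fix f C assume f: "f \<in> carrier E" and C: "C \<in> \<C>"
    and *: "\<forall>P. finite P \<and> P \<subseteq> Sigma X V \<longrightarrow> (\<exists>g\<in>\<Inter>\<C>. \<forall>(x, v)\<in>P. act x f v = act x g v)"
  show "f \<in> C"
  proof (rule closedD[OF assms(1)[OF C] f])
    fix P assume "finite P" "P \<subseteq> Sigma X V"
    then obtain g where "g \<in> \<Inter>\<C>" "\<forall>(x, v)\<in>P. act x f v = act x g v" using * by blast
    then show "\<exists>g\<in>C. \<forall>(x, v)\<in>P. act x f v = act x g v" using C by blast
  qed
qed

lemma closed_Int: "\<lbrakk>closed C; closed D\<rbrakk> \<Longrightarrow> closed (C \<inter> D)"
  using closed_Inter[of "{C, D}"] by auto

lemma affine_into: "subgroups N \<Longrightarrow> affine N (into N)"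
  unfolding affine_def using into_affine by blast

lemma closed_pointwise:
  assumes "\<And>x v. \<lbrakk>x \<in> X; v \<in> V x\<rbrakk> \<Longrightarrow> T x v \<subseteq> V x"
  shows "closed {f \<in> carrier E. \<forall>x\<in>X. \<forall>v\<in>V x. act x f v \<in> T x v}"
  unfolding closed_def
proof (intro conjI ballI impI)
  fix f assume f: "f \<in> carrier E" and *: "\<forall>P. finite P \<and> P \<subseteq> Sigma X V \<longrightarrow>
     (\<exists>g\<in>{f \<in> carrier E. \<forall>x\<in>X. \<forall>v\<in>V x. act x f v \<in> T x v}. \<forall>(x, v)\<in>P. act x f v = act x g v)"
  have "act x f v \<in> T x v" if "x \<in> X" "v \<in> V x" for x v
    using *[rule_format, of "{(x, v)}"] that by auto
  then show "f \<in> {f \<in> carrier E. \<forall>x\<in>X. \<forall>v\<in>V x. act x f v \<in> T x v}" using f by auto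
qed auto

lemma closed_single:
  assumes "x \<in> X" "v \<in> V x"
  shows "closed {f \<in> carrier E. act x f v = w}"
  unfolding closed_def
proof (intro conjI ballI impI)
  fix f assume f: "f \<in> carrier E" and *: "\<forall>P. finite P \<and> P \<subseteq> Sigma X V \<longrightarrow>
     (\<exists>g\<in>{f \<in> carrier E. act x f v = w}. \<forall>(x, v)\<in>P. act x f v = act x g v)"
  show "f \<in> {f \<in> carrier E. act x f v = w}"
    using *[rule_format, of "{(x, v)}"] assms f by auto
qed auto

lemma closed_into: "subgroups N \<Longrightarrow> closed (into N)"
  unfolding into_def by (rule closed_pointwise) (simp add: subgroupsD(1))

text \<open>Through this correspondence \<open>N x\<close> inherits the descending chain condition from \<open>G x\<close>.\<close>

lemma stab_submodule_trace:
  assumes N: "locally_split N" and x: "x \<in> X"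
    and Z: "Z \<subseteq> N x" "\<zero>\<^bsub>G x\<^esub> \<in> Z" "\<And>u v. \<lbrakk>u \<in> Z; v \<in> Z\<rbrakk> \<Longrightarrow> u \<ominus>\<^bsub>G x\<^esub> v \<in> Z"
      "\<And>r v. \<lbrakk>r \<in> stab N; v \<in> Z\<rbrakk> \<Longrightarrow> act x r v \<in> Z"
  shows "submodule {v \<in> V x. \<forall>a\<in>into N. act x a v \<in> Z} E (G x)"
    and "{v \<in> V x. \<forall>a\<in>into N. act x a v \<in> Z} \<inter> N x = Z"
proof -
  have sub: "subgroups N" using N by (simp add: locally_split_def)
  note c = into_carrier[THEN subsetD]
  interpret M: left_module E "G x" using left_module x .
  show "submodule {v \<in> V x. \<forall>a\<in>into N. act x a v \<in> Z} E (G x)"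
  proof (rule M.submoduleI)
    fix r v assume r: "r \<in> carrier E" and v: "v \<in> {v \<in> V x. \<forall>a\<in>into N. act x a v \<in> Z}"
    have "act x a (act x r v) \<in> Z" if "a \<in> into N" for a
    proof -
      have "act x (a \<otimes> r) v \<in> Z" using v into_mult[OF that r] by auto
      then show ?thesis using v r x c[OF that] by (simp add: mult_act)
    qed
    then show "act x r v \<in> {v \<in> V x. \<forall>a\<in>into N. act x a v \<in> Z}"
      using v r x by auto
  qed (use Z x c in \<open>auto simp: act_diff\<close>)
  show "{v \<in> V x. \<forall>a\<in>into N. act x a v \<in> Z} \<inter> N x = Z"
  proof (intro equalityI subsetI)
    fix v assume v: "v \<in> {v \<in> V x. \<forall>a\<in>into N. act x a v \<in> Z} \<inter> N x"
    \<comment> \<open>Local splitting at the single point v: some a in \<open>into N\<close> fixes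
      v, and membership of v in the large submodule then puts v = av into Z.\<close>
    then have "\<exists>a\<in>into N. \<forall>(x, v)\<in>{(x, v)}. act x a v = v"
      using N x unfolding locally_split_def by (meson SigmaI finite.intros insert_subset empty_subsetI IntD2)
    then show "v \<in> Z" using v by auto
  next
    fix v assume "v \<in> Z"
    then show "v \<in> {v \<in> V x. \<forall>a\<in>into N. act x a v \<in> Z} \<inter> N x"
      using Z subgroupsD(1)[OF sub x] into_subset_stab[OF sub] by blast
  qed
qed

text \<open>The descending chain condition for cosets in \<open>N x\<close>. A strictly descending
  sequence of cosets has descending direction modules over \<open>stab N\<close>; these are traces
  on \<open>N x\<close> of E-submodules of \<open>G x\<close>, so they become stationary, and nested
  cosets with the same direction coincide.\<close>

lemma affine_in_min:
  assumes N: "locally_split N" and x: "x \<in> X"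
    and ne: "\<Z> \<noteq> {}" and aff: "\<And>Z. Z \<in> \<Z> \<Longrightarrow> affine_in N x Z"
  shows "\<exists>Z\<in>\<Z>. \<forall>Z'\<in>\<Z>. Z' \<subseteq> Z \<longrightarrow> Z' = Z"
proof (rule ccontr)
  assume "\<not> ?thesis"
  then have step: "\<forall>Z\<in>\<Z>. \<exists>Z'\<in>\<Z>. Z' \<subset> Z" by blast
  have sub: "subgroups N" using N by (simp add: locally_split_def)
  interpret M: left_module E "G x" using left_module x .
  note NV = subgroupsD(1)[OF sub x]
  obtain Z0 where Z0: "Z0 \<in> \<Z>" using ne by blast
  obtain Z where Z: "\<And>n. Z n \<in> \<Z>" "\<And>n. Z (Suc n) \<subset> Z n"
    using dependent_nat_choice[of "\<lambda>_ Z. Z \<in> \<Z>" "\<lambda>_ Z Z'. Z' \<subset> Z"] step Z0 by metis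
  \<comment> \<open>\<open>D n\<close> is the direction module of the coset \<open>Z n\<close>;
    \<open>Y n\<close> is the E-submodule of \<open>V x\<close> whose trace on \<open>N x\<close> is
    \<open>D n\<close>.\<close>
  define D where "D n = {u \<ominus>\<^bsub>G x\<^esub> v | u v. u \<in> Z n \<and> v \<in> Z n}" for n
  define Y where "Y n = {v \<in> V x. \<forall>a\<in>into N. act x a v \<in> D n}" for n
  have ZN: "u \<in> N x" "u \<in> V x" if "u \<in> Z n" for u n
    using aff[OF Z(1)[of n]] that NV by (auto simp: affine_in_def)
  have Zaff: "u \<oplus>\<^bsub>G x\<^esub> act x r (v \<ominus>\<^bsub>G x\<^esub> w) \<in> Z n"
    if "u \<in> Z n" "v \<in> Z n" "w \<in> Z n" "r \<in> stab N" for u v w r n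
    using aff[OF Z(1)[of n]] that by (simp add: affine_in_def)
  have D1: "D n \<subseteq> N x" for n
    using ZN subgroupsD[OF sub x] by (auto simp: D_def)
  have D2: "\<zero>\<^bsub>G x\<^esub> \<in> D n" for n
  proof -
    obtain u where "u \<in> Z n" using aff[OF Z(1)[of n]] by (auto simp: affine_in_def)
    moreover from this have "u \<ominus>\<^bsub>G x\<^esub> u = \<zero>\<^bsub>G x\<^esub>" using ZN(2)[of u n] by (simp add: M.minus_eq M.r_neg)
    ultimately show ?thesis unfolding D_def by force
  qed
  have D3: "d \<ominus>\<^bsub>G x\<^esub> d' \<in> D n" if dd: "d \<in> D n" "d' \<in> D n" for d d' n
  proof -
    obtain u v u' v' where d: "d = u \<ominus>\<^bsub>G x\<^esub> v" "d' = u' \<ominus>\<^bsub>G x\<^esub> v'" "u \<in> Z n" "v \<in> Z n" "u' \<in> Z n" "v' \<in> Z n"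
      using dd by (auto simp: D_def)
    \<comment> \<open>The identity (u - v) - (u' - v') = (u + 1(v' - u')) - v turns a difference of
      two directions into a single difference of points of \<open>Z n\<close>.\<close>
    have "u \<oplus>\<^bsub>G x\<^esub> act x \<one> (v' \<ominus>\<^bsub>G x\<^esub> u') \<in> Z n" by (intro Zaff d) (simp add: sub)
    moreover have "d \<ominus>\<^bsub>G x\<^esub> d' = (u \<oplus>\<^bsub>G x\<^esub> act x \<one> (v' \<ominus>\<^bsub>G x\<^esub> u')) \<ominus>\<^bsub>G x\<^esub> v"
      using d(1,2) ZN(2)[OF d(3)] ZN(2)[OF d(4)] ZN(2)[OF d(5)] ZN(2)[OF d(6)] x
      by (simp add: M.minus_eq M.minus_add M.a_ac)
    ultimately show ?thesis using d(4) unfolding D_def by blast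
  qed
  have D4: "act x r d \<in> D n" if dd: "r \<in> stab N" "d \<in> D n" for r d n
  proof -
    obtain u v where d: "d = u \<ominus>\<^bsub>G x\<^esub> v" "u \<in> Z n" "v \<in> Z n" using dd by (auto simp: D_def)
    have r: "r \<in> carrier E" using dd stab_carrier by blast
    have "v \<oplus>\<^bsub>G x\<^esub> act x r (u \<ominus>\<^bsub>G x\<^esub> v) \<in> Z n" by (intro Zaff d dd)
    moreover have "act x r d = (v \<oplus>\<^bsub>G x\<^esub> act x r (u \<ominus>\<^bsub>G x\<^esub> v)) \<ominus>\<^bsub>G x\<^esub> v"
      using d(1) ZN(2)[OF d(2)] ZN(2)[OF d(3)] x r by (simp add: M.add_diff_cancel2)
    ultimately show ?thesis using d(3) unfolding D_def by blast
  qed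
  have Ysub: "submodule (Y n) E (G x)" for n
    unfolding Y_def by (rule stab_submodule_trace(1)[OF N x D1 D2 D3 D4])
  have YD: "Y n \<inter> N x = D n" for n
    unfolding Y_def by (rule stab_submodule_trace(2)[OF N x D1 D2 D3 D4])
  have Zmono: "Z (Suc n) \<subseteq> Z n" for n using Z(2) by (rule psubset_imp_subset)
  then have Dmono: "D (Suc n) \<subseteq> D n" for n
    unfolding D_def by blast
  have "Y (Suc n) \<subseteq> Y n" for n
    using Dmono[of n] by (simp add: Y_def subset_iff)
  with Ysub have "\<exists>n. \<forall>k\<ge>n. Y k = Y n"
    using artinian[OF x] unfolding artinian_module_def by blast
  then obtain n where n: "\<forall>k\<ge>n. Y k = Y n" ..
  have "Y (Suc n) = Y n" using n[THEN spec, of "Suc n"] by simp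
  then have "D (Suc n) = D n" using YD[of n] YD[of "Suc n"] by simp
  obtain z where z: "z \<in> Z n" "z \<notin> Z (Suc n)" using Z(2) by blast
  obtain u where u: "u \<in> Z (Suc n)" using aff[OF Z(1)[of "Suc n"]] by (auto simp: affine_in_def)
  \<comment> \<open>With equal directions z - u is also v - w for points v, w of the smaller coset,
    so z = u + (v - w) lies in the smaller coset after all.\<close>
  then have "z \<ominus>\<^bsub>G x\<^esub> u \<in> D n" using z(1) Zmono[of n] unfolding D_def by blast
  then have "z \<ominus>\<^bsub>G x\<^esub> u \<in> D (Suc n)" using \<open>D (Suc n) = D n\<close> by simp
  then obtain v w where vw: "v \<in> Z (Suc n)" "w \<in> Z (Suc n)" "z \<ominus>\<^bsub>G x\<^esub> u = v \<ominus>\<^bsub>G x\<^esub> w"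
    unfolding D_def by blast
  have "u \<oplus>\<^bsub>G x\<^esub> act x \<one> (v \<ominus>\<^bsub>G x\<^esub> w) \<in> Z (Suc n)" by (intro Zaff vw u) (simp add: sub)
  moreover have "u \<oplus>\<^bsub>G x\<^esub> act x \<one> (z \<ominus>\<^bsub>G x\<^esub> u) = z"
    using ZN(2)[OF z(1)] ZN(2)[OF u] x by (simp add: M.add_diff_cancel)
  ultimately show False using vw(3) z(2) by simp
qed

end

section \<open>Linear compactness\<close>

text \<open>Complementation reverses inclusion and exchanges unions with intersections, so this is
  Zorn's lemma for the family of complements.\<close>

lemma subset_Zorn_minimal:
  assumes "\<A> \<noteq> {}" and "\<And>\<C>. \<lbrakk>\<C> \<noteq> {}; subset.chain \<A> \<C>\<rbrakk> \<Longrightarrow> \<Inter>\<C> \<in> \<A>"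
  shows "\<exists>M\<in>\<A>. \<forall>Y\<in>\<A>. Y \<subseteq> M \<longrightarrow> Y = M"
proof -
  have "\<exists>M\<in>uminus ` \<A>. \<forall>Y\<in>uminus ` \<A>. M \<subseteq> Y \<longrightarrow> Y = M"
  proof (rule subset_Zorn_nonempty)
    fix \<C> assume C: "\<C> \<noteq> {}" "subset.chain (uminus ` \<A>) \<C>"
    have "uminus ` \<C> \<subseteq> \<A>"
      using C(2) unfolding subset_chain_def by force
    moreover have "- Y \<subseteq> - Y' \<or> - Y' \<subseteq> - Y" if "Y \<in> \<C>" "Y' \<in> \<C>" for Y Y'
      using C(2) that unfolding subset_chain_def by (meson Compl_subset_Compl_iff)
    ultimately have "subset.chain \<A> (uminus ` \<C>)"
      unfolding subset_chain_def by simp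
    then have "\<Inter>(uminus ` \<C>) \<in> \<A>" using assms(2)[of "uminus ` \<C>"] C by blast
    moreover have "\<Union>\<C> = - \<Inter>(uminus ` \<C>)" by auto
    ultimately show "\<Union>\<C> \<in> uminus ` \<A>" by blast
  qed (use assms in auto)
  then obtain M where M: "M \<in> \<A>" "\<forall>Y\<in>uminus ` \<A>. - M \<subseteq> Y \<longrightarrow> Y = - M" by blast
  have "Y = M" if "Y \<in> \<A>" "Y \<subseteq> M" for Y
    using M(2)[rule_format, of "- Y"] that by auto
  then show ?thesis using M(1) by blast
qed

context operator_ring
begin

text \<open>Zorn's lemma enlarges \<C> to a maximal family of affine sets with the finite
  intersection property. At each point v the finite intersections have a minimal set of values, and
  by maximality the evaluation fibre over any value in it already belongs to the family. The values
  so chosen fit together on finite sets, completeness makes them an operator, and closedness puts it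
  into every member of \<C>. Intersecting with \<open>into N\<close> gives the hypothesis a sensible
  meaning for empty F, where the intersection is everything.\<close>

lemma linearly_compact:
  assumes N: "locally_split N"
    and aff: "\<And>C. C \<in> \<C> \<Longrightarrow> affine N C" and cl: "\<And>C. C \<in> \<C> \<Longrightarrow> closed C"
    and fip: "\<And>F. \<lbrakk>finite F; F \<subseteq> \<C>\<rbrakk> \<Longrightarrow> into N \<inter> \<Inter>F \<noteq> {}"
  shows "\<exists>f\<in>into N. \<forall>C\<in>\<C>. f \<in> C"
proof -
  have sub: "subgroups N" using N by (simp add: locally_split_def)
  \<comment> \<open>Members added by the enlargement are required to be affine only; closedness is
    asked of the members of \<C>, where the limit operator has to land.\<close>
  define \<A> where "\<A> = {\<D>. \<C> \<subseteq> \<D> \<and> (\<forall>C\<in>\<D>. affine N C) \<and>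
    (\<forall>F. finite F \<and> F \<subseteq> \<D> \<longrightarrow> into N \<inter> \<Inter>F \<noteq> {})}"
  have "\<exists>M\<in>\<A>. \<forall>Y\<in>\<A>. M \<subseteq> Y \<longrightarrow> Y = M"
  proof (rule subset_Zorn_nonempty)
    show "\<A> \<noteq> {}" using aff fip by (auto simp: \<A>_def intro!: exI[of _ \<C>])
    fix K assume K: "K \<noteq> {}" "subset.chain \<A> K"
    have KA: "K \<subseteq> \<A>" using K by (simp add: subset.chain_def)
    have "\<C> \<subseteq> \<Union>K" "\<forall>C\<in>\<Union>K. affine N C" using K KA unfolding \<A>_def by blast+
    moreover have "into N \<inter> \<Inter>F \<noteq> {}" if F: "finite F" "F \<subseteq> \<Union>K" for F
    proof -
      obtain D where "D \<in> K" "F \<subseteq> D" using finite_subset_Union_chain[OF F K] by blast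
      then show ?thesis using KA F(1) unfolding \<A>_def by blast
    qed
    ultimately show "\<Union>K \<in> \<A>" unfolding \<A>_def by blast
  qed
  then obtain \<D> where D: "\<D> \<in> \<A>" and max: "\<And>Y. \<lbrakk>Y \<in> \<A>; \<D> \<subseteq> Y\<rbrakk> \<Longrightarrow> Y = \<D>" by blast
  have CD: "\<C> \<subseteq> \<D>" and Daff: "\<And>C. C \<in> \<D> \<Longrightarrow> affine N C"
    and Dfip: "\<And>F. \<lbrakk>finite F; F \<subseteq> \<D>\<rbrakk> \<Longrightarrow> into N \<inter> \<Inter>F \<noteq> {}"
    using D by (auto simp: \<A>_def)
  define S where "S x v w = {f \<in> into N. act x f v = w}" for x v w
  have point: "\<exists>w\<in>V x. S x v w \<in> \<D>" if x: "x \<in> X" and v: "v \<in> V x" for x v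
  proof -
    \<comment> \<open>The values at v taken on finite intersections; they are cosets in
      \<open>N x\<close>, so one of them is minimal.\<close>
    define \<Z> where "\<Z> = {(\<lambda>f. act x f v) ` (into N \<inter> \<Inter>F) | F. finite F \<and> F \<subseteq> \<D>}"
    have "\<exists>Z\<in>\<Z>. \<forall>Z'\<in>\<Z>. Z' \<subseteq> Z \<longrightarrow> Z' = Z"
    proof (rule affine_in_min[OF N x])
      show "\<Z> \<noteq> {}" by (auto simp: \<Z>_def)
      fix Z assume "Z \<in> \<Z>"
      then obtain F where F: "finite F" "F \<subseteq> \<D>" "Z = (\<lambda>f. act x f v) ` (into N \<inter> \<Inter>F)"
        by (auto simp: \<Z>_def)
      have *: "affine N (\<Inter>(insert (into N) F))"
        by (rule affine_Inter) (use F(2) Daff affine_into[OF sub] in blast)+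
      have "u \<oplus>\<^bsub>G x\<^esub> act x r (u' \<ominus>\<^bsub>G x\<^esub> u'') \<in> Z"
        if uu: "u \<in> Z" "u' \<in> Z" "u'' \<in> Z" and r: "r \<in> stab N" for u u' u'' r
      proof -
        obtain f g h where f: "f \<in> into N \<inter> \<Inter>F" "g \<in> into N \<inter> \<Inter>F" "h \<in> into N \<inter> \<Inter>F"
          "u = act x f v" "u' = act x g v" "u'' = act x h v"
          using uu F(3) by blast
        then have c: "f \<in> carrier E" "g \<in> carrier E" "h \<in> carrier E" "r \<in> carrier E"
          using r into_carrier stab_carrier by auto
        have "f \<oplus> r \<otimes> (g \<ominus> h) \<in> into N \<inter> \<Inter>F"
          using * f(1-3) r unfolding affine_def by simp
        moreover have "u \<oplus>\<^bsub>G x\<^esub> act x r (u' \<ominus>\<^bsub>G x\<^esub> u'') = act x (f \<oplus> r \<otimes> (g \<ominus> h)) v"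
          using f c x v by (simp add: add_act mult_act diff_act)
        ultimately show ?thesis using F(3) by blast
      qed
      moreover have "Z \<subseteq> N x" using F(3) x v by (auto simp: into_def)
      moreover have "Z \<noteq> {}" using Dfip[OF F(1,2)] F(3) by simp
      ultimately show "affine_in N x Z" unfolding affine_in_def by blast
    qed
    then obtain Z where Z: "Z \<in> \<Z>" "\<And>Z'. \<lbrakk>Z' \<in> \<Z>; Z' \<subseteq> Z\<rbrakk> \<Longrightarrow> Z' = Z" by metis
    then obtain F0 where F0: "finite F0" "F0 \<subseteq> \<D>" and ZF: "Z = (\<lambda>f. act x f v) ` (into N \<inter> \<Inter>F0)"
      unfolding \<Z>_def by (elim CollectE exE conjE) metis
    have min: "(\<lambda>f. act x f v) ` (into N \<inter> \<Inter>F) = Z"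
      if "finite F" "F \<subseteq> \<D>" "(\<lambda>f. act x f v) ` (into N \<inter> \<Inter>F) \<subseteq> Z" for F
      by (rule Z(2)) (use that in \<open>auto simp: \<Z>_def\<close>)
    obtain f0 where f0: "f0 \<in> into N \<inter> \<Inter>F0" using Dfip[OF F0] by blast
    define w where "w = act x f0 v"
    have w: "w \<in> V x" using f0 into_carrier x v by (auto simp: w_def)
    have "insert (S x v w) \<D> \<in> \<A>"
    proof -
      have "into N \<inter> \<Inter>F \<noteq> {}" if F: "finite F" "F \<subseteq> insert (S x v w) \<D>" for F
      proof -
        \<comment> \<open>Adjoining F0 forces the set of values inside the minimal one, hence equal
          to it. So w is still attained on this smaller intersection, and an operator attaining it
          lies in the fibre as well.\<close>
        let ?F = "(F - {S x v w}) \<union> F0"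
        have *: "(\<lambda>f. act x f v) ` (into N \<inter> \<Inter>?F) = Z"
          by (rule min) (use F F0 ZF in auto)
        obtain f where f: "f \<in> into N \<inter> \<Inter>?F" "act x f v = w"
        proof -
          have "w \<in> (\<lambda>f. act x f v) ` (into N \<inter> \<Inter>?F)"
            unfolding * unfolding ZF w_def using f0 by (rule imageI)
          then show thesis using that by (elim imageE) simp
        qed
        from f have "f \<in> S x v w" by (simp add: S_def)
        with f(1) have "f \<in> into N \<inter> \<Inter>F" by blast
        then show ?thesis by blast
      qed
      moreover have "affine N (S x v w)" using affine_single[OF sub x v] by (simp add: S_def)
      ultimately show ?thesis
        using CD Daff by (simp add: \<A>_def subset_insertI2)
    qed
    then have "S x v w \<in> \<D>" using max by blast
    then show ?thesis using w by blast
  qed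
  then obtain \<phi> where \<phi>: "\<And>x v. \<lbrakk>x \<in> X; v \<in> V x\<rbrakk> \<Longrightarrow> \<phi> x v \<in> V x"
    "\<And>x v. \<lbrakk>x \<in> X; v \<in> V x\<rbrakk> \<Longrightarrow> S x v (\<phi> x v) \<in> \<D>" by metis
  \<comment> \<open>Finitely many fibres of the maximal family may be intersected with F, so all
    finitely many prescribed values are realised by one operator.\<close>
  have approx: "\<exists>g\<in>into N \<inter> \<Inter>F. \<forall>(x, v)\<in>P. act x g v = \<phi> x v"
    if F: "finite F" "F \<subseteq> \<D>" and P: "finite P" "P \<subseteq> Sigma X V" for F P
  proof -
    have "into N \<inter> \<Inter>(F \<union> (\<lambda>(x, v). S x v (\<phi> x v)) ` P) \<noteq> {}"
      by (rule Dfip) (use F P \<phi> in auto)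
    then obtain g where g: "g \<in> into N" "g \<in> \<Inter>F" "\<forall>p\<in>P. g \<in> (\<lambda>(x, v). S x v (\<phi> x v)) p" by blast
    have "\<forall>(x, v)\<in>P. act x g v = \<phi> x v" using g(3) by (auto simp: S_def)
    then show ?thesis using g by blast
  qed
  have "\<exists>f\<in>carrier E. \<forall>x\<in>X. \<forall>v\<in>V x. act x f v = \<phi> x v"
  proof (rule complete)
    fix P assume "finite P" "P \<subseteq> Sigma X V"
    then obtain g where "g \<in> into N" "\<forall>(x, v)\<in>P. act x g v = \<phi> x v"
      using approx[of "{}" P] by auto
    then show "\<exists>f\<in>carrier E. \<forall>(x, v)\<in>P. act x f v = \<phi> x v"
      using into_carrier by (intro bexI[of _ g]) auto
  qed (use \<phi> in blast)
  then obtain f where f: "f \<in> carrier E" "\<And>x v. \<lbrakk>x \<in> X; v \<in> V x\<rbrakk> \<Longrightarrow> act x f v = \<phi> x v" by blast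
  \<comment> \<open>f is approximated on finite sets by operators from the intersection of F, hence
    by operators from C, so it lies in the closed set C.\<close>
  have close: "f \<in> C" if C: "closed C" "finite F" "F \<subseteq> \<D>" "into N \<inter> \<Inter>F \<subseteq> C" for C F
  proof (rule closedD[OF C(1) f(1)])
    fix P assume P: "finite P" "P \<subseteq> Sigma X V"
    then obtain g where "g \<in> C" "\<forall>(x, v)\<in>P. act x g v = \<phi> x v"
      using approx[OF C(2,3) P] C(4) by blast
    then show "\<exists>g\<in>C. \<forall>(x, v)\<in>P. act x f v = act x g v" using f(2) P(2) by (intro bexI[of _ g]) (auto simp: subset_iff)
  qed
  have "f \<in> into N" by (rule close[OF closed_into[OF sub], of "{}"]) auto
  moreover have "f \<in> C" if "C \<in> \<C>" for C
    by (rule close[OF cl[OF that], of "{C}"]) (use that CD in auto)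
  ultimately show ?thesis by blast
qed

text \<open>The conditions fv = v, one for each v in N, are closed and affine, and local splitting
  is exactly their finite intersection property. A common solution is a retraction onto N.\<close>

lemma locally_split_imp_split:
  assumes N: "locally_split N"
  shows "\<exists>q\<in>into N. \<forall>x\<in>X. \<forall>v\<in>N x. act x q v = v"
proof -
  have sub: "subgroups N" using N by (simp add: locally_split_def)
  note NV = subgroupsD(1)[OF sub]
  let ?S = "\<lambda>(x, v). {f \<in> into N. act x f v = v}"
  have "\<exists>f\<in>into N. \<forall>C\<in>?S ` Sigma X N. f \<in> C"
  proof (rule linearly_compact[OF N])
    fix C assume "C \<in> ?S ` Sigma X N"
    then obtain x v where C: "x \<in> X" "v \<in> N x" "C = {f \<in> into N. act x f v = v}" by auto
    then show "affine N C" using affine_single[OF sub] NV by blast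
    have "C = into N \<inter> {f \<in> carrier E. act x f v = v}" using C(3) into_carrier by blast
    then show "closed C" using closed_Int[OF closed_into[OF sub] closed_single] C NV by blast
  next
    fix F assume "finite F" "F \<subseteq> ?S ` Sigma X N"
    then obtain P where P: "P \<subseteq> Sigma X N" "finite P" "F = ?S ` P"
      by (meson finite_subset_image)
    then obtain a where "a \<in> into N" "\<forall>(x, v)\<in>P. act x a v = v"
      using N unfolding locally_split_def by meson
    then have "a \<in> into N \<inter> \<Inter>F" using P(3) by auto
    then show "into N \<inter> \<Inter>F \<noteq> {}" by blast
  qed
  then show ?thesis by auto
qed

section \<open>Linear compactness of \<open>E\<close> as a left module over itself\<close>

lemma subgroups_V: "subgroups V"
proof -
  have "\<zero>\<^bsub>G x\<^esub> \<in> V x" "\<forall>u\<in>V x. \<forall>v\<in>V x. u \<ominus>\<^bsub>G x\<^esub> v \<in> V x" if "x \<in> X" for x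
  proof -
    interpret M: abelian_group "G x" using mod_abelian that .
    show "\<zero>\<^bsub>G x\<^esub> \<in> V x" "\<forall>u\<in>V x. \<forall>v\<in>V x. u \<ominus>\<^bsub>G x\<^esub> v \<in> V x" by auto
  qed
  then show ?thesis by (simp add: subgroups_def)
qed

lemma into_V [simp]: "into V = carrier E" and stab_V [simp]: "stab V = carrier E"
  by (auto simp: into_def stab_def)

lemma locally_split_V: "locally_split V"
  unfolding locally_split_def using subgroups_V by (auto intro!: bexI[of _ \<one>])

lemma affine_V: "affine V C \<longleftrightarrow> C \<subseteq> carrier E \<and>
    (\<forall>f\<in>C. \<forall>g\<in>C. \<forall>h\<in>C. \<forall>r\<in>carrier E. f \<oplus> r \<otimes> (g \<ominus> h) \<in> C)"
  by (simp add: affine_def)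

text \<open>A finite nonempty part of a chain meets in its least member, so the finite intersection
  property is automatic. This supplies the chain condition for the two minimality arguments by
  Zorn's lemma below.\<close>

lemma affine_closed_chain_Inter:
  assumes "\<C> \<noteq> {}" "subset.chain \<A> \<C>"
    and "\<And>C. C \<in> \<C> \<Longrightarrow> affine V C" "\<And>C. C \<in> \<C> \<Longrightarrow> closed C" "\<And>C. C \<in> \<C> \<Longrightarrow> C \<noteq> {}"
  shows "\<Inter>\<C> \<noteq> {}"
proof -
  have "\<exists>f\<in>into V. \<forall>C\<in>\<C>. f \<in> C"
  proof (rule linearly_compact[OF locally_split_V assms(3,4)])
    fix F assume F: "finite F" "F \<subseteq> \<C>"
    have Fc: "C \<subseteq> carrier E" if "C \<in> F" for C
      using assms(3)[of C] that F by (auto simp: affine_V)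
    show "into V \<inter> \<Inter>F \<noteq> {}"
    proof (cases "F = {}")
      case False
      then obtain m where m: "m \<in> F" "\<forall>b\<in>F. b \<le> m \<longrightarrow> m = b"
        using finite_has_minimal[OF F(1)] by blast
      have mC: "m \<subseteq> C" if "C \<in> F" for C
        using assms(2) m(1) m(2)[rule_format, of C] F(2) that unfolding subset_chain_def
        by blast
      have "m \<noteq> {}" "m \<subseteq> carrier E" using assms(5)[of m] m(1) F(2) Fc by auto
      then obtain f where "f \<in> m" "f \<in> carrier E" by blast
      moreover have "f \<in> \<Inter>F" using \<open>f \<in> m\<close> mC by blast
      ultimately show ?thesis by auto
    qed auto
  qed
  then show ?thesis by blast
qed

text \<open>By faithfulness ba = c prescribes b at the points av, which is a pointwise condition;
  and r(g - h)a = 0 when ga = ha.\<close>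

lemma closed_mult_eq:
  assumes "a \<in> carrier E" "c \<in> carrier E"
  shows "closed {b \<in> carrier E. b \<otimes> a = c}" "affine V {b \<in> carrier E. b \<otimes> a = c}"
proof -
  have "{b \<in> carrier E. b \<otimes> a = c} = {b \<in> carrier E. \<forall>x\<in>X. \<forall>v\<in>V x. act x b (act x a v) = act x c v}"
    using assms by (auto simp flip: mult_act intro: faithful)
  moreover have "closed \<dots>"
    unfolding closed_def
  proof (intro conjI ballI impI)
    fix f assume f: "f \<in> carrier E" and *: "\<forall>P. finite P \<and> P \<subseteq> Sigma X V \<longrightarrow>
      (\<exists>g\<in>{b \<in> carrier E. \<forall>x\<in>X. \<forall>v\<in>V x. act x b (act x a v) = act x c v}. \<forall>(x, v)\<in>P. act x f v = act x g v)"
    \<comment> \<open>The approximation is tested at the point av, where the equation determines the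
      value of b.\<close>
    have "act x f (act x a v) = act x c v" if "x \<in> X" "v \<in> V x" for x v
      using *[rule_format, of "{(x, act x a v)}"] that assms by auto
    then show "f \<in> {b \<in> carrier E. \<forall>x\<in>X. \<forall>v\<in>V x. act x b (act x a v) = act x c v}"
      using f by blast
  qed auto
  ultimately show "closed {b \<in> carrier E. b \<otimes> a = c}" by simp
  show "affine V {b \<in> carrier E. b \<otimes> a = c}"
    unfolding affine_V using assms
    by (auto simp: l_distr minus_eq m_assoc l_minus r_neg)
qed

text \<open>Closedness is the analogue of the fact that continuous images of compact sets are
  closed. For f in the closure of Ca, the conditions r(av) = fv on r in C are closed and affine and
  have the finite intersection property; a common solution satisfies ra = f.\<close>

lemma right_mult_image:
  assumes C: "affine V C" "closed C" and a: "a \<in> carrier E"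
  shows "affine V ((\<lambda>r. r \<otimes> a) ` C)" "closed ((\<lambda>r. r \<otimes> a) ` C)"
proof -
  have CE: "C \<subseteq> carrier E" using C by (simp add: affine_V)
  show "affine V ((\<lambda>r. r \<otimes> a) ` C)"
    unfolding affine_V
  proof (intro conjI ballI)
    show "(\<lambda>r. r \<otimes> a) ` C \<subseteq> carrier E" using CE a by auto
  next
    fix f g h r
    assume "f \<in> (\<lambda>r. r \<otimes> a) ` C" "g \<in> (\<lambda>r. r \<otimes> a) ` C" "h \<in> (\<lambda>r. r \<otimes> a) ` C" and r: "r \<in> carrier E"
    then obtain f' g' h' where f: "f' \<in> C" "g' \<in> C" "h' \<in> C" "f = f' \<otimes> a" "g = g' \<otimes> a" "h = h' \<otimes> a"
      by blast
    have "f' \<oplus> r \<otimes> (g' \<ominus> h') \<in> C" using C(1) f r unfolding affine_V by blast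
    moreover have "f \<oplus> r \<otimes> (g \<ominus> h) = (f' \<oplus> r \<otimes> (g' \<ominus> h')) \<otimes> a"
      using f CE[THEN subsetD, OF f(1)] CE[THEN subsetD, OF f(2)] CE[THEN subsetD, OF f(3)] r a
      by (simp add: l_distr minus_eq m_assoc l_minus)
    ultimately show "f \<oplus> r \<otimes> (g \<ominus> h) \<in> (\<lambda>r. r \<otimes> a) ` C" by blast
  qed
  show "closed ((\<lambda>r. r \<otimes> a) ` C)"
    unfolding closed_def
  proof (intro conjI ballI impI)
    show "(\<lambda>r. r \<otimes> a) ` C \<subseteq> carrier E" using CE a by auto
  next
    fix f assume f: "f \<in> carrier E" and *: "\<forall>P. finite P \<and> P \<subseteq> Sigma X V \<longrightarrow>
      (\<exists>g\<in>(\<lambda>r. r \<otimes> a) ` C. \<forall>(x, v)\<in>P. act x f v = act x g v)"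
    let ?S = "\<lambda>(x, v). C \<inter> {r \<in> carrier E. act x r (act x a v) = act x f v}"
    \<comment> \<open>C is listed separately so that the solution lies in C even if there are no
      points at which to impose conditions.\<close>
    have "\<exists>r\<in>into V. \<forall>D\<in>insert C (?S ` Sigma X V). r \<in> D"
    proof (rule linearly_compact[OF locally_split_V])
      fix D assume D: "D \<in> insert C (?S ` Sigma X V)"
      have "affine V (?S p)" "closed (?S p)" if pV: "p \<in> Sigma X V" for p
      proof -
        obtain x v where p: "p = (x, v)" "x \<in> X" "v \<in> V x" using pV by (rule SigmaE)
        show "affine V (?S p)" "closed (?S p)"
          using affine_Int[OF C(1) affine_single[OF subgroups_V, of x "act x a v"]]
            closed_Int[OF C(2) closed_single[of x "act x a v"]] p a by auto
      qed
      then show "affine V D" "closed D" using D C by auto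
    next
      fix F assume F: "finite F" "F \<subseteq> insert C (?S ` Sigma X V)"
      then have "finite (F - {C})" "F - {C} \<subseteq> ?S ` Sigma X V" by auto
      then obtain P where P: "P \<subseteq> Sigma X V" "finite P" "F - {C} = ?S ` P"
        by (meson finite_subset_image)
      have "\<exists>g\<in>(\<lambda>r. r \<otimes> a) ` C. \<forall>(x, v)\<in>P. act x f v = act x g v"
        using *[rule_format, of P] P(1,2) by simp
      then obtain r where r: "r \<in> C" "\<forall>(x, v)\<in>P. act x f v = act x (r \<otimes> a) v" by auto
      have "r \<in> ?S p" if pP: "p \<in> P" for p
      proof -
        obtain x v where p: "p = (x, v)" "x \<in> X" "v \<in> V x" using pP P(1) by blast
        then have "act x f v = act x (r \<otimes> a) v" using r(2) pP by auto
        then show ?thesis using p r(1) CE a by (auto simp: mult_act)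
      qed
      then have "r \<in> \<Inter>(F - {C})" using P(3) by auto
      then have "r \<in> into V \<inter> \<Inter>F" using r(1) CE by auto
      then show "into V \<inter> \<Inter>F \<noteq> {}" by blast
    qed
    then obtain r where r: "r \<in> C" "\<And>x v. \<lbrakk>x \<in> X; v \<in> V x\<rbrakk> \<Longrightarrow> act x r (act x a v) = act x f v" by fastforce
    have "r \<otimes> a = f" by (rule faithful) (use r CE a f in \<open>auto simp: mult_act\<close>)
    then show "f \<in> (\<lambda>r. r \<otimes> a) ` C" using r by blast
  qed
qed

end

section \<open>Local idempotents\<close>

text \<open>For an idempotent e this is the ring eRe. Its elements are described by equations
  instead of as products exe, so that membership can be checked by rewriting.\<close>

definition corner :: "('a, 'b) ring_scheme \<Rightarrow> 'a \<Rightarrow> ('a, 'b) ring_scheme" where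
  "corner R e = R\<lparr>carrier := {x \<in> carrier R. e \<otimes>\<^bsub>R\<^esub> x = x \<and> x \<otimes>\<^bsub>R\<^esub> e = x}, one := e\<rparr>"

lemma corner_simps [simp]:
  "x \<in> carrier (corner R e) \<longleftrightarrow> x \<in> carrier R \<and> e \<otimes>\<^bsub>R\<^esub> x = x \<and> x \<otimes>\<^bsub>R\<^esub> e = x"
  "mult (corner R e) = mult R" "add (corner R e) = add R"
  "zero (corner R e) = zero R" "one (corner R e) = e"
  by (simp_all add: corner_def)

lemma (in ring) corner_ring:
  assumes e: "e \<in> carrier R" "e \<otimes> e = e"
  shows "ring (corner R e)"
proof (rule ringI)
  show "abelian_group (corner R e)"
  proof (rule abelian_groupI)
    fix x assume x: "x \<in> carrier (corner R e)"
    then have "\<ominus> x \<in> carrier (corner R e)" "\<ominus> x \<oplus> x = \<zero>"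
      using e by (auto simp: l_minus r_minus l_neg)
    then show "\<exists>y\<in>carrier (corner R e). y \<oplus>\<^bsub>corner R e\<^esub> x = \<zero>\<^bsub>corner R e\<^esub>" by auto
  qed (use e in \<open>auto simp: l_distr r_distr a_ac\<close>)
  show "Group.monoid (corner R e)"
  proof (rule monoidI)
    fix x y assume "x \<in> carrier (corner R e)" "y \<in> carrier (corner R e)"
    then show "x \<otimes>\<^bsub>corner R e\<^esub> y \<in> carrier (corner R e)"
      using e by (auto simp: m_assoc) (simp flip: m_assoc)
  qed (use e in \<open>auto simp: m_assoc\<close>)
qed (auto simp: l_distr r_distr)

text \<open>A unit in J would put the identity into J, so J is precisely the set of
  non-units.\<close>

lemma local_ringI:
  assumes J: "ideal J R" and one: "\<one>\<^bsub>R\<^esub> \<notin> J" and "\<And>u. u \<in> carrier R - J \<Longrightarrow> u \<in> Units R"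
  shows "local_ring R"
proof -
  interpret ideal J R by fact
  have "u \<notin> J" if "u \<in> Units R" for u
  proof
    assume "u \<in> J"
    then have "inv\<^bsub>R\<^esub> u \<otimes>\<^bsub>R\<^esub> u \<in> J" using that by (intro I_l_closed) auto
    then show False using that one by simp
  qed
  then have "carrier R - Units R = J" using assms(3) a_subset by blast
  then show ?thesis using J by (simp add: local_ring_def)
qed

section \<open>Closed left ideals and minimal choices\<close>

context operator_ring
begin

text \<open>An affine set of operators for \<open>V\<close> that passes through zero is a left
  ideal; this phrasing gives direct access to linear compactness.\<close>

definition closed_ideal where
  "closed_ideal L \<longleftrightarrow> affine V L \<and> closed L \<and> \<zero> \<in> L"

lemma closed_idealD:
  assumes "closed_ideal L"
  shows "affine V L" "closed L" "\<zero> \<in> L" "L \<subseteq> carrier E"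
    "\<lbrakk>r \<in> carrier E; f \<in> L\<rbrakk> \<Longrightarrow> r \<otimes> f \<in> L" "\<lbrakk>f \<in> L; g \<in> L\<rbrakk> \<Longrightarrow> f \<ominus> g \<in> L"
proof -
  show *: "affine V L" "closed L" "\<zero> \<in> L" and LE: "L \<subseteq> carrier E"
    using assms by (auto simp: closed_ideal_def affine_V)
  show "r \<otimes> f \<in> L" if "r \<in> carrier E" "f \<in> L"
  proof -
    have "\<zero> \<oplus> r \<otimes> (f \<ominus> \<zero>) \<in> L" using * that unfolding affine_V by blast
    then show ?thesis using that LE by (auto simp: minus_eq)
  qed
  show "f \<ominus> g \<in> L" if "f \<in> L" "g \<in> L"
  proof -
    have "f \<oplus> \<one> \<otimes> (\<zero> \<ominus> g) \<in> L" using * that unfolding affine_V by blast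
    then show ?thesis using that LE by (auto simp: minus_eq)
  qed
qed

lemma closed_ideal_principal:
  "a \<in> carrier E \<Longrightarrow> closed_ideal ((\<lambda>r. r \<otimes> a) ` carrier E)"
  unfolding closed_ideal_def
  using right_mult_image[of "carrier E" a] affine_into[OF subgroups_V] closed_into[OF subgroups_V]
  by (auto intro!: image_eqI[of _ _ \<zero>])

text \<open>The set is the left annihilator of e - 1, hence the solution set of an equation of the
  form ba = c.\<close>

lemma closed_ideal_fixed:
  assumes "e \<in> carrier E" shows "closed_ideal {r \<in> carrier E. r \<otimes> e = r}"
proof -
  have "{r \<in> carrier E. r \<otimes> e = r} = {r \<in> carrier E. r \<otimes> (e \<ominus> \<one>) = \<zero>}"
  proof -
    have "r \<otimes> e = r \<longleftrightarrow> r \<otimes> (e \<ominus> \<one>) = \<zero>" if "r \<in> carrier E" for r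
    proof -
      have "r \<otimes> (e \<ominus> \<one>) = r \<otimes> e \<ominus> r"
        using assms that by (simp add: minus_eq r_distr r_minus)
      then show ?thesis using assms that by (simp add: diff_eq_zero_iff)
    qed
    then show ?thesis by blast
  qed
  then show ?thesis
    using closed_mult_eq[of "e \<ominus> \<one>" \<zero>] assms by (simp add: closed_ideal_def)
qed

text \<open>Choose Z minimal among the E-submodules of \<open>V x\<close> not annihilated by g, and
  m = gu nonzero with u in Z. If g does not annihilate the cyclic submodule generated by rm, that
  submodule belongs to the same family and lies in Z, so it equals Z and contains m. Hence either g
  kills E(rm) or r can be undone at m from the left.\<close>

lemma minimal_submodule:
  assumes x: "x \<in> X" and g: "g \<in> carrier E" "g \<otimes> g = g" and v: "v \<in> V x" "act x g v \<noteq> \<zero>\<^bsub>G x\<^esub>"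
  obtains m where "m \<in> V x" "act x g m = m" "m \<noteq> \<zero>\<^bsub>G x\<^esub>"
    "\<And>r. \<lbrakk>r \<in> carrier E; \<exists>y\<in>carrier E. act x (g \<otimes> y \<otimes> r) m \<noteq> \<zero>\<^bsub>G x\<^esub>\<rbrakk> \<Longrightarrow>
      \<exists>s\<in>carrier E. act x (s \<otimes> r) m = m"
proof -
  interpret M: left_module E "G x" using left_module x .
  define \<Z> where "\<Z> = {Z. submodule Z E (G x) \<and> (\<exists>v\<in>Z. act x g v \<noteq> \<zero>\<^bsub>G x\<^esub>)}"
  have subD: "Z \<subseteq> V x" "\<zero>\<^bsub>G x\<^esub> \<in> Z" "\<And>u w. \<lbrakk>u \<in> Z; w \<in> Z\<rbrakk> \<Longrightarrow> u \<ominus>\<^bsub>G x\<^esub> w \<in> Z"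
    "\<And>u w. \<lbrakk>u \<in> Z; w \<in> Z\<rbrakk> \<Longrightarrow> u \<oplus>\<^bsub>G x\<^esub> w \<in> Z"
    "\<And>r u. \<lbrakk>r \<in> carrier E; u \<in> Z\<rbrakk> \<Longrightarrow> act x r u \<in> Z"
    if "submodule Z E (G x)" for Z
  proof -
    interpret Z: submodule Z E "G x" by fact
    show "Z \<subseteq> V x" "\<zero>\<^bsub>G x\<^esub> \<in> Z" using Z.subset Z.one_closed by auto
    show add: "\<And>u w. \<lbrakk>u \<in> Z; w \<in> Z\<rbrakk> \<Longrightarrow> u \<oplus>\<^bsub>G x\<^esub> w \<in> Z" using Z.m_closed by simp
    show "\<And>u w. \<lbrakk>u \<in> Z; w \<in> Z\<rbrakk> \<Longrightarrow> u \<ominus>\<^bsub>G x\<^esub> w \<in> Z"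
      using add Z.m_inv_closed by (simp add: M.minus_eq a_inv_def)
    show "\<And>r u. \<lbrakk>r \<in> carrier E; u \<in> Z\<rbrakk> \<Longrightarrow> act x r u \<in> Z" using Z.smult_closed .
  qed
  have "submodule (V x) E (G x)"
    by (rule M.submoduleI) (use x in auto)
  then have "\<Z> \<noteq> {}" using v by (auto simp: \<Z>_def)
  moreover have "affine_in V x Z" if "Z \<in> \<Z>" for Z
    using subD[of Z] that unfolding affine_in_def \<Z>_def by auto
  ultimately obtain Z where Z: "Z \<in> \<Z>" "\<And>Z'. \<lbrakk>Z' \<in> \<Z>; Z' \<subseteq> Z\<rbrakk> \<Longrightarrow> Z' = Z"
    using affine_in_min[OF locally_split_V x, of \<Z>] by metis
  then obtain u where u: "u \<in> Z" "act x g u \<noteq> \<zero>\<^bsub>G x\<^esub>" by (auto simp: \<Z>_def)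
  have Zsub: "submodule Z E (G x)" using Z by (simp add: \<Z>_def)
  note ZD = subD[OF Zsub]
  have cyc: "submodule {act x s w | s. s \<in> carrier E} E (G x)" if w: "w \<in> V x" for w
  proof (rule M.submoduleI)
    show "{act x s w | s. s \<in> carrier E} \<subseteq> V x" using x w by auto
    show "\<zero>\<^bsub>G x\<^esub> \<in> {act x s w | s. s \<in> carrier E}"
      using x w by (auto intro!: exI[of _ \<zero>])
  next
    fix a b assume "a \<in> {act x s w | s. s \<in> carrier E}" "b \<in> {act x s w | s. s \<in> carrier E}"
    then obtain s t where "a = act x s w" "b = act x t w" "s \<in> carrier E" "t \<in> carrier E" by blast
    then have "a \<ominus>\<^bsub>G x\<^esub> b = act x (s \<ominus> t) w" "s \<ominus> t \<in> carrier E" using x w by (auto simp: diff_act)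
    then show "a \<ominus>\<^bsub>G x\<^esub> b \<in> {act x s w | s. s \<in> carrier E}" by blast
  next
    fix r b assume r: "r \<in> carrier E" and "b \<in> {act x s w | s. s \<in> carrier E}"
    then obtain t where "b = act x t w" "t \<in> carrier E" by blast
    then have "act x r b = act x (r \<otimes> t) w" "r \<otimes> t \<in> carrier E" using x w r by (auto simp: mult_act)
    then show "act x r b \<in> {act x s w | s. s \<in> carrier E}" by blast
  qed
  define m where "m = act x g u"
  have uV: "u \<in> V x" using u ZD by blast
  have mZ: "m \<in> Z" using u g ZD by (auto simp: m_def)
  have gm: "act x g m = m" using g uV x by (simp add: m_def flip: mult_act)
  have "\<exists>s\<in>carrier E. act x (s \<otimes> r) m = m"
    if r: "r \<in> carrier E" "\<exists>y\<in>carrier E. act x (g \<otimes> y \<otimes> r) m \<noteq> \<zero>\<^bsub>G x\<^esub>" for r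
  proof -
    obtain y where y: "y \<in> carrier E" "act x (g \<otimes> y \<otimes> r) m \<noteq> \<zero>\<^bsub>G x\<^esub>" using r by blast
    have rm: "act x r m \<in> Z" "act x r m \<in> V x" using ZD(1) ZD(5)[OF r(1) mZ] by auto
    have "act x g (act x y (act x r m)) \<noteq> \<zero>\<^bsub>G x\<^esub>"
      using y r g mZ ZD(1) x by (simp add: mult_act subset_iff)
    then have "\<exists>v\<in>{act x s (act x r m) | s. s \<in> carrier E}. act x g v \<noteq> \<zero>\<^bsub>G x\<^esub>"
      using y(1) by blast
    then have "{act x s (act x r m) | s. s \<in> carrier E} \<in> \<Z>"
      using cyc[OF rm(2)] by (simp add: \<Z>_def)
    moreover have "{act x s (act x r m) | s. s \<in> carrier E} \<subseteq> Z"
      using rm(1) ZD(5) by blast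
    ultimately have "m \<in> {act x s (act x r m) | s. s \<in> carrier E}"
      using Z(2) mZ by blast
    then obtain s where "s \<in> carrier E" "act x s (act x r m) = m" by auto
    then show ?thesis using r(1) mZ ZD(1) x by (intro bexI[of _ s]) (auto simp: mult_act)
  qed
  then show thesis using that[of m] mZ ZD(1) gm u(2) by (auto simp: m_def)
qed

text \<open>Containing an operator that fixes m is the condition carried along. Unlike the
  inequality lm \<noteq> 0, the equation lm = m is closed and affine, so it survives intersections
  of chains; for nonzero m it also keeps the ideal nonzero.\<close>

lemma minimal_closed_ideal:
  assumes x: "x \<in> X" "m \<in> V x" and L0: "closed_ideal L0" "\<exists>l\<in>L0. act x l m = m"
  obtains L where "closed_ideal L" "L \<subseteq> L0" "\<exists>l\<in>L. act x l m = m"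
    "\<And>L'. \<lbrakk>closed_ideal L'; L' \<subseteq> L; \<exists>l\<in>L'. act x l m = m\<rbrakk> \<Longrightarrow> L' = L"
proof -
  define \<A> where "\<A> = {L. closed_ideal L \<and> L \<subseteq> L0 \<and> (\<exists>l\<in>L. act x l m = m)}"
  have "\<exists>M\<in>\<A>. \<forall>Y\<in>\<A>. Y \<subseteq> M \<longrightarrow> Y = M"
  proof (rule subset_Zorn_minimal)
    show "\<A> \<noteq> {}" using L0 by (auto simp: \<A>_def)
    fix \<C> assume C: "\<C> \<noteq> {}" "subset.chain \<A> \<C>"
    have CA: "closed_ideal L" "L \<subseteq> L0" "\<exists>l\<in>L. act x l m = m" "L \<subseteq> carrier E" if "L \<in> \<C>" for L
      using that C(2) closed_idealD(4) unfolding subset_chain_def \<A>_def by blast+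
    let ?F = "\<lambda>L. L \<inter> {l \<in> carrier E. act x l m = m}"
    have "\<Inter>(?F ` \<C>) \<noteq> {}"
    proof (rule affine_closed_chain_Inter)
      show "?F ` \<C> \<noteq> {}" using C by simp
      show "subset.chain UNIV (?F ` \<C>)"
        unfolding subset_chain_def
      proof (intro conjI ballI)
        fix Y Y' assume "Y \<in> ?F ` \<C>" "Y' \<in> ?F ` \<C>"
        then obtain L L' where L: "L \<in> \<C>" "L' \<in> \<C>" "Y = ?F L" "Y' = ?F L'" by blast
        then have "L \<subseteq> L' \<or> L' \<subseteq> L" using C(2) unfolding subset_chain_def by blast
        then show "Y \<subseteq> Y' \<or> Y' \<subseteq> Y" using L(3,4) by blast
      qed simp
      fix D assume "D \<in> ?F ` \<C>"
      then obtain L where L: "L \<in> \<C>" "D = ?F L" by blast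
      show "affine V D"
        unfolding L(2) using affine_Int[OF closed_idealD(1)[OF CA(1)[OF L(1)]] affine_single[OF subgroups_V x]]
        by simp
      show "closed D"
        unfolding L(2) by (intro closed_Int closed_single x closed_idealD(2)[OF CA(1)[OF L(1)]])
      show "D \<noteq> {}" using CA(3,4)[OF L(1)] L(2) by blast
    qed
    then obtain l where "\<forall>L\<in>\<C>. l \<in> L" "act x l m = m" using C(1) by blast
    moreover have "closed_ideal (\<Inter>\<C>)"
      unfolding closed_ideal_def using CA(1) closed_idealD(1-3) C(1)
      by (auto intro!: affine_Inter closed_Inter)
    ultimately show "\<Inter>\<C> \<in> \<A>" using CA(2) C(1) by (auto simp: \<A>_def)
  qed
  then obtain L where "L \<in> \<A>" "\<And>Y. \<lbrakk>Y \<in> \<A>; Y \<subseteq> L\<rbrakk> \<Longrightarrow> Y = L" by blast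
  then show thesis using that[of L] unfolding \<A>_def by blast
qed

text \<open>The Ellis--Numakura argument, with linear compactness in place of compactness.\<close>

lemma closed_affine_semigroup_idempotent:
  assumes T: "affine V T" "closed T" "T \<noteq> {}" "\<And>a b. \<lbrakk>a \<in> T; b \<in> T\<rbrakk> \<Longrightarrow> a \<otimes> b \<in> T"
  shows "\<exists>e\<in>T. e \<otimes> e = e"
proof -
  define \<A> where "\<A> = {A. affine V A \<and> closed A \<and> A \<noteq> {} \<and> A \<subseteq> T \<and> (\<forall>a\<in>A. \<forall>b\<in>A. a \<otimes> b \<in> A)}"
  have "\<exists>M\<in>\<A>. \<forall>Y\<in>\<A>. Y \<subseteq> M \<longrightarrow> Y = M"
  proof (rule subset_Zorn_minimal)
    show "\<A> \<noteq> {}" using T by (auto simp: \<A>_def)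
    fix \<C> assume C: "\<C> \<noteq> {}" "subset.chain \<A> \<C>"
    have CA: "affine V A" "closed A" "A \<noteq> {}" "A \<subseteq> T" "\<And>a b. \<lbrakk>a \<in> A; b \<in> A\<rbrakk> \<Longrightarrow> a \<otimes> b \<in> A"
      if "A \<in> \<C>" for A
      using that C(2) unfolding subset_chain_def \<A>_def by blast+
    have "affine V (\<Inter>\<C>)" "closed (\<Inter>\<C>)" "\<Inter>\<C> \<noteq> {}"
      using affine_Inter[OF CA(1) C(1)] closed_Inter[OF CA(2) C(1)]
        affine_closed_chain_Inter[OF C CA(1-3)] by blast+
    then show "\<Inter>\<C> \<in> \<A>" using CA(4,5) C(1) unfolding \<A>_def by blast
  qed
  then obtain A where A: "A \<in> \<A>" and min: "\<And>Y. \<lbrakk>Y \<in> \<A>; Y \<subseteq> A\<rbrakk> \<Longrightarrow> Y = A" by blast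
  have A': "affine V A" "closed A" "A \<subseteq> T" "\<And>a b. \<lbrakk>a \<in> A; b \<in> A\<rbrakk> \<Longrightarrow> a \<otimes> b \<in> A"
    using A by (auto simp: \<A>_def)
  have AE: "A \<subseteq> carrier E" using A'(1) by (simp add: affine_V)
  obtain a where a: "a \<in> A" using A by (auto simp: \<A>_def)
  have aE: "a \<in> carrier E" using a AE by blast
  \<comment> \<open>Aa is a closed affine subsemigroup of A, so Aa = A by minimality, and a itself
    has the form ba with b in A.\<close>
  have "(\<lambda>r. r \<otimes> a) ` A \<in> \<A>"
    unfolding \<A>_def
  proof (intro CollectI conjI ballI)
    show "affine V ((\<lambda>r. r \<otimes> a) ` A)" "closed ((\<lambda>r. r \<otimes> a) ` A)"
      using right_mult_image[OF A'(1,2) aE] by auto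
    show "(\<lambda>r. r \<otimes> a) ` A \<noteq> {}" "(\<lambda>r. r \<otimes> a) ` A \<subseteq> T" using a A'(3,4) by auto
    fix b c assume "b \<in> (\<lambda>r. r \<otimes> a) ` A" "c \<in> (\<lambda>r. r \<otimes> a) ` A"
    then obtain b' c' where bc: "b' \<in> A" "c' \<in> A" "b = b' \<otimes> a" "c = c' \<otimes> a" by blast
    have "b' \<otimes> a \<otimes> c' \<in> A" using A'(4) a bc by blast
    moreover have "b \<otimes> c = b' \<otimes> a \<otimes> c' \<otimes> a"
      using bc(3,4) aE AE[THEN subsetD, OF bc(1)] AE[THEN subsetD, OF bc(2)] by (simp add: m_assoc)
    ultimately show "b \<otimes> c \<in> (\<lambda>r. r \<otimes> a) ` A" by blast
  qed
  moreover have "(\<lambda>r. r \<otimes> a) ` A \<subseteq> A" using A'(4) a by blast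
  ultimately have "(\<lambda>r. r \<otimes> a) ` A = A" using min by blast
  then obtain b where b: "b \<in> A" "b \<otimes> a = a" using a by (metis imageE)
  \<comment> \<open>The elements of A fixing a from the left form another admissible subsemigroup,
    now known to be nonempty. By minimality it is A, so it contains a and aa = a.\<close>
  have "A \<inter> {b \<in> carrier E. b \<otimes> a = a} \<in> \<A>"
    unfolding \<A>_def
  proof (intro CollectI conjI ballI)
    show "affine V (A \<inter> {b \<in> carrier E. b \<otimes> a = a})" "closed (A \<inter> {b \<in> carrier E. b \<otimes> a = a})"
      using affine_Int[OF A'(1) closed_mult_eq(2)[OF aE aE]] closed_Int[OF A'(2) closed_mult_eq(1)[OF aE aE]]
      by auto
    show "A \<inter> {b \<in> carrier E. b \<otimes> a = a} \<noteq> {}" using b AE by blast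
    show "A \<inter> {b \<in> carrier E. b \<otimes> a = a} \<subseteq> T" using A'(3) by blast
  qed (use A'(4) aE in \<open>auto simp: m_assoc\<close>)
  then have "A \<inter> {b \<in> carrier E. b \<otimes> a = a} = A" by (rule min) blast
  then show ?thesis using a A'(3) by blast
qed

text \<open>Inside the left ideal of the r with rg = r, take a closed left ideal L minimal among
  those with an element fixing m. The operators in L that fix m form a closed affine semigroup and
  so contain an idempotent e, with L = Ee by minimality. An element u of eEe either has g E u m = 0
  or makes Eu a closed left ideal in L with an element fixing m, so that Eu = L and u is left
  invertible. The elements of the first kind turn out to be the maximal ideal of eEe.\<close>

lemma local_idempotent:
  assumes g: "g \<in> carrier E" "g \<otimes> g = g" "g \<noteq> \<zero>"
  obtains e where "e \<in> carrier E" "e \<otimes> e = e" "e \<otimes> g = e" "e \<noteq> \<zero>" "local_ring (corner E e)"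
proof -
  have "\<exists>x\<in>X. \<exists>v\<in>V x. act x g v \<noteq> \<zero>\<^bsub>G x\<^esub>"
    using faithful[OF g(1) zero_closed] g(3) by force
  then obtain x v where x: "x \<in> X" and v: "v \<in> V x" "act x g v \<noteq> \<zero>\<^bsub>G x\<^esub>" by blast
  obtain m where m: "m \<in> V x" "act x g m = m" "m \<noteq> \<zero>\<^bsub>G x\<^esub>"
    and gen: "\<And>r. \<lbrakk>r \<in> carrier E; \<exists>y\<in>carrier E. act x (g \<otimes> y \<otimes> r) m \<noteq> \<zero>\<^bsub>G x\<^esub>\<rbrakk> \<Longrightarrow>
      \<exists>s\<in>carrier E. act x (s \<otimes> r) m = m"
    using minimal_submodule[OF x g(1,2) v] by blast
  obtain L where L: "closed_ideal L" "L \<subseteq> {r \<in> carrier E. r \<otimes> g = r}" "\<exists>l\<in>L. act x l m = m"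
    and min: "\<And>L'. \<lbrakk>closed_ideal L'; L' \<subseteq> L; \<exists>l\<in>L'. act x l m = m\<rbrakk> \<Longrightarrow> L' = L"
    using minimal_closed_ideal[OF x m(1) closed_ideal_fixed[OF g(1)]] g m(2) by blast
  note LD = closed_idealD[OF L(1)]
  have "\<exists>e\<in>L \<inter> {l \<in> carrier E. act x l m = m}. e \<otimes> e = e"
  proof (rule closed_affine_semigroup_idempotent)
    show "affine V (L \<inter> {l \<in> carrier E. act x l m = m})"
      using affine_Int[OF LD(1) affine_single[OF subgroups_V x m(1)]] by simp
    show "closed (L \<inter> {l \<in> carrier E. act x l m = m})"
      using closed_Int[OF LD(2) closed_single[OF x m(1)]] .
    show "L \<inter> {l \<in> carrier E. act x l m = m} \<noteq> {}" using L(3) LD(4) by blast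
  qed (use LD(5) m(1) x in \<open>auto simp: mult_act\<close>)
  then obtain e where e: "e \<in> L" "e \<in> carrier E" "act x e m = m" "e \<otimes> e = e" by blast
  have eg: "e \<otimes> g = e" using e(1) L(2) by blast
  have Le: "{r \<in> carrier E. r \<otimes> e = r} = L"
  proof (rule min[OF closed_ideal_fixed[OF e(2)]])
    show "{r \<in> carrier E. r \<otimes> e = r} \<subseteq> L"
    proof
      fix r assume "r \<in> {r \<in> carrier E. r \<otimes> e = r}"
      then have "r \<in> carrier E" "r \<otimes> e = r" by auto
      then show "r \<in> L" using LD(5)[of r e] e(1) by simp
    qed
  qed (use e in auto)
  \<comment> \<open>J collects the u to which the generating property of m does not apply. It is
    visibly a left ideal; that it is two-sided comes last and rests on the units found outside
    it.\<close>
  define J where "J = {u \<in> carrier (corner E e). \<forall>y\<in>carrier E. act x (g \<otimes> y \<otimes> u) m = \<zero>\<^bsub>G x\<^esub>}"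
  interpret C: ring "corner E e" by (rule corner_ring[OF e(2,4)])
  interpret M: left_module E "G x" using left_module x .
  have Jnot: "e \<notin> J"
  proof
    assume "e \<in> J"
    then have "act x (g \<otimes> \<one> \<otimes> e) m = \<zero>\<^bsub>G x\<^esub>" by (auto simp: J_def)
    then show False using e g m x by (simp add: mult_act)
  qed
  have J_corner: "J \<subseteq> carrier (corner E e)" by (auto simp: J_def)
  have J_left: "r \<otimes> u \<in> J" if "u \<in> J" "r \<in> carrier (corner E e)" for r u
  proof -
    have u: "u \<in> carrier (corner E e)" and "act x (g \<otimes> (y \<otimes> r) \<otimes> u) m = \<zero>\<^bsub>G x\<^esub>" if "y \<in> carrier E" for y
      using \<open>u \<in> J\<close> \<open>r \<in> _\<close> that by (auto simp: J_def)
    moreover have "r \<otimes> u \<in> carrier (corner E e)"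
      using C.m_closed[OF that(2)] that(1) J_corner by (simp add: subset_iff)
    ultimately show ?thesis
      using that g(1) J_corner by (auto simp: J_def m_assoc)
  qed
  have J_diff: "u \<ominus> w \<in> J" if "u \<in> J" "w \<in> J" for u w
  proof -
    have c: "u \<in> carrier (corner E e)" "w \<in> carrier (corner E e)" using that J_corner by blast+
    have "u \<ominus> w \<in> carrier (corner E e)"
      using c e(2) by (simp add: minus_eq l_distr r_distr l_minus r_minus)
    moreover have "act x (g \<otimes> y \<otimes> (u \<ominus> w)) m = \<zero>\<^bsub>G x\<^esub>" if y: "y \<in> carrier E" for y
    proof -
      have "act x (g \<otimes> y) (act x u m) = \<zero>\<^bsub>G x\<^esub>" "act x (g \<otimes> y) (act x w m) = \<zero>\<^bsub>G x\<^esub>"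
        using \<open>u \<in> J\<close> \<open>w \<in> J\<close> y c g(1) x m(1) by (auto simp: J_def simp flip: mult_act)
      moreover have "act x (g \<otimes> y \<otimes> (u \<ominus> w)) m = act x (g \<otimes> y) (act x u m \<ominus>\<^bsub>G x\<^esub> act x w m)"
        using mult_act[OF x _ _ m(1), of "g \<otimes> y" "u \<ominus> w"] c y g(1) x m(1) by (simp add: diff_act)
      moreover have "\<dots> = act x (g \<otimes> y) (act x u m) \<ominus>\<^bsub>G x\<^esub> act x (g \<otimes> y) (act x w m)"
        using c y g(1) x m(1) by (intro act_diff) auto
      ultimately show ?thesis by (simp add: M.minus_eq)
    qed
    ultimately show ?thesis by (simp add: J_def)
  qed
  have left_inv: "\<exists>y\<in>carrier (corner E e). y \<otimes> u = e" if u: "u \<in> carrier (corner E e)" "u \<notin> J" for u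
  proof -
    have uE: "u \<in> carrier E" "u \<otimes> e = u" "e \<otimes> u = u" using u by auto
    have "(\<lambda>r. r \<otimes> u) ` carrier E = L"
    proof (rule min[OF closed_ideal_principal[OF uE(1)]])
      show "(\<lambda>r. r \<otimes> u) ` carrier E \<subseteq> L"
        unfolding Le[symmetric] using uE e(2) by (auto simp: m_assoc)
      have "\<exists>y\<in>carrier E. act x (g \<otimes> y \<otimes> u) m \<noteq> \<zero>\<^bsub>G x\<^esub>" using u by (auto simp: J_def)
      then show "\<exists>l\<in>(\<lambda>r. r \<otimes> u) ` carrier E. act x l m = m" using gen[OF uE(1)] by blast
    qed
    then obtain y where y: "y \<in> carrier E" "e = y \<otimes> u" using e(1) by blast
    \<comment> \<open>The left inverse y is found in \<open>E\<close> only; compressing it by e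
      moves it into the corner and preserves the equation, since eu = u.\<close>
    have "e \<otimes> y \<otimes> e \<in> carrier (corner E e)"
      using y(1) e by (simp add: m_assoc) (simp add: e(4) flip: m_assoc)
    moreover have "e \<otimes> y \<otimes> e \<otimes> u = e"
      using y uE e by (simp add: m_assoc)
    ultimately show ?thesis by blast
  qed
  have unit: "\<exists>y\<in>carrier (corner E e). y \<otimes> u = e \<and> u \<otimes> y = e"
    if u: "u \<in> carrier (corner E e)" "u \<notin> J" for u
  proof -
    obtain y where y: "y \<in> carrier (corner E e)" "y \<otimes> u = e" using left_inv[OF u] by blast
    have c: "u \<in> carrier E" "y \<in> carrier E" "u \<otimes> e = u" "e \<otimes> u = u" "y \<otimes> e = y" "e \<otimes> y = y"
      using u y by auto
    define w where "w = u \<otimes> y"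
    have wc: "w \<in> carrier (corner E e)" using C.m_closed[OF u(1) y(1)] by (simp add: w_def)
    then have wE: "w \<in> carrier E" "w \<otimes> e = w" "e \<otimes> w = w" by auto
    have wu: "w \<otimes> u = u" using c y by (simp add: w_def m_assoc)
    have ww: "w \<otimes> w = w" using wu c wE by (simp add: w_def flip: m_assoc)
    \<comment> \<open>The idempotent w = uy satisfies (e - w)u = 0. If w were in J, then e - w would
      lie outside J because e does, hence be left invertible, and u would be zero, which belongs to
      J.\<close>
    have "w \<notin> J"
    proof
      assume wJ: "w \<in> J"
      have "e \<ominus> w \<notin> J"
      proof
        assume "e \<ominus> w \<in> J"
        moreover have "\<ominus> w \<in> J"
          using J_diff[OF J_diff[OF wJ wJ] wJ] wE by (simp add: minus_eq r_neg)
        ultimately have "(e \<ominus> w) \<ominus> (\<ominus> w) \<in> J" by (rule J_diff)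
        then show False using Jnot wE e by (simp add: minus_eq a_assoc l_neg)
      qed
      moreover have "e \<ominus> w \<in> carrier (corner E e)"
        using wE e by (simp add: minus_eq l_distr r_distr l_minus r_minus)
      ultimately obtain z where z: "z \<in> carrier (corner E e)" "z \<otimes> (e \<ominus> w) = e" using left_inv by blast
      have "(e \<ominus> w) \<otimes> u = \<zero>" using wu wE c e by (simp add: minus_eq l_distr l_minus r_neg)
      then have "z \<otimes> (e \<ominus> w) \<otimes> u = \<zero>" using z(1) wE c e by (simp add: m_assoc)
      then have "u = \<zero>" using z c by simp
      then show False using u x m(1) g(1) by (simp add: J_def)
    qed
    then obtain z where z: "z \<in> carrier (corner E e)" "z \<otimes> w = e" using left_inv[OF wc] by blast
    \<comment> \<open>A left invertible idempotent is the identity, so uy = w = e and the left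
      inverse is two-sided.\<close>
    have "e = z \<otimes> (w \<otimes> w)" using z ww by simp
    also have "\<dots> = z \<otimes> w \<otimes> w" using z(1) wE(1) by (simp add: m_assoc)
    also have "\<dots> = w" using z wE by simp
    finally show ?thesis using y by (auto simp: w_def)
  qed
  have J_right: "u \<otimes> r \<in> J" if uJ: "u \<in> J" and r: "r \<in> carrier (corner E e)" for r u
  proof (rule ccontr)
    assume "u \<otimes> r \<notin> J"
    have uc: "u \<in> carrier (corner E e)" using uJ J_corner by blast
    then have "u \<otimes> r \<in> carrier (corner E e)" using C.m_closed[OF _ r] by simp
    then obtain y where y: "y \<in> carrier (corner E e)" "u \<otimes> r \<otimes> y = e"
      using unit \<open>u \<otimes> r \<notin> J\<close> by blast
    define w where "w = r \<otimes> y"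
    have wc: "w \<in> carrier (corner E e)" using C.m_closed[OF r y(1)] by (simp add: w_def)
    have uw: "u \<otimes> w = e" using y uc r by (simp add: w_def m_assoc)
    \<comment> \<open>u has the right inverse w. If w were in J, so would be uw = e; hence w is a
      unit, its inverse is u, and wu = e would put e into the left ideal J.\<close>
    obtain w' where w': "w' \<in> carrier (corner E e)" "w \<otimes> w' = e"
    proof (cases "w \<in> J")
      case True
      then have "u \<otimes> w \<in> J" using J_left uc by blast
      then show ?thesis using uw Jnot by simp
    next
      case False
      then show ?thesis using unit[OF wc] that by blast
    qed
    have "u = u \<otimes> (w \<otimes> w')" using w' uc by simp
    also have "\<dots> = u \<otimes> w \<otimes> w'" using uc wc w' by (simp add: m_assoc)
    also have "\<dots> = w'" using uw w' by simp
    finally have "w \<otimes> u = e" using w' by simp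
    then show False using J_left[OF uJ wc] Jnot by simp
  qed
  have J0: "\<zero> \<in> J" using x m(1) g(1) e(2) by (simp add: J_def)
  have "local_ring (corner E e)"
  proof (rule local_ringI)
    show "ideal J (corner E e)"
    proof (rule idealI)
      show "subgroup J (add_monoid (corner E e))"
      proof (rule C.add.subgroupI)
        have neg: "\<ominus> a \<in> J" if "a \<in> J" for a
          using J_diff[OF J0 that] J_corner that by (auto simp: minus_eq)
        show "a \<oplus>\<^bsub>corner E e\<^esub> b \<in> J" if "a \<in> J" "b \<in> J" for a b
          using J_diff[OF that(1) neg[OF that(2)]] that J_corner by (auto simp: minus_eq)
        show "\<ominus>\<^bsub>corner E e\<^esub> a \<in> J" if a: "a \<in> J" for a
        proof -
          have "\<ominus>\<^bsub>corner E e\<^esub> a = \<ominus> a"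
            by (rule C.minus_equality) (use a J_corner neg[OF a] in \<open>auto simp: l_neg\<close>)
          then show ?thesis using neg[OF a] by simp
        qed
      qed (use J0 J_corner in auto)
    qed (use C.ring_axioms J_left J_right in auto)
    show "\<one>\<^bsub>corner E e\<^esub> \<notin> J" using Jnot by simp
    show "u \<in> Units (corner E e)" if "u \<in> carrier (corner E e) - J" for u
      using unit that unfolding Units_def by auto
  qed
  moreover have "e \<noteq> \<zero>" using J0 Jnot by auto
  ultimately show thesis using that e eg by blast
qed

text \<open>The witness p separates s from the remaining members of F and need not be s. The finite
  character of the condition gives Zorn's lemma for unions of chains, and a new e with et = 0 for
  all old t can be adjoined although te may be nonzero.\<close>

definition independent where
  "independent Q \<longleftrightarrow> (\<forall>F. finite F \<and> F \<subseteq> Q \<longrightarrow> (\<forall>s\<in>F. \<exists>p\<in>carrier E.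
     p \<otimes> s = s \<and> (\<forall>t\<in>F - {s}. p \<otimes> t = \<zero>)))"

text \<open>The separating operators of \<open>independent\<close> depend on the finite set F. The
  conditions bs = s and bt = 0 are closed and affine, so linear compactness replaces all those
  operators by one f that works against the whole of Q.\<close>

lemma independent_coordinate:
  assumes Q: "Q \<subseteq> carrier E" "independent Q" and s: "s \<in> Q"
  shows "\<exists>f\<in>carrier E. f \<otimes> s = s \<and> (\<forall>t\<in>Q - {s}. f \<otimes> t = \<zero>)"
proof -
  let ?S = "\<lambda>t. {b \<in> carrier E. b \<otimes> t = (if t = s then s else \<zero>)}"
  have "\<exists>f\<in>into V. \<forall>C\<in>?S ` Q. f \<in> C"
  proof (rule linearly_compact[OF locally_split_V])
    show "affine V C" "closed C" if C: "C \<in> ?S ` Q" for C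
    proof -
      obtain t where t: "t \<in> Q" "C = ?S t" using C by blast
      have "t \<in> carrier E" "(if t = s then s else \<zero>) \<in> carrier E" using t(1) s Q(1) by auto
      then show "affine V C" "closed C" unfolding t(2) by (rule closed_mult_eq)+
    qed
    fix F assume "finite F" "F \<subseteq> ?S ` Q"
    then obtain P where P: "P \<subseteq> Q" "finite P" "F = ?S ` P" by (meson finite_subset_image)
    \<comment> \<open>P comes from an arbitrary finite set of conditions and may omit s, whereas
      independence yields a separating operator only for a member of the finite set.\<close>
    have "finite (insert s P) \<and> insert s P \<subseteq> Q" using P s by simp
    then obtain p where p: "p \<in> carrier E" "p \<otimes> s = s" "\<forall>t\<in>insert s P - {s}. p \<otimes> t = \<zero>"
      using Q(2)[unfolded independent_def, THEN spec, of "insert s P"] by auto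
    have "p \<in> ?S t" if "t \<in> P" for t using p that by auto
    then have "p \<in> into V \<inter> \<Inter>F" using P(3) p(1) by auto
    then show "into V \<inter> \<Inter>F \<noteq> {}" by blast
  qed
  then obtain f where f: "f \<in> carrier E" "\<And>t. t \<in> Q \<Longrightarrow> f \<otimes> t = (if t = s then s else \<zero>)" by auto
  then show ?thesis using s by (intro bexI[of _ f]) auto
qed

text \<open>c is the sum of s (f s) over s in F, a projection onto the sum of the images of the
  members of F. The last three clauses record its use without sums: the coordinates s (f s)
  determine cv, and bc is controlled by the products bs.\<close>

lemma finite_projection:
  assumes Q: "Q \<subseteq> carrier E" and idem: "\<forall>s\<in>Q. s \<otimes> s = s"
    and f: "\<forall>s\<in>Q. f s \<in> carrier E \<and> f s \<otimes> s = s \<and> (\<forall>t\<in>Q - {s}. f s \<otimes> t = \<zero>)"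
    and F: "finite F" "F \<subseteq> Q"
  shows "\<exists>c\<in>carrier E. (\<forall>t\<in>Q. c \<otimes> t = (if t \<in> F then t else \<zero>)) \<and>
    (\<forall>x\<in>X. \<forall>v\<in>V x. (\<forall>s\<in>F. act x (s \<otimes> f s) v = \<zero>\<^bsub>G x\<^esub>) \<longrightarrow> act x c v = \<zero>\<^bsub>G x\<^esub>) \<and>
    (\<forall>b\<in>carrier E. (\<forall>s\<in>F. b \<otimes> s = \<zero>) \<longrightarrow> b \<otimes> c = \<zero>) \<and>
    (\<forall>b\<in>carrier E. (\<forall>s\<in>F. b \<otimes> s = s) \<longrightarrow> b \<otimes> c = c)"
  using F
proof (induction F rule: finite_induct)
  case empty
  then show ?case using Q by (intro bexI[of _ \<zero>]) auto
next
  case (insert s F)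
  then have s: "s \<in> Q" "s \<in> carrier E" "f s \<in> carrier E" and FE: "F \<subseteq> carrier E" using Q f by auto
  obtain c where c: "c \<in> carrier E" "\<And>t. t \<in> Q \<Longrightarrow> c \<otimes> t = (if t \<in> F then t else \<zero>)"
    "\<And>x v. \<lbrakk>x \<in> X; v \<in> V x; \<And>s. s \<in> F \<Longrightarrow> act x (s \<otimes> f s) v = \<zero>\<^bsub>G x\<^esub>\<rbrakk> \<Longrightarrow> act x c v = \<zero>\<^bsub>G x\<^esub>"
    "\<And>b. \<lbrakk>b \<in> carrier E; \<And>s. s \<in> F \<Longrightarrow> b \<otimes> s = \<zero>\<rbrakk> \<Longrightarrow> b \<otimes> c = \<zero>"
    "\<And>b. \<lbrakk>b \<in> carrier E; \<And>s. s \<in> F \<Longrightarrow> b \<otimes> s = s\<rbrakk> \<Longrightarrow> b \<otimes> c = c"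
    using insert.IH insert.prems by auto
  let ?c = "c \<oplus> s \<otimes> f s"
  show ?case
  proof (intro bexI[of _ ?c] conjI ballI impI)
    show "?c \<in> carrier E" using c s by simp
    show "?c \<otimes> t = (if t \<in> insert s F then t else \<zero>)" if t: "t \<in> Q" for t
    proof -
      have tE: "t \<in> carrier E" using t Q by blast
      have "?c \<otimes> t = c \<otimes> t \<oplus> s \<otimes> (f s \<otimes> t)" using c(1) s tE by (simp add: l_distr m_assoc)
      then show ?thesis
        using c(2)[OF t] f idem insert.hyps(2) s tE t by (cases "t = s") auto
    qed
    show "act x ?c v = \<zero>\<^bsub>G x\<^esub>" if "x \<in> X" "v \<in> V x" "\<forall>t\<in>insert s F. act x (t \<otimes> f t) v = \<zero>\<^bsub>G x\<^esub>" for x v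
    proof -
      interpret M: abelian_group "G x" using mod_abelian that by blast
      show ?thesis using c(1) c(3)[of x v] s that by (simp add: add_act)
    qed
    show "b \<otimes> ?c = \<zero>" if "b \<in> carrier E" "\<forall>t\<in>insert s F. b \<otimes> t = \<zero>" for b
      using c(1) c(4)[of b] s that by (simp add: r_distr flip: m_assoc)
    show "b \<otimes> ?c = ?c" if "b \<in> carrier E" "\<forall>t\<in>insert s F. b \<otimes> t = t" for b
      using c(1) c(5)[of b] s that by (simp add: r_distr flip: m_assoc)
  qed
qed

text \<open>The operator form of the direct sum. The map sending v to the family of all
  \<open>p s\<close> v has finite supports and trivial kernel; surjectivity onto finitely supported
  families of elements of the images of s is contained in the equations for (p s)s and (p
  s)t.\<close>

theorem local_decomposition:
  "\<exists>Q p. Q \<subseteq> carrier E \<and>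
    (\<forall>s\<in>Q. s \<otimes> s = s \<and> s \<noteq> \<zero> \<and> local_ring (corner E s)) \<and>
    (\<forall>s\<in>Q. p s \<in> carrier E \<and> s \<otimes> p s = p s \<and> p s \<otimes> s = s \<and> (\<forall>t\<in>Q. t \<noteq> s \<longrightarrow> p s \<otimes> t = \<zero>)) \<and>
    (\<forall>x\<in>X. \<forall>v\<in>V x. finite {s \<in> Q. act x (p s) v \<noteq> \<zero>\<^bsub>G x\<^esub>} \<and>
      ((\<forall>s\<in>Q. act x (p s) v = \<zero>\<^bsub>G x\<^esub>) \<longrightarrow> v = \<zero>\<^bsub>G x\<^esub>))"
proof -
  define \<A> where "\<A> = {Q. Q \<subseteq> carrier E \<and>
    (\<forall>s\<in>Q. s \<otimes> s = s \<and> s \<noteq> \<zero> \<and> local_ring (corner E s)) \<and> independent Q}"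
  have "\<exists>M\<in>\<A>. \<forall>Y\<in>\<A>. M \<subseteq> Y \<longrightarrow> Y = M"
  proof (rule subset_Zorn_nonempty)
    have "{} \<in> \<A>" by (auto simp: \<A>_def independent_def)
    then show "\<A> \<noteq> {}" by blast
    fix \<C> assume C: "\<C> \<noteq> {}" "subset.chain \<A> \<C>"
    have CA: "\<C> \<subseteq> \<A>" using C(2) by (simp add: subset_chain_def)
    have "independent (\<Union>\<C>)"
      unfolding independent_def
    proof (intro allI impI)
      fix F assume F: "finite F \<and> F \<subseteq> \<Union>\<C>"
      then obtain Q where "Q \<in> \<C>" "F \<subseteq> Q"
        using finite_subset_Union_chain[OF _ _ C] by metis
      moreover from this have "independent Q" using CA by (auto simp: \<A>_def)
      ultimately show "\<forall>s\<in>F. \<exists>p\<in>carrier E. p \<otimes> s = s \<and> (\<forall>t\<in>F - {s}. p \<otimes> t = \<zero>)"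
        using F unfolding independent_def by blast
    qed
    then show "\<Union>\<C> \<in> \<A>" using CA unfolding \<A>_def by blast
  qed
  then obtain Q where QA: "Q \<in> \<A>" and max: "\<And>Y. \<lbrakk>Y \<in> \<A>; Q \<subseteq> Y\<rbrakk> \<Longrightarrow> Y = Q" by blast
  have QE: "Q \<subseteq> carrier E" and idem: "\<And>s. s \<in> Q \<Longrightarrow> s \<otimes> s = s" and ind: "independent Q"
    and loc: "\<And>s. s \<in> Q \<Longrightarrow> s \<noteq> \<zero> \<and> local_ring (corner E s)"
    using QA by (auto simp: \<A>_def)
  have "\<forall>s\<in>Q. \<exists>f. f \<in> carrier E \<and> f \<otimes> s = s \<and> (\<forall>t\<in>Q - {s}. f \<otimes> t = \<zero>)"
    using independent_coordinate[OF QE ind] by blast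
  then obtain f where ff: "\<forall>s\<in>Q. f s \<in> carrier E \<and> f s \<otimes> s = s \<and> (\<forall>t\<in>Q - {s}. f s \<otimes> t = \<zero>)"
    by metis
  then have f: "\<And>s. s \<in> Q \<Longrightarrow> f s \<in> carrier E" "\<And>s. s \<in> Q \<Longrightarrow> f s \<otimes> s = s"
    "\<And>s t. \<lbrakk>s \<in> Q; t \<in> Q; t \<noteq> s\<rbrakk> \<Longrightarrow> f s \<otimes> t = \<zero>" by auto
  have "\<forall>s\<in>Q. s \<otimes> s = s" using idem by blast
  note proj = finite_projection[OF QE this ff]
  \<comment> \<open>For finite F in Q this says that v lies in the sum of the images of the t in F:
    the projection belonging to F fixes v, and conversely an operator fixing every such image fixes
    their sum.\<close>
  define fixes_on where "fixes_on F x v \<longleftrightarrow> (\<forall>c\<in>carrier E. (\<forall>t\<in>F. c \<otimes> t = t) \<longrightarrow> act x c v = v)" for F x v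
  have fixes_mono: "fixes_on F' x v" if "fixes_on F x v" "F \<subseteq> F'" for F F' x v
    using that unfolding fixes_on_def by blast
  define N where "N x = {v \<in> V x. \<exists>F. finite F \<and> F \<subseteq> Q \<and> fixes_on F x v}" for x
  have subN: "subgroups N"
    unfolding subgroups_def
  proof (intro ballI conjI)
    fix x assume x: "x \<in> X"
    interpret M: abelian_group "G x" using mod_abelian x .
    show "N x \<subseteq> V x" by (auto simp: N_def)
    show "\<zero>\<^bsub>G x\<^esub> \<in> N x" using x by (auto simp: N_def fixes_on_def intro!: exI[of _ "{}"])
    fix u v assume u: "u \<in> N x" and v: "v \<in> N x"
    obtain F F' where F: "finite F" "F \<subseteq> Q" "fixes_on F x u" "finite F'" "F' \<subseteq> Q" "fixes_on F' x v"
      using u v by (auto simp: N_def)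
    have "fixes_on (F \<union> F') x u" "fixes_on (F \<union> F') x v"
      using fixes_mono F(3,6) by blast+
    moreover have "u \<in> V x" "v \<in> V x" using u v by (auto simp: N_def)
    ultimately have "fixes_on (F \<union> F') x (u \<ominus>\<^bsub>G x\<^esub> v)"
      using x by (simp add: fixes_on_def act_diff)
    then show "u \<ominus>\<^bsub>G x\<^esub> v \<in> N x"
      using F \<open>u \<in> V x\<close> \<open>v \<in> V x\<close> unfolding N_def by (intro CollectI conjI exI[of _ "F \<union> F'"]) auto
  qed
  have "locally_split N"
    unfolding locally_split_def
  proof (intro conjI allI impI subN)
    fix P assume P: "finite P \<and> P \<subseteq> Sigma X N"
    have "\<forall>p\<in>P. \<exists>F. finite F \<and> F \<subseteq> Q \<and> fixes_on F (fst p) (snd p)"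
    proof
      fix p assume "p \<in> P"
      then obtain x v where "p = (x, v)" "v \<in> N x" using P by blast
      then show "\<exists>F. finite F \<and> F \<subseteq> Q \<and> fixes_on F (fst p) (snd p)" by (simp add: N_def)
    qed
    then obtain H where H: "\<And>p. p \<in> P \<Longrightarrow> finite (H p) \<and> H p \<subseteq> Q \<and> fixes_on (H p) (fst p) (snd p)"
      by metis
    \<comment> \<open>One finite F that serves all points of P; the projection c belonging to it
      provides the local splitting.\<close>
    define F where "F = \<Union>(H ` P)"
    have F: "finite F" "F \<subseteq> Q" using P H by (auto simp: F_def)
    obtain c where c: "c \<in> carrier E" "\<And>t. t \<in> Q \<Longrightarrow> c \<otimes> t = (if t \<in> F then t else \<zero>)"
      "\<And>b. \<lbrakk>b \<in> carrier E; \<And>s. s \<in> F \<Longrightarrow> b \<otimes> s = s\<rbrakk> \<Longrightarrow> b \<otimes> c = c"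
      using proj[OF F] by auto
    have "fixes_on F x (act x c v)" if "x \<in> X" "v \<in> V x" for x v
      using c(1,3) that unfolding fixes_on_def by (auto simp flip: mult_act)
    then have "c \<in> into N" using c(1) F unfolding into_def N_def by auto
    moreover have "\<forall>(x, v)\<in>P. act x c v = v"
    proof (intro ballI, clarify)
      fix x v assume p: "(x, v) \<in> P"
      then have "H (x, v) \<subseteq> F" by (auto simp: F_def)
      then have "fixes_on F x v" using fixes_mono[of "H (x, v)" x v F] H[OF p] by simp
      then show "act x c v = v" using c(1,2) F(2) unfolding fixes_on_def by (auto simp: subset_iff)
    qed
    ultimately show "\<exists>a\<in>into N. \<forall>(x, v)\<in>P. act x a v = v" by blast
  qed
  then obtain q where q: "q \<in> into N" "\<And>x v. \<lbrakk>x \<in> X; v \<in> N x\<rbrakk> \<Longrightarrow> act x q v = v"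
    using locally_split_imp_split by blast
  have qE: "q \<in> carrier E" using q(1) into_carrier by blast
  have qq: "q \<otimes> q = q"
  proof (rule faithful)
    fix x v assume "x \<in> X" "v \<in> V x"
    then show "act x (q \<otimes> q) v = act x q v" using q qE by (simp add: mult_act into_def)
  qed (use qE in auto)
  have qs: "q \<otimes> s = s" if s: "s \<in> Q" for s
  proof (rule faithful)
    fix x v assume x: "x \<in> X" "v \<in> V x"
    have sE: "s \<in> carrier E" using s QE by blast
    have "fixes_on {s} x (act x s v)"
      using x sE unfolding fixes_on_def by (auto simp flip: mult_act)
    then have "act x s v \<in> N x" using s sE x unfolding N_def by blast
    then show "act x (q \<otimes> s) v = act x s v" using q(2) qE sE x by (simp add: mult_act)
  qed (use s QE qE in auto)
  \<comment> \<open>Otherwise there is a local idempotent e with e(1 - q) = e, so eq = 0. Since qs =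
    s for s in Q, this gives es = 0, and e can be adjoined to Q, contradicting maximality.\<close>
  have q1: "q = \<one>"
  proof (rule ccontr)
    assume "q \<noteq> \<one>"
    have "\<one> \<ominus> q \<noteq> \<zero>" using \<open>q \<noteq> \<one>\<close> qE by (simp add: diff_eq_zero_iff)
    moreover have "(\<one> \<ominus> q) \<otimes> (\<one> \<ominus> q) = \<one> \<ominus> q"
      using qE qq by (simp add: minus_eq l_distr r_distr l_minus r_minus r_neg)
    ultimately obtain e where e: "e \<in> carrier E" "e \<otimes> e = e" "e \<otimes> (\<one> \<ominus> q) = e" "e \<noteq> \<zero>"
      "local_ring (corner E e)"
      using local_idempotent[of "\<one> \<ominus> q"] qE by auto
    have "e \<otimes> q = e \<otimes> (\<one> \<ominus> q) \<otimes> q" using e(3) by simp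
    also have "\<dots> = e \<otimes> ((\<one> \<ominus> q) \<otimes> q)" using e(1) qE by (simp add: m_assoc)
    also have "(\<one> \<ominus> q) \<otimes> q = \<zero>" using qE qq by (simp add: minus_eq l_distr l_minus r_neg)
    finally have eq: "e \<otimes> q = \<zero>" using e(1) by simp
    have es: "e \<otimes> s = \<zero>" if "s \<in> Q" for s
    proof -
      have sE: "s \<in> carrier E" using that QE by blast
      have "e \<otimes> s = e \<otimes> q \<otimes> s" using qs[OF that] e(1) qE sE by (simp add: m_assoc)
      then show ?thesis using eq sE by simp
    qed
    have "e \<notin> Q" using es e by auto
    have "independent (insert e Q)"
      unfolding independent_def
    proof (intro allI impI ballI)
      fix F s assume F: "finite F \<and> F \<subseteq> insert e Q" and s: "s \<in> F"
      show "\<exists>p\<in>carrier E. p \<otimes> s = s \<and> (\<forall>t\<in>F - {s}. p \<otimes> t = \<zero>)"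
      proof (cases "s = e")
        case True
        then show ?thesis using e es F by (intro bexI[of _ e]) auto
      next
        case False
        then have sQ: "s \<in> Q" using s F by blast
        \<comment> \<open>The factor 1 - e kills e and acts as the identity on every t in Q because
          et = 0. So the old coordinate is corrected at e and unchanged elsewhere.\<close>
        let ?p = "f s \<otimes> (\<one> \<ominus> e)"
        have p: "?p \<otimes> t = f s \<otimes> t" if "t \<in> Q" for t
        proof -
          have "t \<in> carrier E" using that QE by blast
          then have "(\<one> \<ominus> e) \<otimes> t = t" using e(1) es[OF that] by (simp add: minus_eq l_distr l_minus)
          then show ?thesis using f(1)[OF sQ] e(1) \<open>t \<in> carrier E\<close> by (simp add: m_assoc)
        qed
        have "(\<one> \<ominus> e) \<otimes> e = \<zero>" using e(1,2) by (simp add: minus_eq l_distr l_minus r_neg)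
        then have "?p \<otimes> e = \<zero>" using f(1)[OF sQ] e(1) by (simp add: m_assoc)
        then have "?p \<otimes> t = \<zero>" if "t \<in> F - {s}" for t
          using that F p[of t] f(3)[OF sQ, of t] by (cases "t = e") auto
        moreover have "?p \<otimes> s = s" using p[OF sQ] f(2)[OF sQ] by simp
        ultimately show ?thesis using f(1)[OF sQ] e(1) by (intro bexI[of _ ?p]) auto
      qed
    qed
    then have "insert e Q \<in> \<A>" using QE idem loc e by (auto simp: \<A>_def)
    then show False using max \<open>e \<notin> Q\<close> by blast
  qed
  \<comment> \<open>Multiplying by s on the left makes the coordinate take values in the image of s;
    the values of \<open>f s\<close> alone need not lie there.\<close>
  define p where "p s = s \<otimes> f s" for s
  have p: "p s \<in> carrier E" "s \<otimes> p s = p s" "p s \<otimes> s = s" "\<And>t. \<lbrakk>t \<in> Q; t \<noteq> s\<rbrakk> \<Longrightarrow> p s \<otimes> t = \<zero>"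
    if s: "s \<in> Q" for s
  proof -
    have sE: "s \<in> carrier E" "f s \<in> carrier E" using s QE f by auto
    show "p s \<in> carrier E" using sE by (simp add: p_def)
    show "s \<otimes> p s = p s" using sE idem[OF s] by (simp add: p_def flip: m_assoc)
    show "p s \<otimes> s = s" using sE idem[OF s] f(2)[OF s] by (simp add: p_def m_assoc)
    show "p s \<otimes> t = \<zero>" if t: "t \<in> Q" "t \<noteq> s" for t
    proof -
      have "t \<in> carrier E" using t QE by blast
      then show ?thesis using sE f(3)[OF s t] by (simp add: p_def m_assoc)
    qed
  qed
  have fin: "finite {s \<in> Q. act x (p s) v \<noteq> \<zero>\<^bsub>G x\<^esub>}"
      "(\<forall>s\<in>Q. act x (p s) v = \<zero>\<^bsub>G x\<^esub>) \<longrightarrow> v = \<zero>\<^bsub>G x\<^esub>" if x: "x \<in> X" and v: "v \<in> V x" for x v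
  proof -
    have "v \<in> N x" using q(1) q1 x v by (auto simp: into_def)
    then obtain F where F: "finite F" "F \<subseteq> Q" "fixes_on F x v" by (auto simp: N_def)
    obtain c where c: "c \<in> carrier E" "\<And>t. t \<in> Q \<Longrightarrow> c \<otimes> t = (if t \<in> F then t else \<zero>)"
      "(\<forall>s\<in>F. act x (s \<otimes> f s) v = \<zero>\<^bsub>G x\<^esub>) \<longrightarrow> act x c v = \<zero>\<^bsub>G x\<^esub>"
      "\<And>b. \<lbrakk>b \<in> carrier E; \<And>s. s \<in> F \<Longrightarrow> b \<otimes> s = \<zero>\<rbrakk> \<Longrightarrow> b \<otimes> c = \<zero>"
      using proj[OF F(1,2)] x v by auto
    \<comment> \<open>As q = 1, every v lies in a finite sum of images and is fixed by its
      projection c. Coordinates outside F vanish on v since they annihilate c, and those inside F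
      determine cv = v.\<close>
    have cv: "act x c v = v" using F(2,3) c(1,2) unfolding fixes_on_def by (auto simp: subset_iff)
    have "act x (p s) v = \<zero>\<^bsub>G x\<^esub>" if s: "s \<in> Q - F" for s
    proof -
      have "p s \<otimes> c = \<zero>" using c(4)[of "p s"] p(1,4)[of s] s F(2) by auto
      then have "act x (p s) (act x c v) = \<zero>\<^bsub>G x\<^esub>" using p(1)[of s] s c(1) x v by (simp flip: mult_act)
      then show ?thesis using cv by simp
    qed
    then have "{s \<in> Q. act x (p s) v \<noteq> \<zero>\<^bsub>G x\<^esub>} \<subseteq> F" by blast
    then show "finite {s \<in> Q. act x (p s) v \<noteq> \<zero>\<^bsub>G x\<^esub>}" using F(1) by (rule finite_subset)
    show "(\<forall>s\<in>Q. act x (p s) v = \<zero>\<^bsub>G x\<^esub>) \<longrightarrow> v = \<zero>\<^bsub>G x\<^esub>" using c(3) cv F(2) by (auto simp: p_def)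
  qed
  show ?thesis
    by (intro exI[of _ Q] exI[of _ p] conjI ballI) (use QE idem loc p fin in auto)
qed

end

section \<open>Functoriality of the tensor product\<close>

lemma module_of_simps [simp]:
  "carrier (module_of G act) = carrier G" "zero (module_of G act) = \<one>\<^bsub>G\<^esub>"
  "add (module_of G act) = mult G" "smult (module_of G act) = act"
  by (auto simp: module_of_def)

lemma abelian_group_module_of:
  assumes "comm_group G" shows "abelian_group (module_of G act)"
proof -
  interpret comm_group G by fact
  show ?thesis
  proof (rule abelian_groupI)
    show "\<exists>y\<in>carrier (module_of G act). y \<oplus>\<^bsub>module_of G act\<^esub> x = \<zero>\<^bsub>module_of G act\<^esub>"
      if "x \<in> carrier (module_of G act)" for x
      using that by (intro bexI[of _ "inv\<^bsub>G\<^esub> x"]) auto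
  qed (auto simp: m_ac)
qed

lemma left_linear_mapsD:
  assumes "f \<in> left_linear_maps R M N"
  shows "m \<in> carrier M \<Longrightarrow> f m \<in> carrier N"
    "\<lbrakk>m \<in> carrier M; n \<in> carrier M\<rbrakk> \<Longrightarrow> f (m \<oplus>\<^bsub>M\<^esub> n) = f m \<oplus>\<^bsub>N\<^esub> f n"
    "\<lbrakk>r \<in> carrier R; m \<in> carrier M\<rbrakk> \<Longrightarrow> f (r \<odot>\<^bsub>M\<^esub> m) = r \<odot>\<^bsub>N\<^esub> f m"
  using assms by (auto simp: left_linear_maps_def hom_def)

lemma left_linear_mapsI:
  assumes "\<And>m. m \<in> carrier M \<Longrightarrow> f m \<in> carrier N"
    "\<And>m n. \<lbrakk>m \<in> carrier M; n \<in> carrier M\<rbrakk> \<Longrightarrow> f (m \<oplus>\<^bsub>M\<^esub> n) = f m \<oplus>\<^bsub>N\<^esub> f n"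
    "\<And>r m. \<lbrakk>r \<in> carrier R; m \<in> carrier M\<rbrakk> \<Longrightarrow> f (r \<odot>\<^bsub>M\<^esub> m) = r \<odot>\<^bsub>N\<^esub> f m"
  shows "f \<in> left_linear_maps R M N"
  using assms by (auto simp: left_linear_maps_def hom_def)

lemma left_linear_maps_zero:
  assumes "f \<in> left_linear_maps R M N" "abelian_group M" "abelian_group N"
  shows "f \<zero>\<^bsub>M\<^esub> = \<zero>\<^bsub>N\<^esub>"
proof -
  interpret M: abelian_group M by fact
  interpret N: abelian_group N by fact
  show ?thesis
    using left_linear_mapsD(1)[OF assms(1), of "\<zero>\<^bsub>M\<^esub>"] left_linear_mapsD(2)[OF assms(1), of "\<zero>\<^bsub>M\<^esub>" "\<zero>\<^bsub>M\<^esub>"]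
    by (simp add: N.add.l_cancel_one')
qed

lemma left_linear_maps_uminus:
  assumes "f \<in> left_linear_maps R M N" "abelian_group M" "abelian_group N" "m \<in> carrier M"
  shows "f (\<ominus>\<^bsub>M\<^esub> m) = \<ominus>\<^bsub>N\<^esub> f m"
proof -
  interpret M: abelian_group M by fact
  interpret N: abelian_group N by fact
  note f = left_linear_mapsD[OF assms(1)]
  have "f (\<ominus>\<^bsub>M\<^esub> m) \<oplus>\<^bsub>N\<^esub> f m = \<zero>\<^bsub>N\<^esub>"
    using f(2)[of "\<ominus>\<^bsub>M\<^esub> m" m] left_linear_maps_zero[OF assms(1-3)] assms(4) by (simp add: M.l_neg)
  then show ?thesis using f(1) assms(4) by (intro N.minus_equality[symmetric]) auto
qed

lemma left_linear_maps_comp: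
  assumes "f \<in> left_linear_maps R M N" "g \<in> left_linear_maps R N K"
  shows "(\<lambda>m. g (f m)) \<in> left_linear_maps R M K"
  using left_linear_mapsD[OF assms(1)] left_linear_mapsD[OF assms(2)]
  by (intro left_linear_mapsI) auto

section \<open>Tensor products by generators and relations\<close>

lemma keys_diffI:
  "\<lbrakk>Poly_Mapping.keys u \<subseteq> S; Poly_Mapping.keys w \<subseteq> S\<rbrakk> \<Longrightarrow> Poly_Mapping.keys (u - w) \<subseteq> S"
  using keys_diff[of u w] by blast

lemma keys_addI:
  "\<lbrakk>Poly_Mapping.keys u \<subseteq> S; Poly_Mapping.keys w \<subseteq> S\<rbrakk> \<Longrightarrow> Poly_Mapping.keys (u + w) \<subseteq> S"
  using keys_add[of u w] by blast

text \<open>The relators of \<open>tensor_null\<close> as an inductive set, so that the three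
  families can be treated by case analysis.\<close>

inductive_set tensor_gens ::
    "('r, 'y) ring_scheme \<Rightarrow> ('l, 'r, 'a, 'z) bimodule_scheme
      \<Rightarrow> ('r, 'm, 'w) module_scheme \<Rightarrow> ('a \<times> 'm \<Rightarrow>\<^sub>0 int) set"
  for R :: "('r, 'y) ring_scheme" and A :: "('l, 'r, 'a, 'z) bimodule_scheme"
    and M :: "('r, 'm, 'w) module_scheme" where
  add_left: "\<lbrakk>a \<in> carrier A; b \<in> carrier A; m \<in> carrier M\<rbrakk> \<Longrightarrow>
    frag_of (a \<oplus>\<^bsub>A\<^esub> b, m) - frag_of (a, m) - frag_of (b, m) \<in> tensor_gens R A M"
| add_right: "\<lbrakk>a \<in> carrier A; m \<in> carrier M; n \<in> carrier M\<rbrakk> \<Longrightarrow>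
    frag_of (a, m \<oplus>\<^bsub>M\<^esub> n) - frag_of (a, m) - frag_of (a, n) \<in> tensor_gens R A M"
| balanced: "\<lbrakk>a \<in> carrier A; r \<in> carrier R; m \<in> carrier M\<rbrakk> \<Longrightarrow>
    frag_of (a \<odot>\<^sub>r\<^bsub>A\<^esub> r, m) - frag_of (a, r \<odot>\<^bsub>M\<^esub> m) \<in> tensor_gens R A M"

lemma tensor_null_eq: "tensor_null R A M = generate (tensor_free A M) (tensor_gens R A M)"
  unfolding tensor_null_def
  by (rule arg_cong[where f = "generate _"])
    (auto elim!: tensor_gens.cases intro: tensor_gens.intros)

definition tensor_coset where
  "tensor_coset R A M u = tensor_null R A M #>\<^bsub>tensor_free A M\<^esub> u"

abbreviation pure_tensor where
  "pure_tensor R A M a m \<equiv> tensor_coset R A M (frag_of (a, m))"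

abbreviation frag_map where
  "frag_map g h \<equiv> frag_extend (\<lambda>(a, m). frag_of (g a, h m))"

lemma frag_map_frag_map: "frag_map g' h' (frag_map g h u) = frag_map (\<lambda>a. g' (g a)) (\<lambda>m. h' (h m)) u"
proof -
  have *: "(\<lambda>(a, m). frag_of (p a, q m)) = frag_of \<circ> map_prod p q" for p q by auto
  show ?thesis
    unfolding * frag_extend_compose by (simp add: map_prod.comp comp_def map_prod_def case_prod_beta')
qed

lemma frag_map_cong:
  assumes "Poly_Mapping.keys u \<subseteq> S" "\<And>a m. (a, m) \<in> S \<Longrightarrow> g a = g' a \<and> h m = h' m"
  shows "frag_map g h u = frag_map g' h' u"
  by (rule frag_extend_eq) (use assms in auto)

lemma frag_map_id: "frag_map (\<lambda>a. a) (\<lambda>m. m) u = u"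
  by (rule frag_induction[OF subset_UNIV[of "Poly_Mapping.keys u"], of "\<lambda>u. frag_map (\<lambda>a. a) (\<lambda>m. m) u = u"])
    (auto simp: frag_extend_diff)

lemma keys_frag_map:
  assumes "Poly_Mapping.keys u \<subseteq> carrier A \<times> carrier M" "\<And>a. a \<in> carrier A \<Longrightarrow> g a \<in> carrier B"
    "\<And>m. m \<in> carrier M \<Longrightarrow> h m \<in> carrier N"
  shows "Poly_Mapping.keys (frag_map g h u) \<subseteq> carrier B \<times> carrier N"
  by (rule order_trans[OF keys_frag_extend]) (use assms in auto)

locale tensor_product = A: bimodule L R A + M: left_module R M for L R A M
begin

abbreviation F where "F \<equiv> tensor_free A M"
abbreviation T where "T \<equiv> tensor R A M"
abbreviation coset where "coset \<equiv> tensor_coset R A M"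

lemma tensor_gens_carrier: "tensor_gens R A M \<subseteq> carrier F"
proof
  fix w assume "w \<in> tensor_gens R A M"
  then have "Poly_Mapping.keys w \<subseteq> carrier A \<times> carrier M"
    by cases (simp_all add: A.rsmult_closed M.smult_closed keys_diffI)
  then show "w \<in> carrier F" by simp
qed

sublocale F: comm_group F by (rule abelian_free_Abelian_group)

lemma subgroup_tensor_null: "subgroup (tensor_null R A M) F"
  unfolding tensor_null_eq using F.generate_is_subgroup tensor_gens_carrier .

lemma normal_tensor_null: "tensor_null R A M \<lhd> F"
  using subgroup_tensor_null F.normal_iff_subgroup by simp

lemma coset_hom: "coset \<in> hom F (F Mod tensor_null R A M)"
  using normal.r_coset_hom_Mod[OF normal_tensor_null] by (simp add: tensor_coset_def[abs_def])

lemma carrier_tensor: "carrier T = coset ` carrier F"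
  by (auto simp: tensor_def FactGroup_def RCOSETS_def tensor_coset_def)

lemma coset_closed: "Poly_Mapping.keys u \<subseteq> carrier A \<times> carrier M \<Longrightarrow> coset u \<in> carrier T"
  unfolding carrier_tensor by simp

lemma add_coset:
  assumes "Poly_Mapping.keys u \<subseteq> carrier A \<times> carrier M" "Poly_Mapping.keys w \<subseteq> carrier A \<times> carrier M"
  shows "coset u \<oplus>\<^bsub>T\<^esub> coset w = coset (u + w)"
  using hom_mult[OF coset_hom, of u w] assms by (simp add: tensor_def)

lemma coset_eqI:
  assumes "Poly_Mapping.keys u \<subseteq> carrier A \<times> carrier M" "Poly_Mapping.keys w \<subseteq> carrier A \<times> carrier M"
    and "u - w \<in> tensor_null R A M"
  shows "coset u = coset w"
proof -
  have "u \<in> tensor_null R A M #>\<^bsub>F\<^esub> w"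
    unfolding r_coset_def using assms(3) by (auto intro!: bexI[of _ "u - w"])
  then show ?thesis
    unfolding tensor_coset_def using F.repr_independence[OF _ _ subgroup_tensor_null] assms(2) by auto
qed

lemma gens_null: "u \<in> tensor_gens R A M \<Longrightarrow> u \<in> tensor_null R A M"
  unfolding tensor_null_eq by (rule generate.incl)

lemma pure_closed: "\<lbrakk>a \<in> carrier A; m \<in> carrier M\<rbrakk> \<Longrightarrow> pure_tensor R A M a m \<in> carrier T"
  by (intro coset_closed) auto

lemma pure_add:
  assumes "a \<in> carrier A" "m \<in> carrier M" "n \<in> carrier M"
  shows "pure_tensor R A M a (m \<oplus>\<^bsub>M\<^esub> n) = pure_tensor R A M a m \<oplus>\<^bsub>T\<^esub> pure_tensor R A M a n"
proof -
  have "coset (frag_of (a, m \<oplus>\<^bsub>M\<^esub> n)) = coset (frag_of (a, m) + frag_of (a, n))"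
  proof (rule coset_eqI)
    show "frag_of (a, m \<oplus>\<^bsub>M\<^esub> n) - (frag_of (a, m) + frag_of (a, n)) \<in> tensor_null R A M"
      unfolding diff_diff_eq[symmetric]
      by (rule gens_null) (rule tensor_gens.add_right[OF assms])
  qed (use assms in \<open>simp_all add: keys_addI\<close>)
  then show ?thesis using assms by (simp add: add_coset)
qed

text \<open>Composition with the coset map moves the question to the free abelian group, where
  induction on formal sums reduces it to basis elements.\<close>

lemma tensor_hom_eqI:
  assumes K: "group K" and f: "f \<in> hom (add_monoid T) K" and g: "g \<in> hom (add_monoid T) K"
    and pure: "\<And>a m. \<lbrakk>a \<in> carrier A; m \<in> carrier M\<rbrakk> \<Longrightarrow>
      f (pure_tensor R A M a m) = g (pure_tensor R A M a m)"
    and t: "t \<in> carrier T"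
  shows "f t = g t"
proof -
  have c: "coset \<in> hom F (add_monoid T)"
    using coset_hom by (auto simp: hom_def tensor_def)
  interpret f: group_hom F K "f \<circ> coset"
    using K hom_compose[OF c f] by (simp add: group_hom_def group_hom_axioms_def)
  interpret g: group_hom F K "g \<circ> coset"
    using K hom_compose[OF c g] by (simp add: group_hom_def group_hom_axioms_def)
  obtain u where u: "Poly_Mapping.keys u \<subseteq> carrier A \<times> carrier M" "t = coset u"
    using t by (auto simp: carrier_tensor)
  have "Poly_Mapping.keys u \<subseteq> carrier A \<times> carrier M \<and> (f \<circ> coset) u = (g \<circ> coset) u"
    using u(1)
  proof (induction u rule: frag_induction)
    case zero
    show ?case using f.hom_one g.hom_one by simp
  next
    case (one p)
    then show ?case using pure by auto
  next
    case (diff a b)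
    have "a - b = a \<otimes>\<^bsub>F\<^esub> inv\<^bsub>F\<^esub> b" using diff by simp
    then have "(f \<circ> coset) (a - b) = (g \<circ> coset) (a - b)"
      using diff f.hom_mult[of a "inv\<^bsub>F\<^esub> b"] g.hom_mult[of a "inv\<^bsub>F\<^esub> b"] f.hom_inv[of b] g.hom_inv[of b]
        F.inv_closed[of b]
      by simp
    then show ?case using diff keys_diff[of a b] by blast
  qed
  then show ?thesis using u by simp
qed

end

text \<open>\<open>tensor_map\<close> is a union over all representatives, so this is its
  well-definedness. The map on formal sums carries relators to relators, hence the null subgroup
  into the null subgroup, and all representatives give one coset.\<close>

lemma tensor_map_coset:
  assumes AM: "tensor_product L R A M" and BN: "tensor_product K R B N"
    and g: "\<And>a. a \<in> carrier A \<Longrightarrow> g a \<in> carrier B"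
      "\<And>a b. \<lbrakk>a \<in> carrier A; b \<in> carrier A\<rbrakk> \<Longrightarrow> g (a \<oplus>\<^bsub>A\<^esub> b) = g a \<oplus>\<^bsub>B\<^esub> g b"
      "\<And>a r. \<lbrakk>a \<in> carrier A; r \<in> carrier R\<rbrakk> \<Longrightarrow> g (a \<odot>\<^sub>r\<^bsub>A\<^esub> r) = g a \<odot>\<^sub>r\<^bsub>B\<^esub> r"
    and h: "h \<in> left_linear_maps R M N"
    and u: "Poly_Mapping.keys u \<subseteq> carrier A \<times> carrier M"
  shows "tensor_map R B N g h (tensor_coset R A M u) = tensor_coset R B N (frag_map g h u)"
proof -
  interpret AM: tensor_product L R A M by fact
  interpret BN: tensor_product K R B N by fact
  note h = left_linear_mapsD[OF h]
  have keys: "Poly_Mapping.keys (frag_map g h w) \<subseteq> carrier B \<times> carrier N"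
    if "Poly_Mapping.keys w \<subseteq> carrier A \<times> carrier M" for w
    using keys_frag_map[OF that g(1) h(1)] .
  interpret group_hom AM.F BN.F "frag_map g h"
    by (intro group_hom.intro group_hom_axioms.intro homI) (use keys in \<open>auto simp: frag_extend_add\<close>)
  have "frag_map g h ` tensor_gens R A M \<subseteq> tensor_gens R B N"
  proof (rule image_subsetI)
    fix w assume "w \<in> tensor_gens R A M"
    then show "frag_map g h w \<in> tensor_gens R B N"
    proof cases
      case (add_left a b m)
      then have "frag_map g h w = frag_of (g a \<oplus>\<^bsub>B\<^esub> g b, h m) - frag_of (g a, h m) - frag_of (g b, h m)"
        by (simp add: frag_extend_diff g)
      then show ?thesis using add_left g h by (simp add: tensor_gens.add_left)
    next
      case (add_right a m n)
      then have "frag_map g h w = frag_of (g a, h m \<oplus>\<^bsub>N\<^esub> h n) - frag_of (g a, h m) - frag_of (g a, h n)"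
        by (simp add: frag_extend_diff h)
      then show ?thesis using add_right g h by (simp add: tensor_gens.add_right)
    next
      case (balanced a r m)
      then have "frag_map g h w = frag_of (g a \<odot>\<^sub>r\<^bsub>B\<^esub> r, h m) - frag_of (g a, r \<odot>\<^bsub>N\<^esub> h m)"
        by (simp add: frag_extend_diff g h)
      then show ?thesis using balanced g h by (simp add: tensor_gens.balanced)
    qed
  qed
  then have null: "frag_map g h w \<in> tensor_null R B N" if "w \<in> tensor_null R A M" for w
    using that generate_img[OF AM.tensor_gens_carrier] BN.F.mono_generate
    unfolding tensor_null_eq by blast
  have "tensor_coset R B N (frag_map g h w) = tensor_coset R B N (frag_map g h u)"
    if wu: "w \<in> tensor_coset R A M u" for w
  proof -
    obtain n where n: "n \<in> tensor_null R A M" "w = n + u"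
      using wu by (auto simp: tensor_coset_def r_coset_def)
    have "Poly_Mapping.keys n \<subseteq> carrier A \<times> carrier M"
      using subgroup.mem_carrier[OF AM.subgroup_tensor_null n(1)] by simp
    then have "Poly_Mapping.keys w \<subseteq> carrier A \<times> carrier M"
      using n(2) u keys_add[of n u] by blast
    moreover have "frag_map g h w - frag_map g h u \<in> tensor_null R B N"
      using null[OF n(1)] n(2) by (simp add: frag_extend_add)
    ultimately show ?thesis using BN.coset_eqI[OF keys keys[OF u]] by blast
  qed
  \<comment> \<open>The union has at least one member; otherwise it would be empty instead of the
    common coset.\<close>
  moreover have "u \<in> tensor_coset R A M u"
    unfolding tensor_coset_def using AM.F.rcos_self[OF _ AM.subgroup_tensor_null, of u] u by simp
  ultimately show ?thesis
    unfolding tensor_map_def tensor_coset_def[of R B N, symmetric] by blast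
qed

context tensor_product
begin

lemma smult_coset:
  assumes l: "l \<in> carrier L" and u: "Poly_Mapping.keys u \<subseteq> carrier A \<times> carrier M"
  shows "l \<odot>\<^bsub>T\<^esub> coset u = coset (frag_map (\<lambda>a. l \<odot>\<^bsub>A\<^esub> a) (\<lambda>m. m) u)"
proof -
  have "(\<lambda>m. m) \<in> left_linear_maps R M M" by (rule left_linear_mapsI) auto
  then show ?thesis
    using tensor_map_coset[OF tensor_product_axioms tensor_product_axioms _ _ _ _ u,
        of "\<lambda>a. l \<odot>\<^bsub>A\<^esub> a" "\<lambda>m. m"] l
    by (simp add: tensor_def A.smult_closed A.smult_r_distr A.smult_rsmult)
qed

end

section \<open>Functoriality of the tensor product in its second factor\<close>

abbreviation id_tensor where
  "id_tensor R A N h \<equiv> tensor_map R A N (\<lambda>a. a) h"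

lemma id_tensor_coset:
  assumes "tensor_product L R A M" "tensor_product L R A N" "h \<in> left_linear_maps R M N"
    "Poly_Mapping.keys u \<subseteq> carrier A \<times> carrier M"
  shows "id_tensor R A N h (tensor_coset R A M u) = tensor_coset R A N (frag_map (\<lambda>a. a) h u)"
  by (rule tensor_map_coset[OF assms(1,2) _ _ _ assms(3,4)]) auto

lemma id_tensor_pure:
  assumes "tensor_product L R A M" "tensor_product L R A N" "h \<in> left_linear_maps R M N"
    "a \<in> carrier A" "m \<in> carrier M"
  shows "id_tensor R A N h (pure_tensor R A M a m) = pure_tensor R A N a (h m)"
  using id_tensor_coset[OF assms(1-3), of "frag_of (a, m)"] assms by simp

lemma id_tensor_linear:
  assumes "tensor_product L R A M" "tensor_product L R A N" and h: "h \<in> left_linear_maps R M N"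
  shows "id_tensor R A N h \<in> left_linear_maps L (tensor R A M) (tensor R A N)"
proof -
  interpret AM: tensor_product L R A M by fact
  interpret AN: tensor_product L R A N by fact
  note c = id_tensor_coset[OF assms]
  have keys: "Poly_Mapping.keys (frag_map (\<lambda>a. a) h w) \<subseteq> carrier A \<times> carrier N"
    if "Poly_Mapping.keys w \<subseteq> carrier A \<times> carrier M" for w
    using that by (rule keys_frag_map) (simp_all add: left_linear_mapsD(1)[OF h])
  show ?thesis
  proof (rule left_linear_mapsI)
    fix s assume "s \<in> carrier AM.T"
    then obtain u where u: "Poly_Mapping.keys u \<subseteq> carrier A \<times> carrier M" "s = AM.coset u"
      by (auto simp: AM.carrier_tensor)
    show "id_tensor R A N h s \<in> carrier AN.T"
      unfolding u(2) c[OF u(1)] by (rule AN.coset_closed[OF keys[OF u(1)]])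
    fix t assume "t \<in> carrier AM.T"
    then obtain w where w: "Poly_Mapping.keys w \<subseteq> carrier A \<times> carrier M" "t = AM.coset w"
      by (auto simp: AM.carrier_tensor)
    have "Poly_Mapping.keys (u + w) \<subseteq> carrier A \<times> carrier M"
      using u(1) w(1) keys_add[of u w] by blast
    then show "id_tensor R A N h (s \<oplus>\<^bsub>AM.T\<^esub> t) = id_tensor R A N h s \<oplus>\<^bsub>AN.T\<^esub> id_tensor R A N h t"
      unfolding u(2) w(2) AM.add_coset[OF u(1) w(1)]
      by (simp add: c u w frag_extend_add AN.add_coset keys)
  next
    fix l s assume l: "l \<in> carrier L" and "s \<in> carrier AM.T"
    then obtain u where u: "Poly_Mapping.keys u \<subseteq> carrier A \<times> carrier M" "s = AM.coset u"
      by (auto simp: AM.carrier_tensor)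
    have "Poly_Mapping.keys (frag_map (\<lambda>a. l \<odot>\<^bsub>A\<^esub> a) (\<lambda>m. m) u) \<subseteq> carrier A \<times> carrier M"
      by (rule keys_frag_map[OF u(1)]) (use l AM.A.smult_closed in auto)
    then show "id_tensor R A N h (l \<odot>\<^bsub>AM.T\<^esub> s) = l \<odot>\<^bsub>AN.T\<^esub> id_tensor R A N h s"
      unfolding u(2) AM.smult_coset[OF l u(1)]
      by (simp add: c u AN.smult_coset[OF l] keys frag_map_frag_map)
  qed
qed

lemma id_tensor_comp:
  assumes "tensor_product L R A M" "tensor_product L R A N" "tensor_product L R A K"
    and f: "f \<in> left_linear_maps R M N" and g: "g \<in> left_linear_maps R N K"
    and t: "t \<in> carrier (tensor R A M)"
  shows "id_tensor R A K g (id_tensor R A N f t) = id_tensor R A K (\<lambda>m. g (f m)) t"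
proof -
  interpret AM: tensor_product L R A M by fact
  obtain u where u: "Poly_Mapping.keys u \<subseteq> carrier A \<times> carrier M" "t = AM.coset u"
    using t by (auto simp: AM.carrier_tensor)
  have "Poly_Mapping.keys (frag_map (\<lambda>a. a) f u) \<subseteq> carrier A \<times> carrier N"
    using u(1) by (rule keys_frag_map) (simp_all add: left_linear_mapsD(1)[OF f])
  then show ?thesis
    using u id_tensor_coset[OF assms(1,2) f] id_tensor_coset[OF assms(2,3) g]
      id_tensor_coset[OF assms(1,3) left_linear_maps_comp[OF f g]]
    by (simp add: frag_map_frag_map)
qed

text \<open>Only values on the carrier matter. This reconciles morphisms, which are undefined off
  carriers, with inclusions, projections and composites written as total functions.\<close>

lemma id_tensor_cong:
  assumes "tensor_product L R A M" "tensor_product L R A N"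
    and f: "f \<in> left_linear_maps R M N" and g: "g \<in> left_linear_maps R M N"
    and t: "t \<in> carrier (tensor R A M)" and "\<And>m. m \<in> carrier M \<Longrightarrow> f m = g m"
  shows "id_tensor R A N f t = id_tensor R A N g t"
proof -
  interpret AM: tensor_product L R A M by fact
  obtain u where u: "Poly_Mapping.keys u \<subseteq> carrier A \<times> carrier M" "t = AM.coset u"
    using t by (auto simp: AM.carrier_tensor)
  have "frag_map (\<lambda>a. a) f u = frag_map (\<lambda>a. a) g u"
    by (rule frag_map_cong[OF u(1)]) (use assms(6) in auto)
  then show ?thesis
    using u id_tensor_coset[OF assms(1,2) f] id_tensor_coset[OF assms(1,2) g] by simp
qed

lemma id_tensor_ident:
  assumes "tensor_product L R A M" and t: "t \<in> carrier (tensor R A M)"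
  shows "id_tensor R A M (\<lambda>m. m) t = t"
proof -
  interpret AM: tensor_product L R A M by fact
  obtain u where u: "Poly_Mapping.keys u \<subseteq> carrier A \<times> carrier M" "t = AM.coset u"
    using t by (auto simp: AM.carrier_tensor)
  have "(\<lambda>m. m) \<in> left_linear_maps R M M" by (rule left_linear_mapsI) auto
  then show ?thesis using u id_tensor_coset[OF assms(1,1)] by (simp add: frag_map_id)
qed

section \<open>Endomorphism rings of representations\<close>

text \<open>The non-units of S pull back to an ideal of R; an element outside it maps to a unit, and
  the inverse of that unit lifts.\<close>

lemma local_ring_iso:
  assumes R: "ring R" and S: "ring S" and h: "h \<in> ring_iso R S" and "local_ring S"
  shows "local_ring R"
proof -
  interpret ring_hom_ring R S h
    using R S h by (intro ring_hom_ringI2) (auto simp: ring_iso_def)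
  have bij: "bij_betw h (carrier R) (carrier S)" using h by (simp add: ring_iso_def)
  show ?thesis
  proof (rule local_ringI)
    show "ideal {r \<in> carrier R. h r \<in> carrier S - Units S} R"
      using ideal_vimage assms(4) unfolding local_ring_def by blast
    show "\<one>\<^bsub>R\<^esub> \<notin> {r \<in> carrier R. h r \<in> carrier S - Units S}" by simp
    fix u assume u: "u \<in> carrier R - {r \<in> carrier R. h r \<in> carrier S - Units S}"
    then have uR: "u \<in> carrier R" and "h u \<in> Units S" by auto
    then obtain w where w: "w \<in> carrier S" "w \<otimes>\<^bsub>S\<^esub> h u = \<one>\<^bsub>S\<^esub>" "h u \<otimes>\<^bsub>S\<^esub> w = \<one>\<^bsub>S\<^esub>"
      unfolding Units_def by auto
    obtain v where v: "v \<in> carrier R" "h v = w"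
      using bij w(1) unfolding bij_betw_def by (metis imageE)
    have "v \<otimes>\<^bsub>R\<^esub> u = \<one>\<^bsub>R\<^esub>" "u \<otimes>\<^bsub>R\<^esub> v = \<one>\<^bsub>R\<^esub>"
      using bij_betw_imp_inj_on[OF bij] w v uR by (auto intro!: inj_onD[of h "carrier R"])
    then show "u \<in> Units R" using uR v unfolding Units_def by blast
  qed
qed

abbreviation pure_at where
  "pure_at S M y x a m \<equiv> pure_tensor (Rng S x) (Bim S y x) (Mod_at M x) a m"

locale species =
  fixes S :: "('c, 'r, 'a) species"
  assumes species: "is_species S"
begin

lemma tensor_productI:
  assumes "x \<in> Idx S" "y \<in> Idx S" "left_module (Rng S x) K"
  shows "tensor_product (Rng S y) (Rng S x) (Bim S y x) K"
  using species assms by (simp add: is_species_def tensor_product_def)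

lemma rep_left_module: "\<lbrakk>is_representation S M; x \<in> Idx S\<rbrakk> \<Longrightarrow> left_module (Rng S x) (Mod_at M x)"
  by (simp add: is_representation_def)

lemma rep_abelian_group: "\<lbrakk>is_representation S M; x \<in> Idx S\<rbrakk> \<Longrightarrow> abelian_group (Mod_at M x)"
  using rep_left_module left_module.axioms(2) by blast

lemma rep_map_linear: "\<lbrakk>is_representation S M; x \<in> Idx S; y \<in> Idx S\<rbrakk> \<Longrightarrow>
    Map_at M y x \<in> left_linear_maps (Rng S y) (tensor_at S M y x) (Mod_at M y)"
  by (simp add: is_representation_def)

lemma rep_tensor_product: "\<lbrakk>is_representation S M; x \<in> Idx S; y \<in> Idx S\<rbrakk> \<Longrightarrow>
    tensor_product (Rng S y) (Rng S x) (Bim S y x) (Mod_at M x)"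
  by (intro tensor_productI rep_left_module)

lemma left_linear_hom:
  "f \<in> left_linear_maps R M N \<Longrightarrow> f \<in> hom (add_monoid M) (add_monoid N)"
  by (simp add: left_linear_maps_def)

lemma pure_at_closed:
  assumes "is_representation S M" "x \<in> Idx S" "y \<in> Idx S" "a \<in> carrier (Bim S y x)" "m \<in> carrier (Mod_at M x)"
  shows "pure_at S M y x a m \<in> carrier (tensor_at S M y x)"
  using tensor_product.pure_closed[OF rep_tensor_product[OF assms(1-3)] assms(4,5)]
  by (simp add: tensor_at_def)

lemma Map_pure_closed:
  assumes "is_representation S M" "x \<in> Idx S" "y \<in> Idx S" "a \<in> carrier (Bim S y x)" "m \<in> carrier (Mod_at M x)"
  shows "Map_at M y x (pure_at S M y x a m) \<in> carrier (Mod_at M y)"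
  using left_linear_mapsD(1)[OF rep_map_linear[OF assms(1-3)] pure_at_closed[OF assms]] .

lemma Map_pure_hom:
  assumes "is_representation S M" "x \<in> Idx S" "y \<in> Idx S" "a \<in> carrier (Bim S y x)"
  shows "(\<lambda>m. Map_at M y x (pure_at S M y x a m)) \<in> hom (add_monoid (Mod_at M x)) (add_monoid (Mod_at M y))"
proof (rule homI)
  interpret tensor_product "Rng S y" "Rng S x" "Bim S y x" "Mod_at M x"
    by (rule rep_tensor_product[OF assms(1-3)])
  fix m n assume "m \<in> carrier (add_monoid (Mod_at M x))" "n \<in> carrier (add_monoid (Mod_at M x))"
  then show "Map_at M y x (pure_at S M y x a (m \<otimes>\<^bsub>add_monoid (Mod_at M x)\<^esub> n)) =
    Map_at M y x (pure_at S M y x a m) \<otimes>\<^bsub>add_monoid (Mod_at M y)\<^esub> Map_at M y x (pure_at S M y x a n)"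
    using pure_add[OF assms(4)] left_linear_mapsD(2)[OF rep_map_linear[OF assms(1-3)]]
      pure_closed[OF assms(4)] by (simp add: tensor_at_def)
qed (use Map_pure_closed[OF assms] in simp)

text \<open>Both sides of the commutation condition are additive in the tensor, so agreement on pure
  tensors suffices. Each condition then involves f at just two points, which is what makes the
  endomorphism ring complete.\<close>

lemma rep_hom_iff:
  assumes M: "is_representation S M" and N: "is_representation S N"
  shows "f \<in> rep_hom S M N \<longleftrightarrow>
    f \<in> (\<Pi>\<^sub>E x\<in>Idx S. left_linear_maps (Rng S x) (Mod_at M x) (Mod_at N x) \<inter> extensional (carrier (Mod_at M x))) \<and>
    (\<forall>y\<in>Idx S. \<forall>x\<in>Idx S. \<forall>a\<in>carrier (Bim S y x). \<forall>m\<in>carrier (Mod_at M x).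
      Map_at N y x (pure_at S N y x a (f x m)) = f y (Map_at M y x (pure_at S M y x a m)))"
    (is "_ \<longleftrightarrow> ?lin \<and> ?pure")
proof -
  have "(\<forall>y\<in>Idx S. \<forall>x\<in>Idx S. \<forall>t\<in>carrier (tensor_at S M y x).
      Map_at N y x (one_tensor S N y x (f x) t) = f y (Map_at M y x t)) \<longleftrightarrow> ?pure" if lin: ?lin
  proof (intro ball_cong refl)
    fix y x assume y: "y \<in> Idx S" and x: "x \<in> Idx S"
    interpret MM: tensor_product "Rng S y" "Rng S x" "Bim S y x" "Mod_at M x"
      by (rule rep_tensor_product[OF M x y])
    interpret Ny: abelian_group "Mod_at N y" by (rule rep_abelian_group[OF N y])
    have f: "f x \<in> left_linear_maps (Rng S x) (Mod_at M x) (Mod_at N x)"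
      "f y \<in> left_linear_maps (Rng S y) (Mod_at M y) (Mod_at N y)"
      using lin x y by (auto simp: PiE_iff)
    note pure = id_tensor_pure[OF rep_tensor_product[OF M x y] rep_tensor_product[OF N x y] f(1)]
    have l: "(\<lambda>t. Map_at N y x (one_tensor S N y x (f x) t)) \<in>
        left_linear_maps (Rng S y) (tensor_at S M y x) (Mod_at N y)"
      unfolding one_tensor_def tensor_at_def
      using id_tensor_linear[OF rep_tensor_product[OF M x y] rep_tensor_product[OF N x y] f(1)]
        rep_map_linear[OF N x y]
      unfolding tensor_at_def by (rule left_linear_maps_comp)
    have r: "(\<lambda>t. f y (Map_at M y x t)) \<in> left_linear_maps (Rng S y) (tensor_at S M y x) (Mod_at N y)"
      using rep_map_linear[OF M x y] f(2) by (rule left_linear_maps_comp)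
    show "(\<forall>t\<in>carrier (tensor_at S M y x). Map_at N y x (one_tensor S N y x (f x) t) = f y (Map_at M y x t))
      \<longleftrightarrow> (\<forall>a\<in>carrier (Bim S y x). \<forall>m\<in>carrier (Mod_at M x).
        Map_at N y x (pure_at S N y x a (f x m)) = f y (Map_at M y x (pure_at S M y x a m)))"
      (is "?A \<longleftrightarrow> ?B")
    proof
      assume A: ?A
      show ?B
      proof (intro ballI)
        fix a m assume am: "a \<in> carrier (Bim S y x)" "m \<in> carrier (Mod_at M x)"
        show "Map_at N y x (pure_at S N y x a (f x m)) = f y (Map_at M y x (pure_at S M y x a m))"
          using A[rule_format, OF pure_at_closed[OF M x y am]] pure[OF am] by (simp add: one_tensor_def)
      qed
    next
      assume B: ?B
      show ?A
      proof
        fix t assume t: "t \<in> carrier (tensor_at S M y x)"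
        show "Map_at N y x (one_tensor S N y x (f x) t) = f y (Map_at M y x t)"
          by (rule MM.tensor_hom_eqI[OF Ny.a_group left_linear_hom[OF l[unfolded tensor_at_def]]
              left_linear_hom[OF r[unfolded tensor_at_def]] _ t[unfolded tensor_at_def]])
            (use B pure in \<open>simp add: one_tensor_def\<close>)
      qed
    qed
  qed
  then show ?thesis unfolding rep_hom_def by blast
qed

lemma rep_homD:
  assumes "f \<in> rep_hom S M N" "x \<in> Idx S"
  shows "f x \<in> left_linear_maps (Rng S x) (Mod_at M x) (Mod_at N x)"
    "f x \<in> extensional (carrier (Mod_at M x))" "f \<in> extensional (Idx S)"
    "m \<in> carrier (Mod_at M x) \<Longrightarrow> f x m \<in> carrier (Mod_at N x)"
    "\<lbrakk>m \<in> carrier (Mod_at M x); n \<in> carrier (Mod_at M x)\<rbrakk> \<Longrightarrow>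
      f x (m \<oplus>\<^bsub>Mod_at M x\<^esub> n) = f x m \<oplus>\<^bsub>Mod_at N x\<^esub> f x n"
    "\<lbrakk>r \<in> carrier (Rng S x); m \<in> carrier (Mod_at M x)\<rbrakk> \<Longrightarrow>
      f x (r \<odot>\<^bsub>Mod_at M x\<^esub> m) = r \<odot>\<^bsub>Mod_at N x\<^esub> f x m"
proof -
  show *: "f x \<in> left_linear_maps (Rng S x) (Mod_at M x) (Mod_at N x)"
    and "f x \<in> extensional (carrier (Mod_at M x))" "f \<in> extensional (Idx S)"
    using assms by (auto simp: rep_hom_def PiE_iff)
  show "m \<in> carrier (Mod_at M x) \<Longrightarrow> f x m \<in> carrier (Mod_at N x)"
    "\<lbrakk>m \<in> carrier (Mod_at M x); n \<in> carrier (Mod_at M x)\<rbrakk> \<Longrightarrow>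
      f x (m \<oplus>\<^bsub>Mod_at M x\<^esub> n) = f x m \<oplus>\<^bsub>Mod_at N x\<^esub> f x n"
    "\<lbrakk>r \<in> carrier (Rng S x); m \<in> carrier (Mod_at M x)\<rbrakk> \<Longrightarrow>
      f x (r \<odot>\<^bsub>Mod_at M x\<^esub> m) = r \<odot>\<^bsub>Mod_at N x\<^esub> f x m"
    using left_linear_mapsD[OF *] by auto
qed

lemma rep_hom_pure:
  assumes "is_representation S M" "is_representation S N" "f \<in> rep_hom S M N"
    "x \<in> Idx S" "y \<in> Idx S" "a \<in> carrier (Bim S y x)" "m \<in> carrier (Mod_at M x)"
  shows "Map_at N y x (pure_at S N y x a (f x m)) = f y (Map_at M y x (pure_at S M y x a m))"
  using assms rep_hom_iff[OF assms(1,2)] by blast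

lemma rep_homI:
  assumes "is_representation S M" "is_representation S N"
    and "f \<in> extensional (Idx S)"
    and "\<And>x. x \<in> Idx S \<Longrightarrow> f x \<in> left_linear_maps (Rng S x) (Mod_at M x) (Mod_at N x)"
    and "\<And>x. x \<in> Idx S \<Longrightarrow> f x \<in> extensional (carrier (Mod_at M x))"
    and "\<And>x y a m. \<lbrakk>x \<in> Idx S; y \<in> Idx S; a \<in> carrier (Bim S y x); m \<in> carrier (Mod_at M x)\<rbrakk> \<Longrightarrow>
      Map_at N y x (pure_at S N y x a (f x m)) = f y (Map_at M y x (pure_at S M y x a m))"
  shows "f \<in> rep_hom S M N"
  using assms(3-6) by (auto simp: rep_hom_iff[OF assms(1,2)] PiE_iff)

lemma rep_hom_eqI:
  assumes f: "f \<in> rep_hom S M N" and g: "g \<in> rep_hom S M N"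
    and eq: "\<And>x m. \<lbrakk>x \<in> Idx S; m \<in> carrier (Mod_at M x)\<rbrakk> \<Longrightarrow> f x m = g x m"
  shows "f = g"
proof (rule PiE_ext)
  show "f \<in> (\<Pi>\<^sub>E x\<in>Idx S. extensional (carrier (Mod_at M x)))" "g \<in> (\<Pi>\<^sub>E x\<in>Idx S. extensional (carrier (Mod_at M x)))"
    using f g by (auto simp: rep_hom_def PiE_iff)
  show "f x = g x" if "x \<in> Idx S" for x
    by (rule extensionalityI[OF rep_homD(2)[OF f that] rep_homD(2)[OF g that]]) (rule eq[OF that])
qed

section \<open>The ring structure on endomorphisms\<close>

lemma rep_End_simps [simp]:
  "carrier (rep_End S M) = rep_hom S M M" "mult (rep_End S M) = rep_comp S M"
  "one (rep_End S M) = rep_id S M"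
  by (simp_all add: rep_End_def)

lemma rep_End_apply:
  assumes "x \<in> Idx S" "m \<in> carrier (Mod_at M x)"
  shows "(f \<oplus>\<^bsub>rep_End S M\<^esub> g) x m = f x m \<oplus>\<^bsub>Mod_at M x\<^esub> g x m"
    "\<zero>\<^bsub>rep_End S M\<^esub> x m = \<zero>\<^bsub>Mod_at M x\<^esub>"
    "rep_comp S M f g x m = f x (g x m)"
    "rep_id S M x m = m"
  using assms by (simp_all add: rep_End_def rep_comp_def rep_id_def compose_def)

lemma rep_End_closed:
  assumes M: "is_representation S M"
  shows "rep_id S M \<in> rep_hom S M M" "\<zero>\<^bsub>rep_End S M\<^esub> \<in> rep_hom S M M"
    "\<lbrakk>f \<in> rep_hom S M M; g \<in> rep_hom S M M\<rbrakk> \<Longrightarrow> f \<oplus>\<^bsub>rep_End S M\<^esub> g \<in> rep_hom S M M"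
    "\<lbrakk>f \<in> rep_hom S M M; g \<in> rep_hom S M M\<rbrakk> \<Longrightarrow> rep_comp S M f g \<in> rep_hom S M M"
    "f \<in> rep_hom S M M \<Longrightarrow> (\<lambda>x\<in>Idx S. \<lambda>m\<in>carrier (Mod_at M x). \<ominus>\<^bsub>Mod_at M x\<^esub> f x m) \<in> rep_hom S M M"
proof -
  note ab = rep_abelian_group[OF M] and lm = rep_left_module[OF M]
  show "rep_id S M \<in> rep_hom S M M"
  proof (rule rep_homI[OF M M])
    fix x assume x: "x \<in> Idx S"
    interpret left_module "Rng S x" "Mod_at M x" by (rule lm[OF x])
    show "rep_id S M x \<in> left_linear_maps (Rng S x) (Mod_at M x) (Mod_at M x)"
      using x by (intro left_linear_mapsI) (simp_all add: rep_id_def smult_closed)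
  qed (auto simp: rep_id_def Map_pure_closed[OF M])
  show "\<zero>\<^bsub>rep_End S M\<^esub> \<in> rep_hom S M M"
  proof (rule rep_homI[OF M M])
    fix x assume x: "x \<in> Idx S"
    interpret left_module "Rng S x" "Mod_at M x" by (rule lm[OF x])
    show "\<zero>\<^bsub>rep_End S M\<^esub> x \<in> left_linear_maps (Rng S x) (Mod_at M x) (Mod_at M x)"
      using x by (intro left_linear_mapsI) (simp_all add: rep_End_apply smult_closed)
  next
    fix x y a m assume *: "x \<in> Idx S" "y \<in> Idx S" "a \<in> carrier (Bim S y x)" "m \<in> carrier (Mod_at M x)"
    interpret Mx: abelian_group "Mod_at M x" by (rule ab[OF *(1)])
    interpret My: abelian_group "Mod_at M y" by (rule ab[OF *(2)])
    show "Map_at M y x (pure_at S M y x a (\<zero>\<^bsub>rep_End S M\<^esub> x m)) = \<zero>\<^bsub>rep_End S M\<^esub> y (Map_at M y x (pure_at S M y x a m))"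
      using hom_one[OF Map_pure_hom[OF M *(1-3)] Mx.a_group My.a_group] Map_pure_closed[OF M *] *
      by (simp add: rep_End_apply)
  qed (auto simp: rep_End_def)
  {
    fix f assume f: "f \<in> rep_hom S M M"
    let ?n = "\<lambda>x\<in>Idx S. \<lambda>m\<in>carrier (Mod_at M x). \<ominus>\<^bsub>Mod_at M x\<^esub> f x m"
    show "?n \<in> rep_hom S M M"
    proof (rule rep_homI[OF M M])
      fix x assume x: "x \<in> Idx S"
      interpret left_module "Rng S x" "Mod_at M x" by (rule lm[OF x])
      note fx = rep_homD(4-6)[OF f x]
      show "?n x \<in> left_linear_maps (Rng S x) (Mod_at M x) (Mod_at M x)"
        using x by (intro left_linear_mapsI) (simp_all add: fx smult_closed M.minus_add smult_r_uminus)
    next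
      fix x y a m assume *: "x \<in> Idx S" "y \<in> Idx S" "a \<in> carrier (Bim S y x)" "m \<in> carrier (Mod_at M x)"
      interpret h: group_hom "add_monoid (Mod_at M x)" "add_monoid (Mod_at M y)" "\<lambda>m. Map_at M y x (pure_at S M y x a m)"
        using Map_pure_hom[OF M *(1-3)] abelian_group.a_group[OF ab[OF *(1)]] abelian_group.a_group[OF ab[OF *(2)]]
        by (simp add: group_hom_def group_hom_axioms_def)
      show "Map_at M y x (pure_at S M y x a (?n x m)) = ?n y (Map_at M y x (pure_at S M y x a m))"
        using h.hom_inv[of "f x m"] * rep_homD(4)[OF f *(1)] Map_pure_closed[OF M *] rep_hom_pure[OF M M f *]
        by (simp add: a_inv_def)
    qed auto
  }
  assume f: "f \<in> rep_hom S M M" and g: "g \<in> rep_hom S M M"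
  show "f \<oplus>\<^bsub>rep_End S M\<^esub> g \<in> rep_hom S M M"
  proof (rule rep_homI[OF M M])
    fix x assume x: "x \<in> Idx S"
    interpret left_module "Rng S x" "Mod_at M x" by (rule lm[OF x])
    note fx = rep_homD(4-6)[OF f x] rep_homD(4-6)[OF g x]
    show "(f \<oplus>\<^bsub>rep_End S M\<^esub> g) x \<in> left_linear_maps (Rng S x) (Mod_at M x) (Mod_at M x)"
      using x by (intro left_linear_mapsI) (simp_all add: rep_End_apply fx smult_closed M.a_ac smult_r_distr)
  next
    fix x y a m assume *: "x \<in> Idx S" "y \<in> Idx S" "a \<in> carrier (Bim S y x)" "m \<in> carrier (Mod_at M x)"
    show "Map_at M y x (pure_at S M y x a ((f \<oplus>\<^bsub>rep_End S M\<^esub> g) x m)) =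
      (f \<oplus>\<^bsub>rep_End S M\<^esub> g) y (Map_at M y x (pure_at S M y x a m))"
      using hom_mult[OF Map_pure_hom[OF M *(1-3)], of "f x m" "g x m"] * Map_pure_closed[OF M *]
        rep_homD(4)[OF f *(1)] rep_homD(4)[OF g *(1)] rep_hom_pure[OF M M f *] rep_hom_pure[OF M M g *]
      by (simp add: rep_End_apply)
  qed (auto simp: rep_End_def)
  show "rep_comp S M f g \<in> rep_hom S M M"
  proof (rule rep_homI[OF M M])
    fix x assume x: "x \<in> Idx S"
    interpret left_module "Rng S x" "Mod_at M x" by (rule lm[OF x])
    note fx = rep_homD(4-6)[OF f x] rep_homD(4-6)[OF g x]
    show "rep_comp S M f g x \<in> left_linear_maps (Rng S x) (Mod_at M x) (Mod_at M x)"
      using x by (intro left_linear_mapsI) (simp_all add: rep_End_apply fx smult_closed)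
  next
    fix x y a m assume *: "x \<in> Idx S" "y \<in> Idx S" "a \<in> carrier (Bim S y x)" "m \<in> carrier (Mod_at M x)"
    have gm: "g x m \<in> carrier (Mod_at M x)" using rep_homD(4)[OF g *(1,4)] .
    show "Map_at M y x (pure_at S M y x a (rep_comp S M f g x m)) =
      rep_comp S M f g y (Map_at M y x (pure_at S M y x a m))"
      using * Map_pure_closed[OF M *] rep_hom_pure[OF M M f *(1-3) gm] rep_hom_pure[OF M M g *]
      by (simp add: rep_End_apply)
  qed (auto simp: rep_comp_def compose_def)
qed

lemma rep_End_ring:
  assumes M: "is_representation S M" shows "ring (rep_End S M)"
proof -
  note cl = rep_End_closed[OF M] and ap = rep_End_apply
  note D = rep_homD(4,5)
  have ext: "f = g" if "f \<in> rep_hom S M M" "g \<in> rep_hom S M M"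
    "\<And>x m. \<lbrakk>x \<in> Idx S; m \<in> carrier (Mod_at M x); abelian_group (Mod_at M x)\<rbrakk> \<Longrightarrow> f x m = g x m" for f g
    using rep_hom_eqI[OF that(1,2)] that(3) rep_abelian_group[OF M] by blast
  note ag = abelian_group.axioms(1)[THEN abelian_monoid.a_assoc]
    abelian_group.axioms(1)[THEN abelian_monoid.l_zero] abelian_group.l_neg
    abelian_group.a_inv_closed
    abelian_group.axioms(1)[THEN abelian_monoid.a_closed] abelian_group.axioms(1)[THEN abelian_monoid.zero_closed]
  show ?thesis
  proof (rule ringI)
    show "abelian_group (rep_End S M)"
    proof (rule abelian_groupI)
      fix f assume f: "f \<in> carrier (rep_End S M)"
      let ?n = "\<lambda>x\<in>Idx S. \<lambda>m\<in>carrier (Mod_at M x). \<ominus>\<^bsub>Mod_at M x\<^esub> f x m"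
      have n: "?n \<in> rep_hom S M M" using cl(5) f by simp
      moreover have "?n \<oplus>\<^bsub>rep_End S M\<^esub> f = \<zero>\<^bsub>rep_End S M\<^esub>"
        by (rule ext) (use f n in \<open>simp_all add: cl ap D ag\<close>)
      ultimately show "\<exists>g\<in>carrier (rep_End S M). g \<oplus>\<^bsub>rep_End S M\<^esub> f = \<zero>\<^bsub>rep_End S M\<^esub>" by auto
    next
      fix f g assume "f \<in> carrier (rep_End S M)" "g \<in> carrier (rep_End S M)"
      then show "f \<oplus>\<^bsub>rep_End S M\<^esub> g = g \<oplus>\<^bsub>rep_End S M\<^esub> f"
        by (intro ext) (simp_all add: cl ap D abelian_group.axioms(1)[THEN abelian_monoid.a_comm])
    qed (simp_all add: cl, (rule ext; simp add: cl ap D ag)+)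
    show "Group.monoid (rep_End S M)"
      by (rule monoidI; simp add: cl; rule ext; simp add: cl ap D)
  qed (simp_all, (rule ext; simp add: cl ap D)+)
qed

end

lemma End_module_simps [simp]:
  "carrier (End_module M x) = carrier (Mod_at M x)" "zero (End_module M x) = zero (Mod_at M x)"
  "add (End_module M x) = add (Mod_at M x)" "smult (End_module M x) f m = f x m"
  by (simp_all add: End_module_def)

context species
begin

text \<open>Completeness holds because every defining equation of an endomorphism mentions finitely
  many of its values: additivity three, linearity two, and compatibility with a pure tensor two. An
  endomorphism matching \<phi> at those points transfers the equation to \<phi>.\<close>

lemma operator_ring_End:
  assumes M: "is_representation S M"
    and art: "\<And>x. x \<in> Idx S \<Longrightarrow> artinian_module (rep_End S M) (End_module M x)"
  shows "operator_ring (rep_End S M) (Idx S) (End_module M)"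
proof (intro operator_ring.intro operator_ring_axioms.intro art)
  show ring: "ring (rep_End S M)" by (rule rep_End_ring[OF M])
  show "left_module (rep_End S M) (End_module M x)" if x: "x \<in> Idx S" for x
  proof -
    interpret Mx: left_module "Rng S x" "Mod_at M x" by (rule rep_left_module[OF M x])
    have "abelian_group (End_module M x)"
      unfolding End_module_def by (rule abelian_group_module_of) (rule Mx.M.a_comm_group)
    then show ?thesis
      using ring x
      by (auto intro!: left_module.intro left_module_axioms.intro simp: rep_homD rep_End_apply)
  qed
  fix f g assume "f \<in> carrier (rep_End S M)" "g \<in> carrier (rep_End S M)"
    and "\<And>x v. \<lbrakk>x \<in> Idx S; v \<in> carrier (End_module M x)\<rbrakk> \<Longrightarrow>
      f \<odot>\<^bsub>End_module M x\<^esub> v = g \<odot>\<^bsub>End_module M x\<^esub> v"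
  then show "f = g" using rep_hom_eqI[of f M M g] by simp
next
  fix \<phi>
  assume cl: "\<And>x v. \<lbrakk>x \<in> Idx S; v \<in> carrier (End_module M x)\<rbrakk> \<Longrightarrow> \<phi> x v \<in> carrier (End_module M x)"
    and approx: "\<And>P. \<lbrakk>finite P; P \<subseteq> (SIGMA x:Idx S. carrier (End_module M x))\<rbrakk> \<Longrightarrow>
      \<exists>f\<in>carrier (rep_End S M). \<forall>(x, v)\<in>P. f \<odot>\<^bsub>End_module M x\<^esub> v = \<phi> x v"
  let ?f = "\<lambda>x\<in>Idx S. \<lambda>m\<in>carrier (Mod_at M x). \<phi> x m"
  have ap: "\<exists>f\<in>rep_hom S M M. \<forall>(x, v)\<in>P. f x v = \<phi> x v"
    if "finite P" "P \<subseteq> (SIGMA x:Idx S. carrier (Mod_at M x))" for P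
    using approx[of P] that by simp
  have "?f \<in> rep_hom S M M"
  proof (rule rep_homI[OF M M])
    fix x assume x: "x \<in> Idx S"
    interpret Mx: left_module "Rng S x" "Mod_at M x" by (rule rep_left_module[OF M x])
    show "?f x \<in> left_linear_maps (Rng S x) (Mod_at M x) (Mod_at M x)"
    proof (rule left_linear_mapsI)
      fix m n assume mn: "m \<in> carrier (Mod_at M x)" "n \<in> carrier (Mod_at M x)"
      obtain f where f: "f \<in> rep_hom S M M" "f x m = \<phi> x m" "f x n = \<phi> x n"
          "f x (m \<oplus>\<^bsub>Mod_at M x\<^esub> n) = \<phi> x (m \<oplus>\<^bsub>Mod_at M x\<^esub> n)"
        using ap[of "{(x, m), (x, n), (x, m \<oplus>\<^bsub>Mod_at M x\<^esub> n)}"] x mn by auto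
      then show "?f x (m \<oplus>\<^bsub>Mod_at M x\<^esub> n) = ?f x m \<oplus>\<^bsub>Mod_at M x\<^esub> ?f x n"
        using x mn rep_homD(5)[OF f(1) x mn] unfolding f(2-4) by simp
    next
      fix r m assume rm: "r \<in> carrier (Rng S x)" "m \<in> carrier (Mod_at M x)"
      obtain f where f: "f \<in> rep_hom S M M" "f x m = \<phi> x m"
          "f x (r \<odot>\<^bsub>Mod_at M x\<^esub> m) = \<phi> x (r \<odot>\<^bsub>Mod_at M x\<^esub> m)"
        using ap[of "{(x, m), (x, r \<odot>\<^bsub>Mod_at M x\<^esub> m)}"] x rm Mx.smult_closed by auto
      then show "?f x (r \<odot>\<^bsub>Mod_at M x\<^esub> m) = r \<odot>\<^bsub>Mod_at M x\<^esub> ?f x m"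
        using x rm rep_homD(6)[OF f(1) x rm] Mx.smult_closed unfolding f(2-3) by simp
    qed (use cl x in simp)
  next
    fix x y a m assume *: "x \<in> Idx S" "y \<in> Idx S" "a \<in> carrier (Bim S y x)" "m \<in> carrier (Mod_at M x)"
    let ?n = "Map_at M y x (pure_at S M y x a m)"
    obtain f where "f \<in> rep_hom S M M" "\<forall>(x, v)\<in>{(x, m), (y, ?n)}. f x v = \<phi> x v"
      using ap[of "{(x, m), (y, ?n)}"] * Map_pure_closed[OF M *] by auto
    then show "Map_at M y x (pure_at S M y x a (?f x m)) = ?f y ?n"
      using rep_hom_pure[OF M M _ *, of f] * Map_pure_closed[OF M *] by simp
  qed auto
  then show "\<exists>f\<in>carrier (rep_End S M). \<forall>x\<in>Idx S. \<forall>v\<in>carrier (End_module M x).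
      f \<odot>\<^bsub>End_module M x\<^esub> v = \<phi> x v"
    by (intro bexI[of _ ?f]) auto
qed

end

section \<open>The image of an idempotent endomorphism\<close>

text \<open>Tensors over the smaller carrier are cosets of a different null subgroup, so the
  structure map of M cannot be applied to them directly. It is preceded by the map that the
  inclusion induces on tensor products.\<close>

definition sub_rep ::
    "('c, 'r, 'a) species \<Rightarrow> ('c, 'r, 'a, 'm) representation \<Rightarrow> ('c \<Rightarrow> 'm \<Rightarrow> 'm)
      \<Rightarrow> ('c, 'r, 'a, 'm) representation" where
  "sub_rep S M s =
    \<lparr>Mod_at = (\<lambda>x. Mod_at M x\<lparr>carrier := s x ` carrier (Mod_at M x)\<rparr>),
     Map_at = (\<lambda>y x t. Map_at M y x (one_tensor S M y x (\<lambda>m. m) t))\<rparr>"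

lemma sub_rep_simps [simp]:
  "carrier (Mod_at (sub_rep S M s) x) = s x ` carrier (Mod_at M x)"
  "add (Mod_at (sub_rep S M s) x) = add (Mod_at M x)"
  "zero (Mod_at (sub_rep S M s) x) = zero (Mod_at M x)"
  "smult (Mod_at (sub_rep S M s) x) = smult (Mod_at M x)"
  "Map_at (sub_rep S M s) y x t = Map_at M y x (one_tensor S M y x (\<lambda>m. m) t)"
  by (simp_all add: sub_rep_def)

locale idempotent_endo = species S for S :: "('c, 'r, 'a) species" +
  fixes M :: "('c, 'r, 'a, 'm) representation" and s
  assumes M: "is_representation S M" and s: "s \<in> rep_hom S M M" "rep_comp S M s s = s"
begin

abbreviation sM where "sM \<equiv> sub_rep S M s"

lemma fixed:
  assumes "x \<in> Idx S" "m \<in> s x ` carrier (Mod_at M x)"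
  shows "s x m = m" "m \<in> carrier (Mod_at M x)"
proof -
  obtain n where n: "n \<in> carrier (Mod_at M x)" "m = s x n" using assms by blast
  then show "m \<in> carrier (Mod_at M x)" using rep_homD(4)[OF s(1) assms(1)] by simp
  have "rep_comp S M s s x n = s x n" using s(2) by simp
  then show "s x m = m" using n assms(1) by (simp add: rep_End_apply)
qed

lemma image_closed: "\<lbrakk>x \<in> Idx S; m \<in> carrier (Mod_at M x)\<rbrakk> \<Longrightarrow> s x m \<in> carrier (Mod_at M x)"
  by (rule rep_homD(4)[OF s(1)])

lemma imageI': "\<lbrakk>m \<in> carrier (Mod_at M x); s x m = m\<rbrakk> \<Longrightarrow> m \<in> s x ` carrier (Mod_at M x)"
  by (metis imageI)

lemma sub_left_module:
  assumes x: "x \<in> Idx S" shows "left_module (Rng S x) (Mod_at sM x)"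
proof -
  interpret Mx: left_module "Rng S x" "Mod_at M x" by (rule rep_left_module[OF M x])
  note f = fixed[OF x] and sD = rep_homD(5,6)[OF s(1) x]
  have "abelian_group (Mod_at sM x)"
  proof (rule abelian_groupI)
    fix m assume "m \<in> carrier (Mod_at sM x)"
    then have m: "m \<in> carrier (Mod_at M x)" "s x m = m" using f[of m] by simp_all
    have "s x (\<ominus>\<^bsub>Mod_at M x\<^esub> m) = \<ominus>\<^bsub>Mod_at M x\<^esub> m"
      using left_linear_maps_uminus[OF rep_homD(1)[OF s(1) x] Mx.M.abelian_group_axioms Mx.M.abelian_group_axioms m(1)] m(2)
      by simp
    then have "\<ominus>\<^bsub>Mod_at M x\<^esub> m \<in> s x ` carrier (Mod_at M x)" using m(1) by (intro imageI') auto
    then show "\<exists>n\<in>carrier (Mod_at sM x). n \<oplus>\<^bsub>Mod_at sM x\<^esub> m = \<zero>\<^bsub>Mod_at sM x\<^esub>"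
      using m(1) by (intro bexI[of _ "\<ominus>\<^bsub>Mod_at M x\<^esub> m"]) (simp_all add: Mx.M.l_neg)
  next
    show "\<zero>\<^bsub>Mod_at sM x\<^esub> \<in> carrier (Mod_at sM x)"
      using left_linear_maps_zero[OF rep_homD(1)[OF s(1) x] Mx.M.abelian_group_axioms Mx.M.abelian_group_axioms]
      by (simp add: imageI')
    fix m n assume "m \<in> carrier (Mod_at sM x)" "n \<in> carrier (Mod_at sM x)"
    then have "m \<in> carrier (Mod_at M x)" "s x m = m" "n \<in> carrier (Mod_at M x)" "s x n = n"
      using f[of m] f[of n] by simp_all
    then show "m \<oplus>\<^bsub>Mod_at sM x\<^esub> n \<in> carrier (Mod_at sM x)"
      "m \<oplus>\<^bsub>Mod_at sM x\<^esub> n = n \<oplus>\<^bsub>Mod_at sM x\<^esub> m" "\<zero>\<^bsub>Mod_at sM x\<^esub> \<oplus>\<^bsub>Mod_at sM x\<^esub> m = m"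
      by (simp_all add: imageI' sD Mx.M.a_comm)
    fix k assume "k \<in> carrier (Mod_at sM x)"
    then show "m \<oplus>\<^bsub>Mod_at sM x\<^esub> n \<oplus>\<^bsub>Mod_at sM x\<^esub> k = m \<oplus>\<^bsub>Mod_at sM x\<^esub> (n \<oplus>\<^bsub>Mod_at sM x\<^esub> k)"
      using f[of k] \<open>m \<in> carrier (Mod_at M x)\<close> \<open>n \<in> carrier (Mod_at M x)\<close> by (simp add: Mx.M.a_assoc)
  qed
  moreover have "r \<odot>\<^bsub>Mod_at M x\<^esub> m \<in> s x ` carrier (Mod_at M x)"
    if "r \<in> carrier (Rng S x)" "m \<in> s x ` carrier (Mod_at M x)" for r m
    using that f[OF that(2)] by (intro imageI') (auto simp: sD Mx.smult_closed)
  ultimately show ?thesis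
    by (intro left_module.intro left_module_axioms.intro Mx.R.ring_axioms)
      (simp_all add: f(2) Mx.smult_l_distr Mx.smult_r_distr Mx.smult_assoc Mx.smult_one del: image_iff)
qed

lemma inclusion_linear:
  "x \<in> Idx S \<Longrightarrow> (\<lambda>m. m) \<in> left_linear_maps (Rng S x) (Mod_at sM x) (Mod_at M x)"
  by (intro left_linear_mapsI) (auto simp: image_closed)

lemma sub_pure:
  assumes "x \<in> Idx S" "y \<in> Idx S" "a \<in> carrier (Bim S y x)" "m \<in> s x ` carrier (Mod_at M x)"
  shows "Map_at sM y x (pure_at S sM y x a m) = Map_at M y x (pure_at S M y x a m)"
  using id_tensor_pure[OF tensor_productI[OF assms(1,2) sub_left_module[OF assms(1)]]
      rep_tensor_product[OF M assms(1,2)] inclusion_linear[OF assms(1)] assms(3)] assms(4)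
  by (simp add: one_tensor_def)

lemma sub_rep: "is_representation S sM"
  unfolding is_representation_def
proof (intro conjI ballI sub_left_module)
  fix y x assume y: "y \<in> Idx S" and x: "x \<in> Idx S"
  note tp = tensor_productI[OF x y sub_left_module[OF x]] rep_tensor_product[OF M x y]
  note i = inclusion_linear[OF x]
  have l: "(\<lambda>t. Map_at M y x (one_tensor S M y x (\<lambda>m. m) t)) \<in>
      left_linear_maps (Rng S y) (tensor_at S sM y x) (Mod_at M y)"
    using id_tensor_linear[OF tp i] rep_map_linear[OF M x y]
    unfolding one_tensor_def tensor_at_def by (rule left_linear_maps_comp)
  have im: "Map_at M y x (one_tensor S M y x (\<lambda>m. m) t) \<in> s y ` carrier (Mod_at M y)"
    if t: "t \<in> carrier (tensor_at S sM y x)" for t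
  proof -
    let ?t = "one_tensor S M y x (\<lambda>m. m) t"
    have t': "t \<in> carrier (tensor (Rng S x) (Bim S y x) (Mod_at sM x))" using t by (simp add: tensor_at_def)
    have "?t \<in> carrier (tensor_at S M y x)"
      using left_linear_mapsD(1)[OF id_tensor_linear[OF tp i] t'] by (simp add: one_tensor_def tensor_at_def)
    then have "Map_at M y x (one_tensor S M y x (s x) ?t) = s y (Map_at M y x ?t)"
      using s(1) x y unfolding rep_hom_def by blast
    \<comment> \<open>A tensor coming from the image of s is fixed by 1 \<otimes> s. Since s is a
      morphism, its value under the structure map is then fixed by s as well and so lies in the
      image.\<close>
    moreover have "one_tensor S M y x (s x) ?t = ?t"
      unfolding one_tensor_def
        id_tensor_comp[OF tp tp(2) i rep_homD(1)[OF s(1) x] t']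
      by (rule id_tensor_cong[OF tp left_linear_maps_comp[OF i rep_homD(1)[OF s(1) x]] i t'])
        (rule fixed(1)[OF x], simp)
    ultimately show ?thesis
      using left_linear_mapsD(1)[OF l t] by (intro imageI') simp_all
  qed
  show "Map_at sM y x \<in> left_linear_maps (Rng S y) (tensor_at S sM y x) (Mod_at sM y)"
    using left_linear_mapsD[OF l] im by (intro left_linear_mapsI) simp_all
qed

lemma corner_iff:
  "f \<in> carrier (corner (rep_End S M) s) \<longleftrightarrow>
    f \<in> rep_hom S M M \<and> (\<forall>x\<in>Idx S. \<forall>m\<in>carrier (Mod_at M x). s x (f x m) = f x m \<and> f x (s x m) = f x m)"
    (is "?l \<longleftrightarrow> ?r")
proof
  assume l: ?l
  then have f: "f \<in> rep_hom S M M" "rep_comp S M s f = f" "rep_comp S M f s = f" by auto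
  have "s x (f x m) = f x m" "f x (s x m) = f x m" if "x \<in> Idx S" "m \<in> carrier (Mod_at M x)" for x m
    using fun_cong[OF fun_cong[OF f(2)], of x m] fun_cong[OF fun_cong[OF f(3)], of x m] that
    by (simp_all add: rep_End_apply)
  then show ?r using f by blast
next
  assume r: ?r
  then have "rep_comp S M s f = f" "rep_comp S M f s = f"
    by (auto intro!: rep_hom_eqI[of _ M M] rep_End_closed(4)[OF M] s simp: rep_End_apply)
  then show ?l using r by simp
qed

text \<open>An endomorphism of the image is extended to M by precomposing with s, which lands in the
  corner sEs; restriction to the image is the inverse. Multiplicativity uses that s fixes the values
  of the inner factor.\<close>

lemma End_sub_rep_iso: "ring_iso (rep_End S sM) (corner (rep_End S M) s) \<noteq> {}"
proof -
  define \<Phi> where "\<Phi> \<phi> = (\<lambda>x\<in>Idx S. \<lambda>m\<in>carrier (Mod_at M x). \<phi> x (s x m))" for \<phi> :: "'c \<Rightarrow> 'm \<Rightarrow> 'm"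
  have \<Phi>: "\<Phi> \<phi> x m = \<phi> x (s x m)" if "x \<in> Idx S" "m \<in> carrier (Mod_at M x)" for \<phi> x m
    using that by (simp add: \<Phi>_def)
  have im: "\<phi> x m \<in> s x ` carrier (Mod_at M x)"
    if "\<phi> \<in> rep_hom S sM sM" "x \<in> Idx S" "m \<in> s x ` carrier (Mod_at M x)" for \<phi> x m
    using rep_homD(4)[OF that(1,2)] that(3) by simp
  have corner: "\<Phi> \<phi> \<in> carrier (corner (rep_End S M) s)" if \<phi>: "\<phi> \<in> rep_hom S sM sM" for \<phi>
  proof -
    have "\<Phi> \<phi> \<in> rep_hom S M M"
    proof (rule rep_homI[OF M M])
      fix x assume x: "x \<in> Idx S"
      interpret Mx: left_module "Rng S x" "Mod_at M x" by (rule rep_left_module[OF M x])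
      show "\<Phi> \<phi> x \<in> left_linear_maps (Rng S x) (Mod_at M x) (Mod_at M x)"
        using fixed(2)[OF x im[OF \<phi> x]] rep_homD(5,6)[OF \<phi> x] rep_homD(5,6)[OF s(1) x]
        by (intro left_linear_mapsI) (simp_all add: \<Phi> x Mx.smult_closed)
    next
      fix x y a m assume *: "x \<in> Idx S" "y \<in> Idx S" "a \<in> carrier (Bim S y x)" "m \<in> carrier (Mod_at M x)"
      have sm: "s x m \<in> carrier (Mod_at sM x)" using * by simp
      have "Map_at M y x (pure_at S M y x a (\<phi> x (s x m))) = Map_at sM y x (pure_at S sM y x a (\<phi> x (s x m)))"
        using sub_pure[OF *(1-3) im[OF \<phi> *(1)]] sm by simp
      also have "\<dots> = \<phi> y (Map_at sM y x (pure_at S sM y x a (s x m)))"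
        by (rule rep_hom_pure[OF sub_rep sub_rep \<phi> *(1-3) sm])
      also have "Map_at sM y x (pure_at S sM y x a (s x m)) = Map_at M y x (pure_at S M y x a (s x m))"
        using sub_pure[OF *(1-3)] sm by simp
      also have "\<dots> = s y (Map_at M y x (pure_at S M y x a m))"
        by (rule rep_hom_pure[OF M M s(1) *])
      finally show "Map_at M y x (pure_at S M y x a (\<Phi> \<phi> x m)) = \<Phi> \<phi> y (Map_at M y x (pure_at S M y x a m))"
        using * Map_pure_closed[OF M *] by (simp add: \<Phi>)
    qed (auto simp: \<Phi>_def)
    moreover have "s x (\<Phi> \<phi> x m) = \<Phi> \<phi> x m" "\<Phi> \<phi> x (s x m) = \<Phi> \<phi> x m"
      if "x \<in> Idx S" "m \<in> carrier (Mod_at M x)" for x m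
      using fixed(1)[OF that(1) im[OF \<phi> that(1)], of "s x m"] fixed(1)[OF that(1), of "s x m"] that
      by (simp_all add: \<Phi> image_closed)
    ultimately show ?thesis unfolding corner_iff by blast
  qed
  have cE: "f \<in> rep_hom S M M" if "f \<in> carrier (corner (rep_End S M) s)" for f
    using that by simp
  have "\<Phi> \<in> ring_iso (rep_End S sM) (corner (rep_End S M) s)"
  proof (rule ring_iso_memI)
    show "\<Phi> \<phi> \<in> carrier (corner (rep_End S M) s)" if "\<phi> \<in> carrier (rep_End S sM)" for \<phi>
      using corner that by simp
    fix \<phi> \<psi> assume "\<phi> \<in> carrier (rep_End S sM)" "\<psi> \<in> carrier (rep_End S sM)"
    then have \<phi>: "\<phi> \<in> rep_hom S sM sM" and \<psi>: "\<psi> \<in> rep_hom S sM sM" by auto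
    note c = corner[OF \<phi>, THEN cE] corner[OF \<psi>, THEN cE]
    show "\<Phi> (\<phi> \<otimes>\<^bsub>rep_End S sM\<^esub> \<psi>) = \<Phi> \<phi> \<otimes>\<^bsub>corner (rep_End S M) s\<^esub> \<Phi> \<psi>"
    proof (rule rep_hom_eqI[of _ M M])
      show "\<Phi> (\<phi> \<otimes>\<^bsub>rep_End S sM\<^esub> \<psi>) \<in> rep_hom S M M"
        using corner[OF rep_End_closed(4)[OF sub_rep \<phi> \<psi>], THEN cE] by simp
      show "\<Phi> \<phi> \<otimes>\<^bsub>corner (rep_End S M) s\<^esub> \<Phi> \<psi> \<in> rep_hom S M M"
        using rep_End_closed(4)[OF M c] by simp
      fix x m assume x: "x \<in> Idx S" and m: "m \<in> carrier (Mod_at M x)"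
      have "\<psi> x (s x m) \<in> s x ` carrier (Mod_at M x)" using im[OF \<psi> x] m by simp
      then show "\<Phi> (\<phi> \<otimes>\<^bsub>rep_End S sM\<^esub> \<psi>) x m = (\<Phi> \<phi> \<otimes>\<^bsub>corner (rep_End S M) s\<^esub> \<Phi> \<psi>) x m"
        using x m fixed[OF x, of "\<psi> x (s x m)"] by (simp add: \<Phi> rep_End_apply)
    qed
    show "\<Phi> (\<phi> \<oplus>\<^bsub>rep_End S sM\<^esub> \<psi>) = \<Phi> \<phi> \<oplus>\<^bsub>corner (rep_End S M) s\<^esub> \<Phi> \<psi>"
    proof (rule rep_hom_eqI[of _ M M])
      show "\<Phi> (\<phi> \<oplus>\<^bsub>rep_End S sM\<^esub> \<psi>) \<in> rep_hom S M M"
        using corner[OF rep_End_closed(3)[OF sub_rep \<phi> \<psi>], THEN cE] .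
      show "\<Phi> \<phi> \<oplus>\<^bsub>corner (rep_End S M) s\<^esub> \<Phi> \<psi> \<in> rep_hom S M M"
        using rep_End_closed(3)[OF M c] by simp
      fix x m assume x: "x \<in> Idx S" and m: "m \<in> carrier (Mod_at M x)"
      then show "\<Phi> (\<phi> \<oplus>\<^bsub>rep_End S sM\<^esub> \<psi>) x m = (\<Phi> \<phi> \<oplus>\<^bsub>corner (rep_End S M) s\<^esub> \<Phi> \<psi>) x m"
        by (simp add: \<Phi> rep_End_apply)
    qed
  next
    have "\<Phi> (rep_id S sM) = s"
    proof (rule rep_hom_eqI[OF corner[OF rep_End_closed(1)[OF sub_rep], THEN cE] s(1)])
      fix x m assume x: "x \<in> Idx S" and m: "m \<in> carrier (Mod_at M x)"
      then have "rep_id S sM x (s x m) = s x m" by (intro rep_End_apply(4)) simp_all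
      then show "\<Phi> (rep_id S sM) x m = s x m" using x m by (simp add: \<Phi>)
    qed
    then show "\<Phi> \<one>\<^bsub>rep_End S sM\<^esub> = \<one>\<^bsub>corner (rep_End S M) s\<^esub>" by simp
    show "bij_betw \<Phi> (carrier (rep_End S sM)) (carrier (corner (rep_End S M) s))"
      unfolding bij_betw_def
    proof
      show "inj_on \<Phi> (carrier (rep_End S sM))"
      proof (rule inj_onI)
        fix \<phi> \<psi> assume \<phi>: "\<phi> \<in> carrier (rep_End S sM)" "\<psi> \<in> carrier (rep_End S sM)" and eq: "\<Phi> \<phi> = \<Phi> \<psi>"
        show "\<phi> = \<psi>"
        proof (rule rep_hom_eqI[of _ sM sM])
          fix x m assume x: "x \<in> Idx S" and "m \<in> carrier (Mod_at sM x)"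
          then have m: "m \<in> carrier (Mod_at M x)" "s x m = m" using fixed[OF x, of m] by simp_all
          have "\<Phi> \<phi> x m = \<Phi> \<psi> x m" using eq by simp
          then show "\<phi> x m = \<psi> x m" using x m by (simp add: \<Phi>)
        qed (use \<phi> in auto)
      qed
      show "\<Phi> ` carrier (rep_End S sM) = carrier (corner (rep_End S M) s)"
      proof
        show "\<Phi> ` carrier (rep_End S sM) \<subseteq> carrier (corner (rep_End S M) s)"
          using corner by (auto simp del: corner_simps)
        show "carrier (corner (rep_End S M) s) \<subseteq> \<Phi> ` carrier (rep_End S sM)"
        proof
          fix f assume fc: "f \<in> carrier (corner (rep_End S M) s)"
          then have f: "f \<in> rep_hom S M M"
            and fs: "\<And>x m. \<lbrakk>x \<in> Idx S; m \<in> carrier (Mod_at M x)\<rbrakk> \<Longrightarrow> s x (f x m) = f x m"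
              "\<And>x m. \<lbrakk>x \<in> Idx S; m \<in> carrier (Mod_at M x)\<rbrakk> \<Longrightarrow> f x (s x m) = f x m"
            unfolding corner_iff by auto
          let ?\<phi> = "\<lambda>x\<in>Idx S. \<lambda>m\<in>s x ` carrier (Mod_at M x). f x m"
          have \<phi>: "?\<phi> \<in> rep_hom S sM sM"
          proof (rule rep_homI[OF sub_rep sub_rep])
            fix x assume x: "x \<in> Idx S"
            interpret sx: left_module "Rng S x" "Mod_at sM x" by (rule sub_left_module[OF x])
            have add_mem: "m \<oplus>\<^bsub>Mod_at M x\<^esub> n \<in> s x ` carrier (Mod_at M x)"
              if "m \<in> s x ` carrier (Mod_at M x)" "n \<in> s x ` carrier (Mod_at M x)" for m n
              using sx.M.a_closed[of m n] that by simp
            have smult_mem: "r \<odot>\<^bsub>Mod_at M x\<^esub> m \<in> s x ` carrier (Mod_at M x)"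
              if "m \<in> s x ` carrier (Mod_at M x)" "r \<in> carrier (Rng S x)" for m r
              using sx.smult_closed[of r m] that by simp
            have fm: "f x m \<in> s x ` carrier (Mod_at M x)" if "m \<in> s x ` carrier (Mod_at M x)" for m
              using fixed(2)[OF x that] fs(1)[OF x] rep_homD(4)[OF f x] by (intro imageI') auto
            show "?\<phi> x \<in> left_linear_maps (Rng S x) (Mod_at sM x) (Mod_at sM x)"
              by (rule left_linear_mapsI)
                (simp_all add: x add_mem smult_mem fm fixed(2)[OF x] rep_homD(5,6)[OF f x] del: image_iff)
          next
            fix x y a m assume *: "x \<in> Idx S" "y \<in> Idx S" "a \<in> carrier (Bim S y x)" "m \<in> carrier (Mod_at sM x)"
            then have m: "m \<in> s x ` carrier (Mod_at M x)" by simp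
            have fm: "f x m \<in> s x ` carrier (Mod_at M x)"
              using fixed(2)[OF *(1) m] fs(1)[OF *(1)] rep_homD(4)[OF f *(1)] by (intro imageI') auto
            have "Map_at sM y x (pure_at S sM y x a (f x m)) = Map_at M y x (pure_at S M y x a (f x m))"
              by (rule sub_pure[OF *(1-3) fm])
            also have "\<dots> = f y (Map_at M y x (pure_at S M y x a m))"
              by (rule rep_hom_pure[OF M M f *(1-3) fixed(2)[OF *(1) m]])
            also have "Map_at M y x (pure_at S M y x a m) = Map_at sM y x (pure_at S sM y x a m)"
              by (rule sub_pure[OF *(1-3) m, symmetric])
            finally have "Map_at sM y x (pure_at S sM y x a (f x m)) = f y (Map_at sM y x (pure_at S sM y x a m))" .
            moreover have "Map_at sM y x (pure_at S sM y x a m) \<in> s y ` carrier (Mod_at M y)"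
              using Map_pure_closed[OF sub_rep *] by simp
            ultimately show "Map_at sM y x (pure_at S sM y x a (?\<phi> x m)) = ?\<phi> y (Map_at sM y x (pure_at S sM y x a m))"
              using * m by (simp del: sub_rep_simps(5))
          qed auto
          have "f = \<Phi> ?\<phi>"
            by (rule rep_hom_eqI[of _ M M]) (use f corner[OF \<phi>, THEN cE] fs(2) in \<open>auto simp: \<Phi>\<close>)
          then show "f \<in> \<Phi> ` carrier (rep_End S sM)" using \<phi> by auto
        qed
      qed
    qed
  qed
  then show ?thesis by blast
qed

lemma strongly_indecomposable_sub_rep:
  assumes "local_ring (corner (rep_End S M) s)"
  shows "strongly_indecomposable S sM"
proof -
  have "ring (corner (rep_End S M) s)"
    using ring.corner_ring[OF rep_End_ring[OF M]] s by simp
  then show ?thesis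
    using End_sub_rep_iso local_ring_iso[OF rep_End_ring[OF sub_rep] _ _ assms]
    unfolding strongly_indecomposable_def by blast
qed

end

section \<open>Direct sums of representations\<close>

lemma comm_group_sum_group:
  assumes "\<And>i. i \<in> I \<Longrightarrow> comm_group (G i)" shows "comm_group (sum_group I G)"
proof -
  have g: "group (G i)" if "i \<in> I" for i using assms[OF that] by (simp add: comm_group_def)
  show ?thesis
  proof (rule group.group_comm_groupI)
    show "group (sum_group I G)" using g by simp
    fix v w assume "v \<in> carrier (sum_group I G)" "w \<in> carrier (sum_group I G)"
    then have "v i \<otimes>\<^bsub>G i\<^esub> w i = w i \<otimes>\<^bsub>G i\<^esub> v i" if "i \<in> I" for i
      using that comm_groupE(4)[OF assms[OF that], of "v i" "w i"] by (auto simp: carrier_sum_group g)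
    then show "v \<otimes>\<^bsub>sum_group I G\<^esub> w = w \<otimes>\<^bsub>sum_group I G\<^esub> v" by auto
  qed
qed

context species
begin

lemma direct_sum_carrier:
  assumes "\<forall>i\<in>I. is_representation S (N i)" "x \<in> Idx S"
  shows "v \<in> carrier (Mod_at (rep_direct_sum S I N) x) \<longleftrightarrow>
    v \<in> (\<Pi>\<^sub>E i\<in>I. carrier (Mod_at (N i) x)) \<and> finite {i \<in> I. v i \<noteq> \<zero>\<^bsub>Mod_at (N i) x\<^esub>}"
proof -
  have "group (add_monoid (Mod_at (N i) x))" if "i \<in> I" for i
    by (rule abelian_group.a_group) (rule rep_abelian_group[OF assms(1)[rule_format, OF that] assms(2)])
  then show ?thesis by (simp add: rep_direct_sum_def carrier_sum_group)
qed

lemma direct_sum_simps [simp]: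
  "v \<oplus>\<^bsub>Mod_at (rep_direct_sum S I N) x\<^esub> w = (\<lambda>i\<in>I. v i \<oplus>\<^bsub>Mod_at (N i) x\<^esub> w i)"
  "\<zero>\<^bsub>Mod_at (rep_direct_sum S I N) x\<^esub> = (\<lambda>i\<in>I. \<zero>\<^bsub>Mod_at (N i) x\<^esub>)"
  "r \<odot>\<^bsub>Mod_at (rep_direct_sum S I N) x\<^esub> v = (\<lambda>i\<in>I. r \<odot>\<^bsub>Mod_at (N i) x\<^esub> v i)"
  "Map_at (rep_direct_sum S I N) y x t = (\<lambda>i\<in>I. Map_at (N i) y x (one_tensor S (N i) y x (\<lambda>v. v i) t))"
  by (simp_all add: rep_direct_sum_def)

lemma direct_sum_left_module:
  assumes N: "\<forall>i\<in>I. is_representation S (N i)" and x: "x \<in> Idx S"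
  shows "left_module (Rng S x) (Mod_at (rep_direct_sum S I N) x)"
proof -
  note lm = rep_left_module[OF N[rule_format] x] and ab = rep_abelian_group[OF N[rule_format] x]
  note car = direct_sum_carrier[OF N x]
  have "abelian_group (Mod_at (rep_direct_sum S I N) x)"
    unfolding rep_direct_sum_def representation.simps
    by (intro abelian_group_module_of comm_group_sum_group abelian_group.a_comm_group ab)
  moreover have "ring (Rng S x)" using species x by (simp add: is_species_def)
  moreover have "(\<lambda>i\<in>I. r \<odot>\<^bsub>Mod_at (N i) x\<^esub> v i) \<in> carrier (Mod_at (rep_direct_sum S I N) x)"
    if r: "r \<in> carrier (Rng S x)" and v: "v \<in> carrier (Mod_at (rep_direct_sum S I N) x)" for r v
  proof -
    have "{i \<in> I. (\<lambda>i\<in>I. r \<odot>\<^bsub>Mod_at (N i) x\<^esub> v i) i \<noteq> \<zero>\<^bsub>Mod_at (N i) x\<^esub>}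
        \<subseteq> {i \<in> I. v i \<noteq> \<zero>\<^bsub>Mod_at (N i) x\<^esub>}"
      using left_module.smult_r_null[OF lm r] by auto
    moreover have "finite {i \<in> I. v i \<noteq> \<zero>\<^bsub>Mod_at (N i) x\<^esub>}" using v unfolding car by blast
    ultimately have "finite {i \<in> I. (\<lambda>i\<in>I. r \<odot>\<^bsub>Mod_at (N i) x\<^esub> v i) i \<noteq> \<zero>\<^bsub>Mod_at (N i) x\<^esub>}"
      by (rule finite_subset)
    moreover have "(\<lambda>i\<in>I. r \<odot>\<^bsub>Mod_at (N i) x\<^esub> v i) \<in> (\<Pi>\<^sub>E i\<in>I. carrier (Mod_at (N i) x))"
      using v left_module.smult_closed[OF lm r] unfolding car by auto
    ultimately show ?thesis unfolding car by blast
  qed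
  moreover have "v i \<in> carrier (Mod_at (N i) x)"
    if "v \<in> carrier (Mod_at (rep_direct_sum S I N) x)" "i \<in> I" for v i
    using that unfolding car by auto
  moreover have "v \<in> extensional I" if "v \<in> carrier (Mod_at (rep_direct_sum S I N) x)" for v
    using that unfolding car by (auto simp: PiE_iff)
  ultimately show ?thesis
    by (intro left_module.intro left_module_axioms.intro)
      (auto intro!: restrict_ext extensionalityI[of _ I] simp: left_module.smult_l_distr[OF lm] left_module.smult_r_distr[OF lm]
        left_module.smult_assoc[OF lm] left_module.smult_one[OF lm])
qed

lemma direct_sum_proj_linear:
  assumes N: "\<forall>i\<in>I. is_representation S (N i)" and x: "x \<in> Idx S" and i: "i \<in> I"
  shows "(\<lambda>v. v i) \<in> left_linear_maps (Rng S x) (Mod_at (rep_direct_sum S I N) x) (Mod_at (N i) x)"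
  using i by (intro left_linear_mapsI) (auto simp: direct_sum_carrier[OF N x])

text \<open>The mapping property with pointwise finite support. For the target only the vertex
  modules have been checked, so commutation is verified on every tensor, componentwise and by
  functoriality, and not through the criterion on pure tensors.\<close>

lemma rep_hom_into_direct_sum:
  assumes M: "is_representation S M" and N: "\<forall>i\<in>I. is_representation S (N i)"
    and f: "\<forall>i\<in>I. f i \<in> rep_hom S M (N i)"
    and fin: "\<And>x m. \<lbrakk>x \<in> Idx S; m \<in> carrier (Mod_at M x)\<rbrakk> \<Longrightarrow> finite {i \<in> I. f i x m \<noteq> \<zero>\<^bsub>Mod_at (N i) x\<^esub>}"
  shows "(\<lambda>x\<in>Idx S. \<lambda>m\<in>carrier (Mod_at M x). \<lambda>i\<in>I. f i x m) \<in> rep_hom S M (rep_direct_sum S I N)"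
    (is "?F \<in> rep_hom S M ?D")
proof -
  have lin: "?F x \<in> left_linear_maps (Rng S x) (Mod_at M x) (Mod_at ?D x)" if x: "x \<in> Idx S" for x
  proof (rule left_linear_mapsI)
    interpret Mx: left_module "Rng S x" "Mod_at M x" by (rule rep_left_module[OF M x])
    fix m assume m: "m \<in> carrier (Mod_at M x)"
    have "{i \<in> I. (\<lambda>i\<in>I. f i x m) i \<noteq> \<zero>\<^bsub>Mod_at (N i) x\<^esub>} = {i \<in> I. f i x m \<noteq> \<zero>\<^bsub>Mod_at (N i) x\<^esub>}"
      by auto
    then show "?F x m \<in> carrier (Mod_at ?D x)"
      using fin[OF x m] rep_homD(4)[OF f[rule_format] x m] x m unfolding direct_sum_carrier[OF N x] by simp
    show "?F x (m \<oplus>\<^bsub>Mod_at M x\<^esub> n) = ?F x m \<oplus>\<^bsub>Mod_at ?D x\<^esub> ?F x n" if "n \<in> carrier (Mod_at M x)" for n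
      using rep_homD(5)[OF f[rule_format] x m that] x m that by (auto intro!: restrict_ext)
    show "?F x (r \<odot>\<^bsub>Mod_at M x\<^esub> m) = r \<odot>\<^bsub>Mod_at ?D x\<^esub> ?F x m" if "r \<in> carrier (Rng S x)" for r
      using rep_homD(6)[OF f[rule_format] x that m] x m that Mx.smult_closed by (auto intro!: restrict_ext)
  qed
  have "Map_at ?D y x (one_tensor S ?D y x (?F x) t) = ?F y (Map_at M y x t)"
    if x: "x \<in> Idx S" and y: "y \<in> Idx S" and t: "t \<in> carrier (tensor_at S M y x)" for x y t
  proof -
    note tp = rep_tensor_product[OF M x y] tensor_productI[OF x y direct_sum_left_module[OF N x]]
    note t' = t[unfolded tensor_at_def]
    have Mt: "Map_at M y x t \<in> carrier (Mod_at M y)"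
      using left_linear_mapsD(1)[OF rep_map_linear[OF M x y] t] .
    have "Map_at (N i) y x (one_tensor S (N i) y x (\<lambda>v. v i) (one_tensor S ?D y x (?F x) t)) = f i y (Map_at M y x t)"
      if i: "i \<in> I" for i
    proof -
      note tpi = rep_tensor_product[OF N[rule_format, OF i] x y]
      note p = direct_sum_proj_linear[OF N x i]
      \<comment> \<open>The i-th projection composed with the family is \<open>f i\<close>, so the
        component reduces to the commutation already known for \<open>f i\<close>.\<close>
      have "one_tensor S (N i) y x (\<lambda>v. v i) (one_tensor S ?D y x (?F x) t) = one_tensor S (N i) y x (f i x) t"
        unfolding one_tensor_def
          id_tensor_comp[OF tp tpi lin[OF x] p t']
        by (rule id_tensor_cong[OF tp(1) tpi left_linear_maps_comp[OF lin[OF x] p] rep_homD(1)[OF f[rule_format, OF i] x] t'])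
          (simp add: x i)
      then show ?thesis using f[rule_format, OF i] x y t unfolding rep_hom_def by auto
    qed
    then show ?thesis using y Mt by (auto intro!: restrict_ext)
  qed
  then show ?thesis using lin unfolding rep_hom_def by auto
qed

text \<open>The vertexwise inverse G is again a morphism: writing t as the image under 1 \<otimes> F
  of its image under 1 \<otimes> G, commutation for F followed by an application of G gives
  commutation for G. Of D only the module structure is assumed, so that a direct sum can be
  inserted.\<close>

lemma rep_iso_of_bij:
  assumes M: "is_representation S M" and D: "\<And>x. x \<in> Idx S \<Longrightarrow> left_module (Rng S x) (Mod_at D x)"
    and F: "F \<in> rep_hom S M D"
    and bij: "\<And>x. x \<in> Idx S \<Longrightarrow> bij_betw (F x) (carrier (Mod_at M x)) (carrier (Mod_at D x))"
  shows "rep_iso S M D"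
proof -
  define G where "G = (\<lambda>x\<in>Idx S. \<lambda>d\<in>carrier (Mod_at D x). the_inv_into (carrier (Mod_at M x)) (F x) d)"
  have GF: "G x (F x m) = m" if "x \<in> Idx S" "m \<in> carrier (Mod_at M x)" for x m
    using bij[OF that(1)] rep_homD(4)[OF F that] that
    by (simp add: G_def bij_betw_def the_inv_into_f_f)
  have FG: "F x (G x d) = d" and Gcl: "G x d \<in> carrier (Mod_at M x)"
    if xd: "x \<in> Idx S" "d \<in> carrier (Mod_at D x)" for x d
  proof -
    obtain m where m: "m \<in> carrier (Mod_at M x)" "d = F x m"
      using bij[OF xd(1)] xd(2) unfolding bij_betw_def by blast
    show "F x (G x d) = d" "G x d \<in> carrier (Mod_at M x)" using GF[OF xd(1) m(1)] m by simp_all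
  qed
  have Glin: "G x \<in> left_linear_maps (Rng S x) (Mod_at D x) (Mod_at M x)" if x: "x \<in> Idx S" for x
  proof (rule left_linear_mapsI)
    interpret Mx: left_module "Rng S x" "Mod_at M x" by (rule rep_left_module[OF M x])
    fix m assume m: "m \<in> carrier (Mod_at D x)"
    show "G x m \<in> carrier (Mod_at M x)" using Gcl[OF x m] .
    show "G x (m \<oplus>\<^bsub>Mod_at D x\<^esub> n) = G x m \<oplus>\<^bsub>Mod_at M x\<^esub> G x n" if n: "n \<in> carrier (Mod_at D x)" for n
      using GF[OF x, of "G x m \<oplus>\<^bsub>Mod_at M x\<^esub> G x n"] rep_homD(5)[OF F x Gcl[OF x m] Gcl[OF x n]]
        Gcl[OF x m] Gcl[OF x n] FG[OF x m] FG[OF x n] by simp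
    show "G x (r \<odot>\<^bsub>Mod_at D x\<^esub> m) = r \<odot>\<^bsub>Mod_at M x\<^esub> G x m" if r: "r \<in> carrier (Rng S x)" for r
      using GF[OF x, of "r \<odot>\<^bsub>Mod_at M x\<^esub> G x m"] rep_homD(6)[OF F x r Gcl[OF x m]]
        Gcl[OF x m] FG[OF x m] Mx.smult_closed[OF r] by simp
  qed
  have "Map_at M y x (one_tensor S M y x (G x) t) = G y (Map_at D y x t)"
    if x: "x \<in> Idx S" and y: "y \<in> Idx S" and t: "t \<in> carrier (tensor_at S D y x)" for x y t
  proof -
    note tpM = rep_tensor_product[OF M x y] and tpD = tensor_productI[OF x y D[OF x]]
    note t' = t[unfolded tensor_at_def]
    note Fx = rep_homD(1)[OF F x]
    let ?s = "one_tensor S M y x (G x) t"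
    have s: "?s \<in> carrier (tensor_at S M y x)"
      using left_linear_mapsD(1)[OF id_tensor_linear[OF tpD tpM Glin[OF x]] t']
      by (simp add: one_tensor_def tensor_at_def)
    have id: "(\<lambda>m. m) \<in> left_linear_maps (Rng S x) (Mod_at D x) (Mod_at D x)"
      by (rule left_linear_mapsI) auto
    have "one_tensor S D y x (F x) ?s = t"
      unfolding one_tensor_def id_tensor_comp[OF tpD tpM tpD Glin[OF x] Fx t']
      using id_tensor_cong[OF tpD tpD left_linear_maps_comp[OF Glin[OF x] Fx] id t'] FG[OF x]
        id_tensor_ident[OF tpD t'] by simp
    moreover have "Map_at D y x (one_tensor S D y x (F x) ?s) = F y (Map_at M y x ?s)"
      using F x y s unfolding rep_hom_def by blast
    ultimately show ?thesis
      using GF[OF y] left_linear_mapsD(1)[OF rep_map_linear[OF M x y] s] by simp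
  qed
  then have G: "G \<in> rep_hom S D M" using Glin unfolding rep_hom_def by (auto simp: G_def)
  have "rep_comp S M G F = rep_id S M" "rep_comp S D F G = rep_id S D"
    using GF FG by (auto simp: rep_comp_def rep_id_def compose_def intro!: restrict_ext)
  then show ?thesis using F G unfolding rep_iso_def by blast
qed

end

theorem lemma3p4:
  fixes S :: "('c, 'r, 'a) species"
    and M :: "('c, 'r, 'a, 'm) representation"
  assumes "is_species S"
    and "is_representation S M"
    and "\<And>x. x \<in> Idx S \<Longrightarrow> artinian_module (rep_End S M) (End_module M x)"
  shows "\<exists>(I :: ('c \<times> 'm) set) (N :: 'c \<times> 'm \<Rightarrow> ('c, 'r, 'a, 'm) representation).
           (\<forall>i\<in>I. is_representation S (N i) \<and> strongly_indecomposable S (N i)) \<and>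
           rep_iso S M (rep_direct_sum S I N)"
proof -
  interpret species S by unfold_locales (rule assms(1))
  note M = assms(2)
  interpret E: operator_ring "rep_End S M" "Idx S" "End_module M"
    by (rule operator_ring_End[OF M assms(3)])
  obtain Q p where Q: "Q \<subseteq> carrier (rep_End S M)"
    and idem': "\<forall>s\<in>Q. s \<otimes>\<^bsub>rep_End S M\<^esub> s = s \<and> s \<noteq> \<zero>\<^bsub>rep_End S M\<^esub> \<and> local_ring (corner (rep_End S M) s)"
    and p': "\<forall>s\<in>Q. p s \<in> carrier (rep_End S M) \<and> s \<otimes>\<^bsub>rep_End S M\<^esub> p s = p s \<and>
      p s \<otimes>\<^bsub>rep_End S M\<^esub> s = s \<and> (\<forall>t\<in>Q. t \<noteq> s \<longrightarrow> p s \<otimes>\<^bsub>rep_End S M\<^esub> t = \<zero>\<^bsub>rep_End S M\<^esub>)"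
    and fin': "\<forall>x\<in>Idx S. \<forall>v\<in>carrier (End_module M x).
      finite {s \<in> Q. p s \<odot>\<^bsub>End_module M x\<^esub> v \<noteq> \<zero>\<^bsub>End_module M x\<^esub>} \<and>
      ((\<forall>s\<in>Q. p s \<odot>\<^bsub>End_module M x\<^esub> v = \<zero>\<^bsub>End_module M x\<^esub>) \<longrightarrow> v = \<zero>\<^bsub>End_module M x\<^esub>)"
    using E.local_decomposition by (elim exE conjE) (rule that)
  note Q = Q[unfolded rep_End_simps]
  have idem: "rep_comp S M s s = s" "s \<noteq> \<zero>\<^bsub>rep_End S M\<^esub>" "local_ring (corner (rep_End S M) s)"
    if "s \<in> Q" for s
    using bspec[OF idem' that] by simp_all
  have p: "p s \<in> rep_hom S M M \<and> rep_comp S M s (p s) = p s \<and> rep_comp S M (p s) s = s"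
    "\<lbrakk>t \<in> Q; t \<noteq> s\<rbrakk> \<Longrightarrow> rep_comp S M (p s) t = \<zero>\<^bsub>rep_End S M\<^esub>" if "s \<in> Q" for s t
    using bspec[OF p' that] by simp_all
  have fin: "finite {s \<in> Q. p s x v \<noteq> \<zero>\<^bsub>Mod_at M x\<^esub>}"
    and inj: "\<forall>s\<in>Q. p s x v = \<zero>\<^bsub>Mod_at M x\<^esub> \<Longrightarrow> v = \<zero>\<^bsub>Mod_at M x\<^esub>"
    if "x \<in> Idx S" "v \<in> carrier (Mod_at M x)" for x v
    using fin'[rule_format, of x v] that by simp_all
  have endo: "idempotent_endo S M s" if "s \<in> Q" for s
    using idem(1)[OF that] M Q that by unfold_locales auto
  have sp: "s x (p s x m) = p s x m" and ps: "p s x (s x m) = s x m"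
    if "s \<in> Q" "x \<in> Idx S" "m \<in> carrier (Mod_at M x)" for s x m
    using p(1)[OF that(1)] rep_End_apply(3)[OF that(2,3), of s "p s"] rep_End_apply(3)[OF that(2,3), of "p s" s]
    by simp_all
  have pt: "p s x (t x m) = \<zero>\<^bsub>Mod_at M x\<^esub>"
    if "s \<in> Q" "t \<in> Q" "t \<noteq> s" "x \<in> Idx S" "m \<in> carrier (Mod_at M x)" for s t x m
    using p(2)[OF that(1-3)] rep_End_apply(3)[OF that(4,5), of "p s" t] rep_End_apply(2)[OF that(4,5)] by simp
  have scl: "s x m \<in> carrier (Mod_at M x)" "p s x m \<in> carrier (Mod_at M x)"
    if "s \<in> Q" "x \<in> Idx S" "m \<in> carrier (Mod_at M x)" for s x m
    using rep_homD(4)[of _ M M x m] Q p(1) that by blast+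
  have "\<exists>x m. x \<in> Idx S \<and> m \<in> carrier (Mod_at M x) \<and> s x m \<noteq> \<zero>\<^bsub>Mod_at M x\<^esub>" if s: "s \<in> Q" for s
  proof (rule ccontr)
    assume "\<not> ?thesis"
    then have "s = \<zero>\<^bsub>rep_End S M\<^esub>"
      using s Q by (intro rep_hom_eqI[of _ M M] rep_End_closed(2)[OF M]) (auto simp: rep_End_apply)
    then show False using idem(2)[OF s] by blast
  qed
  then obtain X m where Xm: "\<And>s. s \<in> Q \<Longrightarrow> X s \<in> Idx S" "\<And>s. s \<in> Q \<Longrightarrow> m s \<in> carrier (Mod_at M (X s))"
    "\<And>s. s \<in> Q \<Longrightarrow> s (X s) (m s) \<noteq> \<zero>\<^bsub>Mod_at M (X s)\<^esub>" by metis
  \<comment> \<open>A summand \<open>sM\<close> is indexed by a nonzero element of it, which fits the index type \<open>'c \<times> 'm\<close>.\<close>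
  define \<iota> where "\<iota> s = (X s, s (X s) (m s))" for s
  have inj_\<iota>: "inj_on \<iota> Q"
  proof (rule inj_onI, rule ccontr)
    fix s t assume s: "s \<in> Q" and t: "t \<in> Q" and eq: "\<iota> s = \<iota> t" and ne: "s \<noteq> t"
    then have X: "X s = X t" "s (X s) (m s) = t (X s) (m t)" by (auto simp: \<iota>_def)
    \<comment> \<open>\<open>p s\<close> fixes elements of the image of s and kills those of the
      image of t, so a common label would be zero.\<close>
    have "s (X s) (m s) = p s (X s) (s (X s) (m s))" using ps[OF s Xm(1,2)[OF s]] by simp
    also have "\<dots> = \<zero>\<^bsub>Mod_at M (X s)\<^esub>"
      unfolding X(2) using pt[OF s t] ne Xm(1,2)[OF t] X(1) by simp
    finally show False using Xm(3)[OF s] by simp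
  qed
  define I where "I = \<iota> ` Q"
  define \<sigma> where "\<sigma> = the_inv_into Q \<iota>"
  have \<sigma>\<iota>: "\<sigma> (\<iota> s) = s" if "s \<in> Q" for s
    using the_inv_into_f_f[OF inj_\<iota> that] by (simp add: \<sigma>_def)
  have \<sigma>: "\<sigma> i \<in> Q" "\<iota> (\<sigma> i) = i" if "i \<in> I" for i
    using that \<sigma>\<iota> by (auto simp: I_def)
  define N where "N i = sub_rep S M (\<sigma> i)" for i
  have N: "is_representation S (N i)" "strongly_indecomposable S (N i)" if i: "i \<in> I" for i
  proof -
    interpret idempotent_endo S M "\<sigma> i" by (rule endo[OF \<sigma>(1)[OF i]])
    show "is_representation S (N i)" using sub_rep by (simp add: N_def)
    show "strongly_indecomposable S (N i)"
      using strongly_indecomposable_sub_rep idem(3)[OF \<sigma>(1)[OF i]] by (simp add: N_def)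
  qed
  have pN: "p (\<sigma> i) \<in> rep_hom S M (N i)" if i: "i \<in> I" for i
  proof -
    let ?s = "\<sigma> i"
    note sQ = \<sigma>(1)[OF i]
    interpret idempotent_endo S M ?s by (rule endo[OF sQ])
    have ph: "p ?s \<in> rep_hom S M M" using p(1)[OF sQ] by blast
    have im: "p ?s x m \<in> ?s x ` carrier (Mod_at M x)" if "x \<in> Idx S" "m \<in> carrier (Mod_at M x)" for x m
      using imageI'[OF scl(2)[OF sQ that] sp[OF sQ that]] .
    show ?thesis
      unfolding N_def
    proof (rule rep_homI[OF M sub_rep])
      fix x assume x: "x \<in> Idx S"
      show "p ?s x \<in> left_linear_maps (Rng S x) (Mod_at M x) (Mod_at sM x)"
        using im[OF x] rep_homD(5,6)[OF ph x] by (intro left_linear_mapsI) simp_all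
    next
      fix x y a m assume *: "x \<in> Idx S" "y \<in> Idx S" "a \<in> carrier (Bim S y x)" "m \<in> carrier (Mod_at M x)"
      show "Map_at sM y x (pure_at S sM y x a (p ?s x m)) = p ?s y (Map_at M y x (pure_at S M y x a m))"
        unfolding sub_pure[OF *(1-3) im[OF *(1,4)]] by (rule rep_hom_pure[OF M M ph *])
    qed (use ph in \<open>auto simp: rep_hom_def PiE_iff\<close>)
  qed
  have NI: "\<forall>i\<in>I. is_representation S (N i)" and pNI: "\<forall>i\<in>I. p (\<sigma> i) \<in> rep_hom S M (N i)"
    using N(1) pN by blast+
  let ?D = "rep_direct_sum S I N"
  let ?F = "\<lambda>x\<in>Idx S. \<lambda>m\<in>carrier (Mod_at M x). \<lambda>i\<in>I. p (\<sigma> i) x m"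
  have F: "?F \<in> rep_hom S M ?D"
  proof (rule rep_hom_into_direct_sum[OF M NI pNI])
    fix x m assume xm: "x \<in> Idx S" "m \<in> carrier (Mod_at M x)"
    have "{i \<in> I. p (\<sigma> i) x m \<noteq> \<zero>\<^bsub>Mod_at (N i) x\<^esub>} \<subseteq> \<iota> ` {s \<in> Q. p s x m \<noteq> \<zero>\<^bsub>Mod_at M x\<^esub>}"
      using \<sigma>\<iota> by (auto simp: N_def I_def)
    then show "finite {i \<in> I. p (\<sigma> i) x m \<noteq> \<zero>\<^bsub>Mod_at (N i) x\<^esub>}"
      using fin[OF xm] by (meson finite_imageI finite_subset)
  qed
  have "bij_betw (?F x) (carrier (Mod_at M x)) (carrier (Mod_at ?D x))" if x: "x \<in> Idx S" for x
  proof -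
    interpret Mx: left_module "Rng S x" "Mod_at M x" by (rule rep_left_module[OF M x])
    have ph: "p s \<in> rep_hom S M M" if "s \<in> Q" for s using p(1)[OF that] by blast
    have "inj_on (?F x) (carrier (Mod_at M x))"
    proof (rule inj_onI)
      fix m n assume mn: "m \<in> carrier (Mod_at M x)" "n \<in> carrier (Mod_at M x)" and eq: "?F x m = ?F x n"
      \<comment> \<open>Equal families mean that all coordinates of m - n vanish, and the
        coordinates jointly have trivial kernel.\<close>
      have "p s x (m \<ominus>\<^bsub>Mod_at M x\<^esub> n) = \<zero>\<^bsub>Mod_at M x\<^esub>" if s: "s \<in> Q" for s
      proof -
        have "\<iota> s \<in> I" using s by (simp add: I_def)
        then have "p s x m = p s x n"
          using fun_cong[OF eq, of "\<iota> s"] \<sigma>\<iota>[OF s] x mn by simp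
        moreover have "p s x (\<ominus>\<^bsub>Mod_at M x\<^esub> n) = \<ominus>\<^bsub>Mod_at M x\<^esub> p s x n"
          by (rule left_linear_maps_uminus[OF rep_homD(1)[OF ph[OF s] x] Mx.M.abelian_group_axioms Mx.M.abelian_group_axioms mn(2)])
        ultimately show ?thesis
          using rep_homD(5)[OF ph[OF s] x mn(1), of "\<ominus>\<^bsub>Mod_at M x\<^esub> n"] mn scl(2)[OF s x mn(2)]
          by (simp add: Mx.M.minus_eq Mx.M.r_neg)
      qed
      then have "m \<ominus>\<^bsub>Mod_at M x\<^esub> n = \<zero>\<^bsub>Mod_at M x\<^esub>" using inj[OF x] mn by simp
      then show "m = n" using Mx.M.diff_eq_zero_iff mn by simp
    qed
    moreover have "d \<in> ?F x ` carrier (Mod_at M x)" if d: "d \<in> carrier (Mod_at ?D x)" for d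
    proof -
      have dc: "\<And>i. i \<in> I \<Longrightarrow> d i \<in> \<sigma> i x ` carrier (Mod_at M x)" "d \<in> extensional I"
        "finite {i \<in> I. d i \<noteq> \<zero>\<^bsub>Mod_at M x\<^esub>}"
        using d unfolding direct_sum_carrier[OF NI x] by (auto simp: N_def PiE_iff)
      \<comment> \<open>The preimage of d is the sum of its finitely many nonzero components. It is
        built one component at a time: d k is fixed by its own coordinate and killed by all
        others.\<close>
      have "\<exists>m\<in>carrier (Mod_at M x). \<forall>i\<in>I. p (\<sigma> i) x m = (if i \<in> K then d i else \<zero>\<^bsub>Mod_at M x\<^esub>)"
        if "finite K" "K \<subseteq> I" for K
        using that
      proof (induction K rule: finite_induct)
        case empty
        then show ?case
          using left_linear_maps_zero[OF rep_homD(1)[OF ph x] Mx.M.abelian_group_axioms Mx.M.abelian_group_axioms] \<sigma>(1)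
          by (intro bexI[of _ "\<zero>\<^bsub>Mod_at M x\<^esub>"]) auto
      next
        case (insert k K)
        then obtain m where m: "m \<in> carrier (Mod_at M x)"
          "\<And>i. i \<in> I \<Longrightarrow> p (\<sigma> i) x m = (if i \<in> K then d i else \<zero>\<^bsub>Mod_at M x\<^esub>)" by auto
        have k: "k \<in> I" "\<sigma> k \<in> Q" using insert.prems \<sigma>(1) by auto
        obtain n where n: "n \<in> carrier (Mod_at M x)" "d k = \<sigma> k x n" using dc(1)[OF k(1)] by blast
        have dk: "d k \<in> carrier (Mod_at M x)" using scl(1)[OF k(2) x n(1)] n(2) by simp
        have "p (\<sigma> i) x (m \<oplus>\<^bsub>Mod_at M x\<^esub> d k) = (if i \<in> insert k K then d i else \<zero>\<^bsub>Mod_at M x\<^esub>)" if i: "i \<in> I" for i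
        proof (cases "i = k")
          case True
          then show ?thesis
            using rep_homD(5)[OF ph[OF k(2)] x m(1) dk] m(2)[OF i] ps[OF k(2) x n(1)] n(2) insert.hyps(2) dk by simp
        next
          case False
          then have "\<sigma> k \<noteq> \<sigma> i" using \<sigma>(2) i k(1) by metis
          then have "p (\<sigma> i) x (d k) = \<zero>\<^bsub>Mod_at M x\<^esub>" using pt[OF \<sigma>(1)[OF i] k(2) _ x n(1)] n(2) by simp
          then show ?thesis
            using rep_homD(5)[OF ph[OF \<sigma>(1)[OF i]] x m(1) dk] m(2)[OF i] False scl(2)[OF \<sigma>(1)[OF i] x m(1)] by auto
        qed
        then show ?case using m(1) dk by (intro bexI[of _ "m \<oplus>\<^bsub>Mod_at M x\<^esub> d k"]) auto
      qed
      \<comment> \<open>K is taken to be the support of d, so the default value zero agrees with d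
        outside K.\<close>
      from this[OF dc(3)] obtain m where m: "m \<in> carrier (Mod_at M x)" "\<And>i. i \<in> I \<Longrightarrow> p (\<sigma> i) x m = d i" by auto
      have "?F x m = (\<lambda>i\<in>I. p (\<sigma> i) x m)" using x m(1) by simp
      also have "\<dots> = d" by (rule extensionalityI[of _ I]) (simp_all add: dc(2) m(2))
      finally have "?F x m = d" .
      show ?thesis by (rule image_eqI[where f = "?F x", OF \<open>?F x m = d\<close>[symmetric] m(1)])
    qed
    moreover have "?F x ` carrier (Mod_at M x) \<subseteq> carrier (Mod_at ?D x)"
      using rep_homD(4)[OF F x] by blast
    ultimately show ?thesis by (intro bij_betw_imageI equalityI) (assumption | rule subsetI)+
  qed
  with M direct_sum_left_module[OF NI] F have "rep_iso S M ?D" by (rule rep_iso_of_bij)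
  then show ?thesis using N by blast
qed

end
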